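(* Let $f\colon \mathbb{N}\to \mathbb{N}$ be an increasing, submultiplicative function, let $\omega\colon \mathbb{N}\to \mathbb{N}$ be a non-decreasing super-polynomial function (arbitrarily slow), and let $\delta\colon \mathbb{N}\to\mathbb{N}$ be a non-decreasing function tending to infinity (arbitrarily slowly), with $\delta(n)\le n$ for all $n$. Let $F$ be an arbitrary field. Then there exists a finitely generated nil algebra $R$ over $F$ whose growth function $g_R(n)$ satisfies $$ f\left(\frac{n}{\delta(n)}\right) \preceq g_R(n) \preceq \omega(n)\cdot f(n). $$
   Context: $\mathbb{N}=\{1,2,\dots\}$. For $f\colon\mathbb{N}\to\mathbb{N}$ and real $x\ge 1$, $f(x)$ means $f(\lfloor x\rfloor)$. "Increasing" means $f(n)<f(n+1)$ for all $n$; "submultiplicative" means $f(n+m)\le f(n)f(m)$ for all $n,m$. A function $\omega$ is super-polynomial if $\omega(n)/n^d\to\infty$ as $n\to\infty$ for every $d>0$. Algebras are associative and not necessarily unital; an algebra is nil if every element of it is nilpotent. If an algebra $A$ over $F$ is generated by a finite-dimensional subspace $V$, its growth function with respect to $V$ is $g_{A,V}(n)=\dim_F(F+V+V^2+\cdots+V^n)$ (computed in the unital hull of $A$ if $A$ is non-unital). For functions $f,g$, write $f\preceq g$ if there exist $C,D>0$ such that $f(n)\le C g(Dn)$ for all $n\in\mathbb{N}$; $f\sim g$ means $f\preceq g$ and $g\preceq f$. Up to $\sim$, $g_{A,V}$ does not depend on $V$, and $g_A$ denotes it for any choice of $V$. *)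

theory Defs
  imports
    Complex_Main
    "HOL-Library.FuncSet"
    "HOL-Library.Poly_Mapping"
    "HOL-Library.Product_Plus"
begin

text \<open>
  An associative, not necessarily unital algebra over the field \<open>'f\<close>. The underlying vector
  space is a subspace \<open>A\<close> of an ambient vector space \<open>'v\<close>; \<open>prod\<close> is only constrained on \<open>A\<close>.
\<close>

locale assoc_algebra = vector_space scale
  for scale :: "'f::field \<Rightarrow> 'v::ab_group_add \<Rightarrow> 'v" +
  fixes prod :: "'v \<Rightarrow> 'v \<Rightarrow> 'v" (infixl "\<odot>" 70)
    and A :: "'v set"
  assumes subspace_carrier: "subspace A"
    and prod_closed: "x \<in> A \<Longrightarrow> y \<in> A \<Longrightarrow> x \<odot> y \<in> A"
    and prod_assoc: "x \<in> A \<Longrightarrow> y \<in> A \<Longrightarrow> z \<in> A \<Longrightarrow> (x \<odot> y) \<odot> z = x \<odot> (y \<odot> z)"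
    and prod_add_left: "x \<in> A \<Longrightarrow> y \<in> A \<Longrightarrow> z \<in> A \<Longrightarrow> (x + y) \<odot> z = x \<odot> z + y \<odot> z"
    and prod_add_right: "x \<in> A \<Longrightarrow> y \<in> A \<Longrightarrow> z \<in> A \<Longrightarrow> x \<odot> (y + z) = x \<odot> y + x \<odot> z"
    and prod_scale_left: "x \<in> A \<Longrightarrow> y \<in> A \<Longrightarrow> scale c x \<odot> y = scale c (x \<odot> y)"
    and prod_scale_right: "x \<in> A \<Longrightarrow> y \<in> A \<Longrightarrow> x \<odot> scale c y = scale c (x \<odot> y)"
begin

text \<open>There is no zeroth power without a unit, so exponents are shifted: \<open>pow_Suc x n\<close> is
  \<open>x\<close> to the power \<open>n + 1\<close>, and similarly for powers of a subspace.\<close>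

primrec pow_Suc :: "'v \<Rightarrow> nat \<Rightarrow> 'v" where
  "pow_Suc x 0 = x"
| "pow_Suc x (Suc n) = pow_Suc x n \<odot> x"

definition nil_algebra :: bool where
  "nil_algebra \<longleftrightarrow> (\<forall>x\<in>A. \<exists>n. pow_Suc x n = 0)"

definition subalgebra :: "'v set \<Rightarrow> bool" where
  "subalgebra B \<longleftrightarrow> B \<subseteq> A \<and> subspace B \<and> (\<forall>x\<in>B. \<forall>y\<in>B. x \<odot> y \<in> B)"

definition generates :: "'v set \<Rightarrow> bool" where
  "generates V \<longleftrightarrow> V \<subseteq> A \<and> (\<forall>B. subalgebra B \<and> V \<subseteq> B \<longrightarrow> B = A)"

definition finitely_generated :: bool where
  "finitely_generated \<longleftrightarrow> (\<exists>S. finite S \<and> generates S)"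

definition fin_dim_subspace :: "'v set \<Rightarrow> bool" where
  "fin_dim_subspace V \<longleftrightarrow> (\<exists>S. finite S \<and> V = span S)"

primrec space_pow_Suc :: "'v set \<Rightarrow> nat \<Rightarrow> 'v set" where
  "space_pow_Suc V 0 = V"
| "space_pow_Suc V (Suc n) = span {x \<odot> y | x y. x \<in> space_pow_Suc V n \<and> y \<in> V}"

definition is_unit :: "'v \<Rightarrow> bool" where
  "is_unit e \<longleftrightarrow> e \<in> A \<and> (\<forall>x\<in>A. e \<odot> x = x \<and> x \<odot> e = x)"

text \<open>The dimension of \<open>F e + V + V\<^sup>2 + \<dots> + V\<^sup>n\<close>, where \<open>e\<close> is the unit.\<close>

definition unital_growth :: "'v \<Rightarrow> 'v set \<Rightarrow> nat \<Rightarrow> nat" where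
  "unital_growth e V n = dim (span (insert e (\<Union>k<n. space_pow_Suc V k)))"

text \<open>The unital hull: the vector space \<open>F \<times> A\<close>, with \<open>(a, x)\<close> standing for \<open>a 1 + x\<close>.\<close>

definition hull_scale :: "'f \<Rightarrow> 'f \<times> 'v \<Rightarrow> 'f \<times> 'v" where
  "hull_scale c p = (c * fst p, scale c (snd p))"

definition hull_prod :: "'f \<times> 'v \<Rightarrow> 'f \<times> 'v \<Rightarrow> 'f \<times> 'v" where
  "hull_prod p q =
     (fst p * fst q, scale (fst p) (snd q) + scale (fst q) (snd p) + snd p \<odot> snd q)"

definition hull_carrier :: "('f \<times> 'v) set" where
  "hull_carrier = UNIV \<times> A"

end

context assoc_algebra
begin

lemma vector_space_hull: "vector_space hull_scale"
  by unfold_locales (auto simp: hull_scale_def algebra_simps)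

lemma assoc_algebra_hull: "assoc_algebra hull_scale hull_prod hull_carrier"
proof -
  interpret H: vector_space hull_scale by (rule vector_space_hull)
  note clo = subspace_add[OF subspace_carrier] subspace_scale[OF subspace_carrier]
    subspace_0[OF subspace_carrier] prod_closed
  note prods = prod_assoc prod_add_left prod_add_right prod_scale_left prod_scale_right
  show ?thesis
  proof unfold_locales
    show "H.subspace hull_carrier"
      unfolding H.subspace_def by (auto simp: hull_carrier_def hull_scale_def clo zero_prod_def)
  qed (auto simp: hull_carrier_def hull_scale_def hull_prod_def clo prods algebra_simps)
qed

lemma is_unit_hull: "assoc_algebra.is_unit hull_prod hull_carrier (1, 0)"
proof -
  interpret H: assoc_algebra hull_scale hull_prod hull_carrier by (rule assoc_algebra_hull)
  have 0: "0 \<odot> x = 0" "x \<odot> 0 = 0" if "x \<in> A" for x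
    using that prod_scale_left[of x x 0] prod_scale_right[of x x 0] by simp_all
  show ?thesis
    unfolding H.is_unit_def
    by (auto simp: hull_carrier_def hull_prod_def 0 subspace_0[OF subspace_carrier])
qed

definition growth :: "'v set \<Rightarrow> nat \<Rightarrow> nat" where
  "growth V n =
     (if \<exists>e. is_unit e then unital_growth (THE e. is_unit e) V n
      else assoc_algebra.unital_growth hull_scale hull_prod (1, 0) ({0} \<times> V) n)"

end

text \<open>
  The ambient space in which a finitely generated algebra is sought. Such an algebra has countable
  dimension, so up to isomorphism its underlying vector space is a subspace of this one.
\<close>

type_synonym 'f word_space = "nat list \<Rightarrow>\<^sub>0 'f"

text \<open>
  Functions on the positive integers are functions on \<open>nat\<close> whose value at 0 is irrelevant.
\<close>

definition at_real :: "(nat \<Rightarrow> nat) \<Rightarrow> real \<Rightarrow> nat" where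
  "at_real f x = f (nat \<lfloor>x\<rfloor>)"

definition asymp_le :: "(nat \<Rightarrow> nat) \<Rightarrow> (nat \<Rightarrow> nat) \<Rightarrow> bool" (infix "\<preceq>" 50) where
  "f \<preceq> g \<longleftrightarrow>
     (\<exists>C::real. \<exists>D::nat. C > 0 \<and> D > 0 \<and> (\<forall>n\<ge>1. real (f n) \<le> C * real (g (D * n))))"

definition increasing :: "(nat \<Rightarrow> nat) \<Rightarrow> bool" where
  "increasing f \<longleftrightarrow> (\<forall>n\<ge>1. f n < f (n + 1))"

definition submultiplicative :: "(nat \<Rightarrow> nat) \<Rightarrow> bool" where
  "submultiplicative f \<longleftrightarrow> (\<forall>n\<ge>1. \<forall>m\<ge>1. f (n + m) \<le> f n * f m)"

definition super_polynomial :: "(nat \<Rightarrow> nat) \<Rightarrow> bool" where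
  "super_polynomial \<omega> \<longleftrightarrow>
     (\<forall>d::real. d > 0 \<longrightarrow> filterlim (\<lambda>n. real (\<omega> n) / real n powr d) at_top sequentially)"

end

theory Submission
  imports Defs "HOL-Combinatorics.Multiset_Permutations"
begin

text \<open>
  The algebra is the quotient of a free algebra on the letters 0, 1, 2 by the largest ideal killed by
  a family of functionals on words, so that its growth is a matrix rank.

  Functionals \<open>G k\<close> on binary words are built like Toeplitz words: the letters at the positions of
  level \<open>k\<close> are read in groups, and each group is evaluated by a coefficient function of small support.
  If \<open>x\<close> has degree below \<open>d\<close>, then, whatever the coefficients of \<open>x\<close>, the part of a high power of
  \<open>x\<close> inside a cell lies in the span of elements obtained by summing over all orders of a multiset of
  words. The number of these elements is polynomial in the cell length, whereas a group can be filled in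
  exponentially many ways; so coefficients of polynomial support exist that annihilate all of them. As
  \<open>d\<close> may grow arbitrarily slowly with the level, the quotient defined by the \<open>G k\<close> is nil and of
  arbitrarily slow super-polynomial growth, over every field.

  The letter 2 separates binary words, and the words \<open>2 b\<^sub>1 2 b\<^sub>2 \<dots> b\<^sub>n 2\<close> are evaluated by products
  of the \<open>G j\<^sub>i (b\<^sub>i)\<close>, where \<open>j\<^sub>1 \<dots> j\<^sub>n\<close> runs through relabelled copies of a language of growth
  about \<open>f\<close>. Each copy is truncated, and the next one uses letters of larger weight. Truncation
  preserves nilness, and the weights in use at length \<open>n\<close> stay below \<open>\<delta> n\<close>.
\<close>

section \<open>Linear systems and matrix rank\<close>

text \<open>Two demands on the coefficients of a level pull against each other. They must vanish on
  all relations of that level, and their support must stay small, because the rank of a window is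
  controlled by a product of support sizes over the levels that it meets. A support with one point
  more than there are relations meets both demands. The binary words supply slow growth only; the
  growth of f is carried by words with the letter 2. An element all of whose words contain 2 would
  have no reason to be nilpotent if one infinite language were used with fixed weights. Letting the
  index j demand a gap of length exactly \<open>period j - 1\<close> cures this: two consecutive
  factors of bounded degree enclose a short gap, and short gaps occur only in copies of small index,
  which are finite. The price is that x index letters of weight at most b cost about x b letters,
  whence the argument n / \<delta> n in the lower bound. A general element combines both mechanisms:
  a power of its binary part vanishes, and what is left of the same power of the element has a 2 (or
  a vanishing letter) in every word.\<close>

lemma homogeneous_system_nontrivial_solution:
  fixes v :: "nat \<Rightarrow> 'a \<Rightarrow> 'f::field"
  assumes "finite S" "n < card S"
  shows "\<exists>a. (\<exists>s\<in>S. a s \<noteq> 0) \<and> (\<forall>i<n. (\<Sum>s\<in>S. a s * v i s) = 0)"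
  using assms
proof (induction n arbitrary: S v)
  case 0
  then obtain s where "s \<in> S" by fastforce
  then show ?case by (intro exI[of _ "\<lambda>_. 1"]) auto
next
  case (Suc n)
  show ?case
  proof (cases "\<forall>s\<in>S. v n s = 0")
    case True
    obtain a where a: "\<exists>s\<in>S. a s \<noteq> 0" "\<forall>i<n. (\<Sum>s\<in>S. a s * v i s) = 0"
      using Suc.IH[of S v] Suc.prems by auto
    have "\<forall>i<Suc n. (\<Sum>s\<in>S. a s * v i s) = 0"
      using a(2) True by (auto simp: less_Suc_eq)
    then show ?thesis using a(1) by blast
  next
    case False
    then obtain p where p: "p \<in> S" "v n p \<noteq> 0" by blast
    define S' where "S' = S - {p}"
    define v' where "v' i s = v i s - v i p * v n s / v n p" for i s
    have fin: "finite S'" "n < card S'"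
      using Suc.prems p by (auto simp: S'_def card_Diff_singleton)
    obtain a where a: "\<exists>s\<in>S'. a s \<noteq> 0" "\<And>i. i < n \<Longrightarrow> (\<Sum>s\<in>S'. a s * v' i s) = 0"
      using Suc.IH[OF fin, of v'] by blast
    define b where "b = a(p := - (\<Sum>s\<in>S'. a s * v n s) / v n p)"
    have split: "(\<Sum>s\<in>S. b s * v i s) = b p * v i p + (\<Sum>s\<in>S'. a s * v i s)" for i
    proof -
      have "(\<Sum>s\<in>S. b s * v i s) = b p * v i p + (\<Sum>s\<in>S'. b s * v i s)"
        unfolding S'_def using Suc.prems p by (simp add: sum.remove)
      also have "(\<Sum>s\<in>S'. b s * v i s) = (\<Sum>s\<in>S'. a s * v i s)"
        by (rule sum.cong) (auto simp: b_def S'_def)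
      finally show ?thesis .
    qed
    have "(\<Sum>s\<in>S. b s * v i s) = 0" if "i < Suc n" for i
    proof (cases "i = n")
      case True
      then show ?thesis using split[of n] p by (simp add: b_def)
    next
      case False
      with that have "i < n" by simp
      have "(\<Sum>s\<in>S'. a s * v' i s) = (\<Sum>s\<in>S'. a s * v i s - v i p / v n p * (a s * v n s))"
        by (rule sum.cong) (auto simp: v'_def algebra_simps)
      also have "\<dots> = (\<Sum>s\<in>S'. a s * v i s) - v i p / v n p * (\<Sum>s\<in>S'. a s * v n s)"
        by (simp add: sum_subtractf sum_distrib_left)
      finally show ?thesis using split[of i] a(2)[OF \<open>i < n\<close>] p
        by (simp add: b_def field_simps)
    qed
    moreover have "\<exists>s\<in>S. b s \<noteq> 0" using a(1) by (auto simp: b_def S'_def)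
    ultimately show ?thesis by blast
  qed
qed

text \<open>A bound on the rank, given as a factorisation through n coordinates: rows and columns
  may form infinite sets, and sums, products and pullbacks of factorisations are explicit.\<close>

definition rank_le :: "'c set \<Rightarrow> 'u set \<Rightarrow> ('c \<Rightarrow> 'u \<Rightarrow> 'f::field) \<Rightarrow> nat \<Rightarrow> bool" where
  "rank_le C U M n \<longleftrightarrow> (\<exists>\<alpha> \<beta>. \<forall>c\<in>C. \<forall>u\<in>U. M c u = (\<Sum>i<n. \<alpha> c i * \<beta> i u))"

lemma rank_leI_sum:
  assumes "finite J" "card J \<le> n"
    and "\<And>c u. c \<in> C \<Longrightarrow> u \<in> U \<Longrightarrow> M c u = (\<Sum>j\<in>J. \<alpha> c j * \<beta> j u)"
  shows "rank_le C U M n"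
proof -
  obtain h where h: "bij_betw h {0..<card J} J" using ex_bij_betw_nat_finite[OF assms(1)] by blast
  define \<alpha>' where "\<alpha>' c i = (if i < card J then \<alpha> c (h i) else 0)" for c i
  have "M c u = (\<Sum>i<n. \<alpha>' c i * \<beta> (h i) u)" if "c \<in> C" "u \<in> U" for c u
  proof -
    have "M c u = (\<Sum>i\<in>{0..<card J}. \<alpha> c (h i) * \<beta> (h i) u)"
      using assms(3)[OF that] sum.reindex_bij_betw[OF h, of "\<lambda>j. \<alpha> c j * \<beta> j u"] by simp
    also have "\<dots> = (\<Sum>i<n. \<alpha>' c i * \<beta> (h i) u)"
      using assms(2) by (intro sum.mono_neutral_cong_left) (auto simp: \<alpha>'_def)
    finally show ?thesis .
  qed
  then show ?thesis
    unfolding rank_le_def by (intro exI[of _ \<alpha>'] exI[of _ "\<lambda>i. \<beta> (h i)"]) simp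
qed

lemma rank_le_mono:
  assumes "rank_le C U M n" "n \<le> n'" "C' \<subseteq> C" "U' \<subseteq> U"
  shows "rank_le C' U' M n'"
proof -
  obtain \<alpha> \<beta> where "\<forall>c\<in>C. \<forall>u\<in>U. M c u = (\<Sum>i<n. \<alpha> c i * \<beta> i u)"
    using assms(1) unfolding rank_le_def by blast
  with assms show ?thesis by (intro rank_leI_sum[of "{..<n}" _ _ _ _ \<alpha> \<beta>]) auto
qed

lemma rank_le_cong:
  assumes "\<And>c u. c \<in> C \<Longrightarrow> u \<in> U \<Longrightarrow> M c u = M' c u"
  shows "rank_le C U M n \<longleftrightarrow> rank_le C U M' n"
  using assms unfolding rank_le_def by simp

lemma rank_le_outer: "rank_le C U (\<lambda>c u. \<alpha> c * \<beta> u) 1"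
  by (rule rank_leI_sum[of "{()}" _ _ _ _ "\<lambda>c _. \<alpha> c" "\<lambda>_. \<beta>"]) auto

lemma rank_le_mult:
  assumes "rank_le C U M n" "rank_le C U M' n'"
  shows "rank_le C U (\<lambda>c u. M c u * M' c u) (n * n')"
proof -
  obtain \<alpha> \<beta> where 1: "\<forall>c\<in>C. \<forall>u\<in>U. M c u = (\<Sum>i<n. \<alpha> c i * \<beta> i u)"
    using assms(1) unfolding rank_le_def by blast
  obtain \<alpha>' \<beta>' where 2: "\<forall>c\<in>C. \<forall>u\<in>U. M' c u = (\<Sum>i<n'. \<alpha>' c i * \<beta>' i u)"
    using assms(2) unfolding rank_le_def by blast
  show ?thesis
    by (rule rank_leI_sum[of "{..<n} \<times> {..<n'}" _ _ _ _ "\<lambda>c (i, i'). \<alpha> c i * \<alpha>' c i'"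
          "\<lambda>(i, i') u. \<beta> i u * \<beta>' i' u"])
      (simp_all add: 1 2 sum_product sum.cartesian_product card_cartesian_product split_def
         mult.assoc mult.left_commute)
qed

lemma rank_le_prod:
  assumes "finite J" "\<And>j. j \<in> J \<Longrightarrow> rank_le C U (M j) (n j)"
  shows "rank_le C U (\<lambda>c u. \<Prod>j\<in>J. M j c u) (\<Prod>j\<in>J. n j)"
  using assms
proof (induction J rule: finite_induct)
  case empty
  then show ?case using rank_le_outer[of C U "\<lambda>_. 1" "\<lambda>_. 1"] by simp
next
  case (insert j J)
  then show ?case using rank_le_mult[of C U "M j" "n j"] by simp
qed

lemma rank_le_sum:
  assumes "finite J" "\<And>j. j \<in> J \<Longrightarrow> rank_le C U (M j) (n j)"
  shows "rank_le C U (\<lambda>c u. \<Sum>j\<in>J. M j c u) (\<Sum>j\<in>J. n j)"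
proof -
  have "\<forall>j\<in>J. \<exists>\<alpha> \<beta>. \<forall>c\<in>C. \<forall>u\<in>U. M j c u = (\<Sum>i<n j. \<alpha> c i * \<beta> i u)"
    using assms(2) unfolding rank_le_def by blast
  then obtain \<alpha> \<beta> where
    1: "\<And>j c u. j \<in> J \<Longrightarrow> c \<in> C \<Longrightarrow> u \<in> U \<Longrightarrow> M j c u = (\<Sum>i<n j. \<alpha> j c i * \<beta> j i u)"
    by metis
  show ?thesis
    by (rule rank_leI_sum[of "Sigma J (\<lambda>j. {..<n j})" _ _ _ _ "\<lambda>c (j, i). \<alpha> j c i"
          "\<lambda>(j, i) u. \<beta> j i u"])
      (use assms(1) in \<open>auto simp: 1 sum.Sigma split_def intro!: sum.cong\<close>)
qed

text \<open>Each row is assigned to one piece that contains it; the matrix is then a sum of blocks,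
  one for each piece, and ranks of summands add.\<close>

lemma rank_le_UN_rows:
  assumes "finite J" "\<And>j. j \<in> J \<Longrightarrow> rank_le (C j) U M n" "\<And>c. c \<in> D \<Longrightarrow> \<exists>j\<in>J. c \<in> C j"
  shows "rank_le D U M (card J * n)"
proof -
  obtain r where r: "\<And>c. c \<in> D \<Longrightarrow> r c \<in> J \<and> c \<in> C (r c)" using assms(3) by metis
  have "rank_le D U (\<lambda>c u. \<Sum>j\<in>J. if r c = j then M c u else 0) (\<Sum>j\<in>J. n)"
  proof (intro rank_le_sum assms(1))
    fix j assume "j \<in> J"
    obtain \<alpha> \<beta> where "\<forall>c\<in>C j. \<forall>u\<in>U. M c u = (\<Sum>i<n. \<alpha> c i * \<beta> i u)"
      using assms(2)[OF \<open>j \<in> J\<close>] unfolding rank_le_def by blast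
    then show "rank_le D U (\<lambda>c u. if r c = j then M c u else 0) n"
      using r unfolding rank_le_def
      by (intro exI[of _ "\<lambda>c i. if r c = j then \<alpha> c i else 0"] exI[of _ \<beta>]) fastforce
  qed
  moreover have "(\<Sum>j\<in>J. if r c = j then M c u else 0) = M c u" if "c \<in> D" for c u
    using r[OF that] assms(1) by simp
  ultimately show ?thesis
    using rank_le_cong[of D U "\<lambda>c u. \<Sum>j\<in>J. if r c = j then M c u else 0" M] by simp
qed

lemma rank_le_transpose: "rank_le C U M n \<longleftrightarrow> rank_le U C (\<lambda>u c. M c u) n"
proof -
  have "rank_le U C (\<lambda>u c. M c u) n" if "rank_le C U M n"
    for C :: "'x set" and U :: "'y set" and M :: "'x \<Rightarrow> 'y \<Rightarrow> 'f::field"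
    proof -
    obtain \<alpha> \<beta> where "\<forall>c\<in>C. \<forall>u\<in>U. M c u = (\<Sum>i<n. \<alpha> c i * \<beta> i u)"
      using \<open>rank_le C U M n\<close> unfolding rank_le_def by blast
    then show ?thesis unfolding rank_le_def
      by (intro exI[of _ "\<lambda>u i. \<beta> i u"] exI[of _ "\<lambda>i c. \<alpha> c i"]) (simp add: mult.commute)
  qed
  from this[of C U M] this[of U C "\<lambda>u c. M c u"] show ?thesis by blast
qed

lemma rank_le_UN_cols:
  assumes "finite J" "\<And>j. j \<in> J \<Longrightarrow> rank_le C (U j) M n" "\<And>u. u \<in> D \<Longrightarrow> \<exists>j\<in>J. u \<in> U j"
  shows "rank_le C D M (card J * n)"
  using rank_le_UN_rows[of J U C "\<lambda>u c. M c u" n D] assms rank_le_transpose by blast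

lemma rank_le_pullback:
  assumes "rank_le C U M n" "\<And>c. c \<in> C' \<Longrightarrow> g c \<in> C" "\<And>u. u \<in> U' \<Longrightarrow> h u \<in> U"
  shows "rank_le C' U' (\<lambda>c u. M (g c) (h u)) n"
proof -
  obtain \<alpha> \<beta> where "\<forall>c\<in>C. \<forall>u\<in>U. M c u = (\<Sum>i<n. \<alpha> c i * \<beta> i u)"
    using assms(1) unfolding rank_le_def by blast
  then show ?thesis using assms(2,3) unfolding rank_le_def
    by (intro exI[of _ "\<lambda>c. \<alpha> (g c)"] exI[of _ "\<lambda>i u. \<beta> i (h u)"]) auto
qed

lemma rank_le_scale:
  assumes "rank_le C U M n"
  shows "rank_le C U (\<lambda>c u. a c * b u * M c u) n"
  using rank_le_mult[OF rank_le_outer[of C U a b] assms] by simp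

text \<open>The argument of \<open>\<phi>\<close> is a list whose entries come partly from the row
  and partly from the column. The indicator that it equals a fixed t is a row condition times a
  column condition, so each point of the support contributes rank one.\<close>

lemma rank_le_finite_support:
  assumes "finite S" "card S \<le> n" "\<And>t. t \<notin> S \<Longrightarrow> \<phi> t = 0"
    and "\<And>c u. c \<in> C \<Longrightarrow> u \<in> U \<Longrightarrow>
      M c u = \<phi> (map (\<lambda>i. if i \<in> A then g c i else h u i) xs)"
  shows "rank_le C U M n"
proof (rule rank_leI_sum[OF assms(1,2)])
  fix c u assume cu: "c \<in> C" "u \<in> U"
  define l where "l = map (\<lambda>i. if i \<in> A then g c i else h u i) xs"
  have eq: "of_bool (l = t) = 
     of_bool (length t = length xs \<and> (\<forall>j<length xs. xs ! j \<in> A \<longrightarrow> g c (xs ! j) = t ! j)) *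
     (of_bool (\<forall>j<length xs. xs ! j \<notin> A \<longrightarrow> h u (xs ! j) = t ! j) :: 'b)" for t
    by (auto simp: l_def list_eq_iff_nth_eq)
  have "M c u = (\<Sum>t\<in>S. \<phi> t * of_bool (l = t))"
    using assms(1,3) assms(4)[OF cu] by (auto simp: l_def[symmetric] of_bool_def if_distrib cong: if_cong)
  also have "\<dots> = (\<Sum>t\<in>S. (\<phi> t * of_bool (length t = length xs \<and> (\<forall>j<length xs. xs ! j \<in> A \<longrightarrow> g c (xs ! j) = t ! j))) *
       of_bool (\<forall>j<length xs. xs ! j \<notin> A \<longrightarrow> h u (xs ! j) = t ! j))"
    by (simp add: eq mult.assoc)
  finally show "M c u = (\<Sum>t\<in>S. (\<phi> t * of_bool (length t = length xs \<and> (\<forall>j<length xs. xs ! j \<in> A \<longrightarrow> g c (xs ! j) = t ! j))) *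
       of_bool (\<forall>j<length xs. xs ! j \<notin> A \<longrightarrow> h u (xs ! j) = t ! j))" .
qed

section \<open>The free algebra\<close>

alias lookup = Poly_Mapping.lookup
alias keys = Poly_Mapping.keys

text \<open>With concatenation as the addition of exponents, the convolution product of
  \<open>Poly_Mapping\<close> is the multiplication of the free algebra.\<close>

instantiation list :: (type) monoid_add
begin

definition zero_list :: "'a list" where "zero_list = []"

definition plus_list :: "'a list \<Rightarrow> 'a list \<Rightarrow> 'a list" where "plus_list = (@)"

instance by standard (auto simp: zero_list_def plus_list_def)

end

definition mon :: "nat list \<Rightarrow> 'f::field word_space" where
  "mon w = Poly_Mapping.single w 1"

definition smul :: "'f::field \<Rightarrow> 'f word_space \<Rightarrow> 'f word_space" where
  "smul a z = Poly_Mapping.single 0 a * z"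

lemma lookup_smul [simp]: "lookup (smul a z) w = a * lookup z w"
  unfolding smul_def by (simp flip: mult_map_scale_conv_mult add: map.rep_eq when_def)

global_interpretation T: vector_space smul
  by unfold_locales (auto simp: smul_def distrib_left distrib_right single_add mult_single simp flip: mult.assoc)

lemma smul_mult_left: "smul a x * y = smul a (x * y)"
  by (simp add: smul_def mult.assoc)

lemma word_expansion: "z = (\<Sum>w\<in>keys z. smul (lookup z w) (mon w))"
  by (rule poly_mapping_eqI)
    (simp add: lookup_sum mon_def lookup_single when_def in_keys_iff if_distrib[of "\<lambda>x. _ * x"] cong: if_cong)

lemma smul_mult_right: "x * smul a y = smul a (x * y)"
proof -
  have 1: "mon w * smul a y = smul a (mon w * y)" for w
    unfolding smul_def mon_def mult.assoc[symmetric] mult_single by simp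
  show ?thesis
    by (subst (1 2) word_expansion[of x])
      (simp add: sum_distrib_right smul_mult_left 1 T.scale_sum_right mult.commute)
qed

lemma mon_mult: "mon u * mon v = mon (u @ v)"
  by (simp add: mon_def mult_single plus_list_def)

lemma mon_Nil: "mon [] = 1"
  by (simp add: mon_def zero_list_def[symmetric])

definition ev :: "(nat list \<Rightarrow> 'f::field) \<Rightarrow> 'f word_space \<Rightarrow> 'f" where
  "ev \<phi> z = (\<Sum>w\<in>keys z. lookup z w * \<phi> w)"

lemma ev_superset: "finite A \<Longrightarrow> keys z \<subseteq> A \<Longrightarrow> ev \<phi> z = (\<Sum>w\<in>A. lookup z w * \<phi> w)"
  unfolding ev_def by (rule sum.mono_neutral_left) (auto simp: in_keys_iff)

lemma ev_add: "ev \<phi> (x + y) = ev \<phi> x + ev \<phi> y"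
proof -
  have "keys (x + y) \<subseteq> keys x \<union> keys y" by (rule Poly_Mapping.keys_add)
  then show ?thesis
    by (simp add: ev_superset[of "keys x \<union> keys y"] lookup_add algebra_simps sum.distrib)
qed

lemma ev_smul: "ev \<phi> (smul a x) = a * ev \<phi> x"
proof -
  have "keys (smul a x) \<subseteq> keys x" by (auto simp: in_keys_iff)
  then show ?thesis by (simp add: ev_superset[of "keys x"] sum_distrib_left mult.assoc)
qed

lemma ev_mon [simp]: "ev \<phi> (mon w) = \<phi> w"
  by (simp add: ev_def mon_def)

lemma ev_0 [simp]: "ev \<phi> 0 = 0"
  by (simp add: ev_def)

lemma ev_sum: "ev \<phi> (\<Sum>i\<in>A. x i) = (\<Sum>i\<in>A. ev \<phi> (x i))"
  by (induction A rule: infinite_finite_induct) (auto simp: ev_add)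

lemma ev_mon_mult_mon: "ev \<phi> (mon p * z * mon s) = ev (\<lambda>u. \<phi> (p @ u @ s)) z"
proof -
  have "ev \<phi> (mon p * z * mon s) =
      ev \<phi> (mon p * (\<Sum>w\<in>keys z. smul (lookup z w) (mon w)) * mon s)"
    using word_expansion[of z] by simp
  also have "\<dots> = (\<Sum>w\<in>keys z. lookup z w * \<phi> (p @ w @ s))"
    by (simp add: sum_distrib_left sum_distrib_right smul_mult_left smul_mult_right mon_mult
        ev_sum ev_smul)
  finally show ?thesis by (simp add: ev_def)
qed

lemma keys_smul_subset: "keys (smul a z) \<subseteq> keys z"
  by (auto simp: in_keys_iff)

lemma keys_mult_subset: "keys (x * y) \<subseteq> {u @ v | u v. u \<in> keys x \<and> v \<in> keys y}"
  using keys_mult[of x y] by (simp add: plus_list_def)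

section \<open>Toeplitz functionals on binary words\<close>

text \<open>With q = \<open>fpow k\<close>, the identity q^2 - 1 = (q - 1) (q + 1) makes each period
  divide the next and puts q letters in a group. Squaring from level to level also places every n
  \<ge> 2 between some q and q^2, so that bounds in terms of q are polynomial in n.\<close>

definition fpow :: "nat \<Rightarrow> nat" where "fpow k = 2 ^ (2 ^ k)"
definition period :: "nat \<Rightarrow> nat" where "period k = fpow k - 1"
definition radix :: "nat \<Rightarrow> nat" where "radix k = fpow k + 1"

lemma fpow_Suc: "fpow (Suc k) = fpow k ^ 2"
  by (simp add: fpow_def power_mult mult.commute flip: power_mult)

lemma fpow_ge_2: "fpow k \<ge> 2"
  unfolding fpow_def using self_le_power[of "2::nat" "2 ^ k"] by simp

lemma period_0 [simp]: "period 0 = 1"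
  by (simp add: period_def fpow_def)

lemma fpow_eq: "fpow k = period k + 1"
  using fpow_ge_2[of k] by (simp add: period_def)

lemma period_pos [simp]: "period k > 0"
  using fpow_ge_2[of k] by (simp add: period_def)

lemma period_neq_0 [simp]: "period k \<noteq> 0"
  using period_pos[of k] by linarith

lemma radix_eq: "radix k = period k + 2"
  by (simp add: radix_def fpow_eq)

lemma period_Suc: "period (Suc k) = period k * radix k"
  using fpow_Suc[of k] by (simp add: fpow_eq radix_eq power2_eq_square algebra_simps)

lemma period_dvd: "k \<le> l \<Longrightarrow> period k dvd period l"
  by (induction l rule: dec_induct) (auto simp: period_Suc)

lemma period_strict_mono: "strict_mono period"
  by (simp add: strict_mono_Suc_iff period_Suc radix_eq)

lemma period_gt: "k < period k"
proof (induction k)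
  case (Suc k)
  then show ?case using period_strict_mono[unfolded strict_mono_def, rule_format, of k "Suc k"] by simp
qed simp

text \<open>Positions in words are counted from 1. The positions divisible by \<open>period k\<close> but not by
  \<open>period (Suc k)\<close> are grouped into tuples \<open>blk y k j\<close>, one for every interval of positions between
  successive multiples of \<open>period (Suc k)\<close>.\<close>

definition blk :: "(nat \<Rightarrow> nat) \<Rightarrow> nat \<Rightarrow> nat \<Rightarrow> nat list" where
  "blk y k j = map (\<lambda>i. y (j * period (Suc k) + i * period k)) [1..<radix k]"

definition cells :: "nat \<Rightarrow> (nat \<times> nat) set" where
  "cells K = (SIGMA k:{..<K}. {..<period K div period (Suc k)})"

definition tval :: "(nat \<Rightarrow> nat list \<Rightarrow> 'f::field) \<Rightarrow> nat \<Rightarrow> (nat \<Rightarrow> nat) \<Rightarrow> 'f" where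
  "tval c K y = (\<Prod>(k, j)\<in>cells K. c k (blk y k j))"

text \<open>The length \<open>period K - 1\<close> stops just before the first position of level at
  least K, so every letter belongs to exactly one cell of \<open>cells K\<close>.\<close>

definition toep :: "(nat \<Rightarrow> nat list \<Rightarrow> 'f::field) \<Rightarrow> nat \<Rightarrow> nat list \<Rightarrow> 'f" where
  "toep c K u = (if length u = period K - 1 \<and> set u \<subseteq> {0, 1}
     then tval c K (\<lambda>i. u ! (i - 1)) else 0)"

lemma finite_cells [simp]: "finite (cells K)"
  by (simp add: cells_def)

lemma blk_cong:
  assumes "\<And>i. 1 \<le> i \<Longrightarrow> i < radix k \<Longrightarrow>
    y (j * period (Suc k) + i * period k) = y' (j' * period (Suc k) + i * period k)"
  shows "blk y k j = blk y' k j'"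
  using assms by (auto simp: blk_def)

lemma nth_append_middle:
  assumes "length u = length u'" "\<not> (length p \<le> n \<and> n < length p + length u)"
  shows "(p @ u @ s) ! n = (p @ u' @ s) ! n"
  using assms by (auto simp: nth_append)

lemma rank_le_zero_rows:
  assumes "rank_le C U M n" "\<And>c u. c \<in> D - C \<Longrightarrow> u \<in> U \<Longrightarrow> M c u = 0"
  shows "rank_le D U M n"
proof -
  obtain \<alpha> \<beta> where "\<forall>c\<in>C. \<forall>u\<in>U. M c u = (\<Sum>i<n. \<alpha> c i * \<beta> i u)"
    using assms(1) unfolding rank_le_def by blast
  then have "\<forall>c\<in>D. \<forall>u\<in>U. M c u = (\<Sum>i<n. (if c \<in> C then \<alpha> c i else 0) * \<beta> i u)"
  proof (intro ballI)
    fix c u assume "c \<in> D" "u \<in> U"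
    then show "M c u = (\<Sum>i<n. (if c \<in> C then \<alpha> c i else 0) * \<beta> i u)"
      using assms(2)[of c u] \<open>\<forall>c\<in>C. \<forall>u\<in>U. M c u = (\<Sum>i<n. \<alpha> c i * \<beta> i u)\<close>
      by (cases "c \<in> C") auto
  qed
  then show ?thesis unfolding rank_le_def by (intro exI)
qed

section \<open>Rank of the Toeplitz functionals on a window of given length\<close>

definition binwords :: "nat \<Rightarrow> nat list set" where
  "binwords d = {u. length u = d \<and> set u \<subseteq> {0, 1}}"

lemma cell_position:
  assumes "1 \<le> i" "i < radix k"
  shows "j * period (Suc k) < j * period (Suc k) + i * period k"
    and "j * period (Suc k) + i * period k < Suc j * period (Suc k)"
proof -
  have "i * period k < radix k * period k" using assms by simp
  then show "j * period (Suc k) + i * period k < Suc j * period (Suc k)"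
    by (simp add: period_Suc mult.commute)
qed (use assms in simp)

text \<open>Rows are the contexts \<open>(K, p, s)\<close> whose left part \<open>p\<close> has a fixed length modulo
  \<open>period \<kappa>\<close>; then the position of the window inside every cell of level below \<open>\<kappa>\<close> is fixed,
  and the window contains at most one position of level at least \<open>\<kappa>\<close>.\<close>

lemma rank_toep_class:
  fixes c :: "nat \<Rightarrow> nat list \<Rightarrow> 'f::field"
  assumes S: "\<And>k. finite (S k)" "\<And>k. card (S k) \<le> N k" "\<And>k t. t \<notin> S k \<Longrightarrow> c k t = 0"
    and N1: "\<And>k. N k \<ge> 1" and d: "d \<le> period \<kappa>" and "\<kappa>' \<le> \<kappa>"
  shows "rank_le {(K, p, s). length p mod period \<kappa> = r \<and> min K \<kappa> = \<kappa>'} (binwords d)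
     (\<lambda>(K, p, s) u. toep c K (p @ u @ s)) (2 * (\<Prod>k<\<kappa>'. N k * N k))"
proof -
  define C where "C = {(K::nat, p::nat list, s::nat list). length p mod period \<kappa> = r \<and> min K \<kappa> = \<kappa>' \<and>
     length p + d + length s = period K - 1 \<and> set p \<union> set s \<subseteq> {0, 1}}"
  define u0 where "u0 = replicate d (0::nat)"
  define y where "y = (\<lambda>(K::nat, p, s) u i. (p @ u @ s) ! (i - 1) :: nat)"
  define F where "F k j x u = c k (blk (y x u) k j)" for k j x u
  \<comment> \<open>Index of the last cell of level k met by the window, counted from the cell in
    which the window starts; it depends on the class only and not on the row.\<close>
  define e where "e k = (r mod period (Suc k) + d) div period (Suc k)" for k
  define jl where "jl k = (\<lambda>(K::nat, p::nat list, s::nat list). length p div period (Suc k))" for k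
  define L where "L k = (\<lambda>x u. \<Prod>j<period (fst x) div period (Suc k). F k j x u)" for k
  define H where "H x u = (\<Prod>k\<in>{\<kappa>..<fst x}. \<Prod>j<period (fst x) div period (Suc k). F k j x u)" for x u
  have split_tval: "toep c K (p @ u @ s) = (\<Prod>k<\<kappa>'. L k (K, p, s) u) * H (K, p, s) u"
    if "(K, p, s) \<in> C" "u \<in> binwords d" for K p s u
  proof -
    have "toep c K (p @ u @ s) = (\<Prod>k<K. \<Prod>j<period K div period (Suc k). F k j (K, p, s) u)"
      using that by (auto simp: toep_def C_def binwords_def tval_def cells_def F_def y_def prod.Sigma)
    also have "{..<K} = {..<\<kappa>'} \<union> {\<kappa>..<K}" using that by (auto simp: C_def)
    also have "(\<Prod>k\<in>{..<\<kappa>'} \<union> {\<kappa>..<K}. \<Prod>j<period K div period (Suc k). F k j (K, p, s) u)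
       = (\<Prod>k<\<kappa>'. L k (K, p, s) u) * H (K, p, s) u"
      unfolding H_def L_def fst_conv using \<open>\<kappa>' \<le> \<kappa>\<close> by (subst prod.union_disjoint) auto
    finally show ?thesis .
  qed
  have outside: "y (K, p, s) u n = y (K, p, s) u' n"
    if "u \<in> binwords d" "u' \<in> binwords d" "n \<ge> 1" "n \<le> length p \<or> length p + d < n" for K p s u u' n
    using that by (auto simp: y_def binwords_def intro!: nth_append_middle)
  have inside: "y (K, p, s) u n = u ! (n - length p - 1)"
    if "u \<in> binwords d" "length p < n" "n \<le> length p + d" for K p s u n
    using that by (auto simp: y_def binwords_def nth_append)
  have u0: "u0 \<in> binwords d" by (auto simp: u0_def binwords_def)
  have rankL: "rank_le C (binwords d) (L k) (N k * N k)" if "k < \<kappa>'" for k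
  proof -
    define p1 where "p1 = period (Suc k)"
    define o1 where "o1 = r mod p1"
    have p1pos: "p1 > 0" by (simp add: p1_def)
    have "k < \<kappa>" using that \<open>\<kappa>' \<le> \<kappa>\<close> by simp
    \<comment> \<open>The letters of the cell that come from the context. Positions are taken
      relative to the start of the first cell met, which makes this set the same for all rows of the
      class.\<close>
    define A where "A e' = {i. \<not> (o1 < e' * p1 + i * period k \<and> e' * p1 + i * period k \<le> o1 + d)}" for e'
    define V where "V u e' i = u ! (e' * p1 + i * period k - o1 - 1)" for u :: "nat list" and e' i
    have geom: "length p = jl k (K, p, s) * p1 + o1" "jl k (K, p, s) + e k < period K div p1"
       "(e k) * p1 \<le> o1 + d" "o1 + d < Suc (e k) * p1" "o1 < p1"
      if "(K, p, s) \<in> C" for K p s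
    proof -
      have "k < K" using that \<open>k < \<kappa>'\<close> by (auto simp: C_def)
      have "r = length p mod period \<kappa>" using that by (auto simp: C_def)
      moreover have "p1 dvd period \<kappa>" unfolding p1_def using \<open>k < \<kappa>\<close> by (intro period_dvd) simp
      ultimately have "length p mod p1 = o1" unfolding o1_def by (simp add: mod_mod_cancel)
      then show a: "length p = jl k (K, p, s) * p1 + o1" unfolding jl_def p1_def by auto
      show e1: "(e k) * p1 \<le> o1 + d" unfolding e_def p1_def[symmetric] o1_def[symmetric] by simp
      show "o1 + d < Suc (e k) * p1" unfolding e_def p1_def[symmetric] o1_def[symmetric]
        using dividend_less_div_times[OF p1pos, of "o1 + d"] by simp
      show "o1 < p1" unfolding o1_def using p1pos by simp
      have "length p + d + length s = period K - 1" using that by (simp add: C_def)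
      then have "length p + d < period K" using period_pos[of K] by linarith
      then have "(jl k (K, p, s) + e k) * p1 < period K" using a e1 by (simp add: algebra_simps)
      moreover have "p1 dvd period K" unfolding p1_def using \<open>k < K\<close> by (intro period_dvd) simp
      ultimately show "jl k (K, p, s) + e k < period K div p1"
        by (metis dvd_div_mult_self mult_less_cancel2)
    qed
    have F_eq: "F k (jl k x + e') x u = c k (map (\<lambda>i. if i \<in> A e'
        then y x u0 ((jl k x + e') * p1 + i * period k) else V u e' i) [1..<radix k])"
      if x: "x \<in> C" and u: "u \<in> binwords d" for x u e'
      unfolding F_def blk_def p1_def[symmetric]
    proof (rule arg_cong[of _ _ "c k"], rule map_cong[OF refl])
      obtain K p s where xe: "x = (K, p, s)" by (cases x)
      have a: "length p = jl k x * p1 + o1" using geom(1) x by (simp add: xe)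
      have pos: "(jl k x + e') * p1 + i * period k + o1 =
         length p + (e' * p1 + i * period k)" for i
        using a by (simp add: algebra_simps)
      fix i assume i: "i \<in> set [1..<radix k]"
      then have "i * period k > 0" by simp
      then have ge: "(jl k x + e') * p1 + i * period k \<ge> 1" by linarith
      show "y x u ((jl k x + e') * p1 + i * period k) =
        (if i \<in> A e' then y x u0 ((jl k x + e') * p1 + i * period k) else V u e' i)"
      proof (cases "i \<in> A e'")
        case True
        then have "(jl k x + e') * p1 + i * period k \<le> length p \<or>
            length p + d < (jl k x + e') * p1 + i * period k"
          using pos[of i] unfolding A_def by auto
        then show ?thesis using True outside[OF u u0 ge, of p K s] by (simp add: xe)
      next
        case False
        then have "length p < (jl k x + e') * p1 + i * period k"
            "(jl k x + e') * p1 + i * period k \<le> length p + d"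
            "(jl k x + e') * p1 + i * period k - length p - 1 = e' * p1 + i * period k - o1 - 1"
          using pos[of i] unfolding A_def by auto
        then have "y x u ((jl k x + e') * p1 + i * period k) = V u e' i"
          unfolding V_def by (metis inside[OF u, of p "(jl k x + e') * p1 + i * period k" K s] xe)
        then show ?thesis using False by simp
      qed
    qed
    have rankF: "rank_le C (binwords d) (\<lambda>x u. F k (jl k x + e') x u) (N k)" for e'
      by (rule rank_le_finite_support[OF S(1) S(2), of k "c k"]) (use S F_eq in auto)
    \<comment> \<open>Only the first and the last cell can be cut by an end of the window. Those
      between lie inside it and are functions of u alone, hence of rank one.\<close>
    define n where "n e' = (if e' = 0 \<or> e' = e k then N k else 1)" for e'
    have rankE: "rank_le C (binwords d) (\<lambda>x u. F k (jl k x + e') x u) (n e')"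
      if "e' \<in> {0..e k}" for e'
    proof (cases "e' = 0 \<or> e' = e k")
      case True
      then show ?thesis using rankF by (simp add: n_def)
    next
      case False
      then have e': "1 \<le> e'" "Suc e' \<le> e k" using that by auto
      have "F k (jl k x + e') x u = 1 * c k (map (V u e') [1..<radix k])"
        if "x \<in> C" "u \<in> binwords d" for x u
      proof -
        obtain K p s where xe: "x = (K, p, s)" by (cases x)
        note g = geom[OF that(1)[unfolded xe]]
        have "1 * p1 \<le> e' * p1" "Suc e' * p1 \<le> e k * p1" using e' by (intro mult_le_mono1; simp)+
        then have b: "o1 < e' * p1" "Suc e' * p1 \<le> o1 + d" using g by linarith+
        have "i \<notin> A e'" if "i \<in> set [1..<radix k]" for i
          using cell_position[of i k e', folded p1_def] that b by (auto simp: A_def)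
        then have "map (\<lambda>i. if i \<in> A e' then y x u0 ((jl k x + e') * p1 + i * period k) else V u e' i)
            [1..<radix k] = map (V u e') [1..<radix k]" by (intro map_cong) auto
        then show ?thesis unfolding F_eq[OF that, of e'] by (simp only: mult_1)
      qed
      then have "rank_le C (binwords d) (\<lambda>x u. F k (jl k x + e') x u) 1"
        using rank_le_outer[of C "binwords d" "\<lambda>_. 1" "\<lambda>u. c k (map (V u e') [1..<radix k])"]
        by (simp cong: rank_le_cong)
      then show ?thesis using False by (simp add: n_def)
    qed
    have "(\<Prod>e'\<in>{0..e k}. n e') \<le> N k * N k"
    proof -
      have "(\<Prod>e'\<in>{0..e k}. n e') = (\<Prod>e'\<in>{0, e k}. n e')"
        by (rule prod.mono_neutral_right) (auto simp: n_def)
      also have "\<dots> \<le> N k * N k" using N1[of k] by (cases "e k = 0") (auto simp: n_def)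
      finally show ?thesis .
    qed
    then have rankP: "rank_le C (binwords d) (\<lambda>x u. \<Prod>e'\<in>{0..e k}. F k (jl k x + e') x u) (N k * N k)"
      by (intro rank_le_mono[OF rank_le_prod[of "{0..e k}" C "binwords d"
            "\<lambda>e' x u. F k (jl k x + e') x u" n, OF finite_atLeastAtMost rankE]]) auto
    \<comment> \<open>The cells that the window misses give a factor of the row alone;
      \<open>u0\<close> is an arbitrary filling of the window.\<close>
    define Out where "Out x = (\<Prod>j\<in>{..<period (fst x) div p1} - (+) (jl k x) ` {0..e k}. F k j x u0)" for x
    have eqL: "L k x u = Out x * 1 * (\<Prod>e'\<in>{0..e k}. F k (jl k x + e') x u)"
      if x: "x \<in> C" and u: "u \<in> binwords d" for x u
    proof -
      obtain K p s where xe: "x = (K, p, s)" by (cases x)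
      note g = geom[OF x[unfolded xe]]
      let ?J = "{..<period K div p1}" and ?I = "(+) (jl k x) ` {0..e k}"
      have sub: "?I \<subseteq> ?J" using g(2) by (auto simp: xe)
      have "L k x u = (\<Prod>j\<in>?J. F k j x u)" by (simp add: L_def p1_def xe)
      also have "\<dots> = (\<Prod>j\<in>?J - ?I. F k j x u) * (\<Prod>j\<in>?I. F k j x u)"
        using sub by (simp add: prod.subset_diff)
      also have "(\<Prod>j\<in>?I. F k j x u) = (\<Prod>e'\<in>{0..e k}. F k (jl k x + e') x u)"
        by (subst prod.reindex) (auto simp: inj_on_def)
      also have "(\<Prod>j\<in>?J - ?I. F k j x u) = Out x"
        unfolding Out_def xe fst_conv
      proof (rule prod.cong[OF refl])
        fix j assume "j \<in> {..<period K div p1} - (+) (jl k (K, p, s)) ` {0..e k}"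
        then have "j \<notin> {jl k x..jl k x + e k}" by (simp add: xe add.commute)
        then consider "Suc j \<le> jl k x" | "j \<ge> jl k x + Suc (e k)" by force
        then have far: "Suc j * p1 \<le> length p \<or> j * p1 \<ge> length p + d"
        proof cases
          case 1
          then have "Suc j * p1 \<le> jl k x * p1" by (intro mult_le_mono1)
          then show ?thesis using g(1) by (simp add: xe)
        next
          case 2
          then have "(jl k x + Suc (e k)) * p1 \<le> j * p1" by (intro mult_le_mono1)
          then show ?thesis using g(1,4) by (simp add: xe algebra_simps)
        qed
        show "F k j (K, p, s) u = F k j (K, p, s) u0" unfolding F_def
        proof (intro arg_cong[of _ _ "c k"] blk_cong outside[OF u u0])
          fix i assume i: "1 \<le> i" "i < radix k"
          note cp = cell_position[OF i, of j, folded p1_def]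
          show "1 \<le> j * period (Suc k) + i * period k" using cp by linarith
          show "j * period (Suc k) + i * period k \<le> length p \<or> length p + d < j * period (Suc k) + i * period k"
            using cp far unfolding p1_def by linarith
        qed
      qed
      finally show ?thesis by simp
    qed
    show ?thesis
      using rank_le_scale[OF rankP, of Out "\<lambda>_. 1"] eqL
      by (simp cong: rank_le_cong)
  qed
  \<comment> \<open>The index in u, counted from 0, of the only multiple of
    \<open>period \<kappa>\<close> that the window can contain. All levels from \<kappa> on see u
    through this one bit, whence the rank 2.\<close>
  define \<iota> where "\<iota> = period \<kappa> - r - 1"
  define w where "w u = replicate d (if \<iota> < d then u ! \<iota> else 0)" for u :: "nat list"
  have H_eq: "H x u = H x (w u)" if x: "x \<in> C" and u: "u \<in> binwords d" for x u
  proof -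
    obtain K p s where xe: "x = (K, p, s)" by (cases x)
    have "(if \<iota> < d then u ! \<iota> else 0) \<in> {0, 1}"
    proof (cases "\<iota> < d")
      case True
      then have "u ! \<iota> \<in> set u" "set u \<subseteq> {0, 1}" using u by (auto simp: binwords_def)
      then show ?thesis using True by auto
    qed simp
    then have wu: "w u \<in> binwords d" by (auto simp: w_def binwords_def)
    have rlt: "r < period \<kappa>" using x by (auto simp: C_def)
    define b where "b = length p div period \<kappa>"
    have a: "length p = b * period \<kappa> + r" using x by (auto simp: C_def xe b_def)
    have y_eq: "y x u n = y x (w u) n" if "n \<ge> 1" "period \<kappa> dvd n" for n
    proof (cases "n \<le> length p \<or> length p + d < n")
      case True
      then show ?thesis using outside[OF u wu \<open>n \<ge> 1\<close>] by (simp add: xe)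
    next
      case False
      have q: "n = (n div period \<kappa>) * period \<kappa>" using that by simp
      define q where "q = n div period \<kappa>"
      note q = q[folded q_def]
      have "b * period \<kappa> < q * period \<kappa>" using False a q by linarith
      moreover have "q * period \<kappa> < Suc (Suc b) * period \<kappa>"
      proof -
        have "n \<le> length p + d" using False by linarith
        then have "q * period \<kappa> < b * period \<kappa> + period \<kappa> + period \<kappa>"
          using a d rlt q by linarith
        then show ?thesis by (simp only: mult_Suc add.commute add.left_commute)
      qed
      ultimately have "b < q" "q < Suc (Suc b)" unfolding mult_less_cancel2 by blast+
      then have "q = Suc b" by linarith
      then have "n - length p - 1 = \<iota>" using q a by (simp add: \<iota>_def)
      moreover have "\<iota> < d" using calculation False by linarith
      ultimately show ?thesis using False inside[OF u, of p n K s] inside[OF wu, of p n K s]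
        by (simp add: xe w_def)
    qed
    show ?thesis unfolding H_def F_def
    proof (intro prod.cong refl arg_cong[of _ _ "c _"] blk_cong y_eq)
      fix k j i assume k: "k \<in> {\<kappa>..<fst x}" and i: "1 \<le> i" "i < radix k"
      show "1 \<le> j * period (Suc k) + i * period k"
        using cell_position[OF i, of j] by linarith
      show "period \<kappa> dvd j * period (Suc k) + i * period k"
        using k by (intro dvd_add dvd_mult period_dvd) auto
    qed
  qed
  have rankH: "rank_le C (binwords d) H 2"
  proof (rule rank_leI_sum[of "{0, 1::nat}"])
    fix x u assume x: "x \<in> C" and u: "u \<in> binwords d"
    have "(if \<iota> < d then u ! \<iota> else 0) \<in> {0, 1}"
    proof (cases "\<iota> < d")
      case True
      then have "u ! \<iota> \<in> set u" "set u \<subseteq> {0, 1}" using u by (auto simp: binwords_def)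
      then show ?thesis using True by auto
    qed simp
    then show "H x u = (\<Sum>j\<in>{0, 1}. H x (replicate d j) * of_bool ((if \<iota> < d then u ! \<iota> else 0) = j))"
      using H_eq[OF x u] by (auto simp: w_def)
  qed auto
  have "rank_le C (binwords d) (\<lambda>x u. (\<Prod>k<\<kappa>'. L k x u) * H x u) ((\<Prod>k<\<kappa>'. N k * N k) * 2)"
    by (intro rank_le_mult rank_le_prod rankH rankL) auto
  moreover have "(case x of (K, p, s) \<Rightarrow> \<lambda>u. toep c K (p @ u @ s)) u = (\<Prod>k<\<kappa>'. L k x u) * H x u"
    if "x \<in> C" "u \<in> binwords d" for x u
    using split_tval that by (cases x) auto
  ultimately have "rank_le C (binwords d) (\<lambda>(K, p, s) u. toep c K (p @ u @ s)) (2 * (\<Prod>k<\<kappa>'. N k * N k))"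
    unfolding mult.commute[of 2] by (simp cong: rank_le_cong)
  then show ?thesis
  proof (rule rank_le_zero_rows)
    fix x u assume x: "x \<in> {(K, p, s). length p mod period \<kappa> = r \<and> min K \<kappa> = \<kappa>'} - C"
      and u: "u \<in> binwords d"
    obtain K p s where xe: "x = (K, p, s)" by (cases x)
    have "\<not> (length (p @ u @ s) = period K - 1 \<and> set (p @ u @ s) \<subseteq> {0, 1})"
      using x u by (auto simp: xe C_def binwords_def)
    then show "(case x of (K, p, s) \<Rightarrow> \<lambda>u. toep c K (p @ u @ s)) u = 0"
      by (simp only: xe toep_def if_False prod.case)
  qed
qed

text \<open>There are \<open>period \<kappa>\<close> residues for the left length and \<kappa> + 1
  values of \<open>min K \<kappa>\<close>. Since \<kappa> < \<open>period \<kappa>\<close>, passing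
  to all rows costs at most a factor \<open>period \<kappa>\<close> squared.\<close>

lemma rank_toep:
  fixes c :: "nat \<Rightarrow> nat list \<Rightarrow> 'f::field"
  assumes S: "\<And>k. finite (S k)" "\<And>k. card (S k) \<le> N k" "\<And>k t. t \<notin> S k \<Longrightarrow> c k t = 0"
    and N1: "\<And>k. N k \<ge> 1" and d: "d \<le> period \<kappa>"
  shows "rank_le UNIV (binwords d) (\<lambda>(K, p, s) u. toep c K (p @ u @ s))
    (2 * period \<kappa> * period \<kappa> * (\<Prod>k<\<kappa>. N k * N k))"
proof -
  let ?J = "{..<period \<kappa>} \<times> {..\<kappa>}"
  have "rank_le UNIV (binwords d) (\<lambda>(K, p, s) u. toep c K (p @ u @ s))
    (card ?J * (2 * (\<Prod>k<\<kappa>. N k * N k)))"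
  proof (rule rank_le_UN_rows)
    fix j assume j: "j \<in> ?J"
    obtain r \<kappa>' where je: "j = (r, \<kappa>')" by (cases j)
    have "(\<Prod>k<\<kappa>'. N k * N k) \<le> (\<Prod>k<\<kappa>. N k * N k)"
    proof -
      have "{..<\<kappa>} = {..<\<kappa>'} \<union> {\<kappa>'..<\<kappa>}" using j by (auto simp: je)
      then have "(\<Prod>k<\<kappa>. N k * N k) = (\<Prod>k<\<kappa>'. N k * N k) * (\<Prod>k\<in>{\<kappa>'..<\<kappa>}. N k * N k)"
        by (metis (no_types, lifting) finite_atLeastLessThan finite_lessThan
            ivl_disj_int_one(2) prod.union_disjoint)
      moreover have "1 \<le> N k * N k" for k using mult_le_mono[OF N1[of k] N1[of k]] by simp
      then have "1 \<le> (\<Prod>k\<in>{\<kappa>'..<\<kappa>}. N k * N k)" by (intro prod_ge_1) auto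
      ultimately show ?thesis by simp
    qed
    then show "rank_le ((\<lambda>(r, \<kappa>'). {(K, p, s). length p mod period \<kappa> = r \<and> min K \<kappa> = \<kappa>'}) j) (binwords d)
        (\<lambda>(K, p, s) u. toep c K (p @ u @ s)) (2 * (\<Prod>k<\<kappa>. N k * N k))"
      using rank_le_mono[OF rank_toep_class[where \<kappa>' = \<kappa>' and r = r, OF S N1 d]] j je by simp
  next
    fix x :: "nat \<times> nat list \<times> nat list"
    obtain K p s where xe: "x = (K, p, s)" by (cases x)
    show "\<exists>j\<in>?J. x \<in> (\<lambda>(r, \<kappa>'). {(K, p, s). length p mod period \<kappa> = r \<and> min K \<kappa> = \<kappa>'}) j"
      by (rule bexI[of _ "(length p mod period \<kappa>, min K \<kappa>)"]) (auto simp: xe)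
  qed auto
  moreover have "card ?J * (2 * (\<Prod>k<\<kappa>. N k * N k)) \<le> 2 * period \<kappa> * period \<kappa> * (\<Prod>k<\<kappa>. N k * N k)"
  proof -
    have "period \<kappa> * Suc \<kappa> \<le> period \<kappa> * period \<kappa>"
      using period_gt[of \<kappa>] by (intro mult_le_mono2) simp
    then have "period \<kappa> * Suc \<kappa> * (2 * (\<Prod>k<\<kappa>. N k * N k)) \<le>
        period \<kappa> * period \<kappa> * (2 * (\<Prod>k<\<kappa>. N k * N k))"
      by (rule mult_le_mono1)
    then show ?thesis by (simp add: card_cartesian_product mult_ac)
  qed
  ultimately show ?thesis by (rule rank_le_mono) auto
qed

text \<open>The window fills the stretch between two successive multiples of
  \<open>period (Suc k)\<close>. A cell of level at most k lies entirely inside or entirely outside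
  it, and cells of higher level use only multiples of \<open>period (Suc k)\<close>, which it
  avoids. The inner cells are a translate of \<open>cells (Suc k)\<close>; the others contribute the
  constant h.\<close>

lemma toep_aligned:
  assumes "Suc k \<le> K" "length p = b * period (Suc k)"
  obtains h where "\<And>y. y \<in> binwords (period (Suc k) - 1) \<Longrightarrow>
    toep c K (p @ y @ s) = h * toep c (Suc k) y"
proof -
  define p1 where "p1 = period (Suc k)"
  have p1: "p1 > 0" by (simp add: p1_def)
  show ?thesis
  proof (cases "length p + (p1 - 1) + length s = period K - 1 \<and> set p \<union> set s \<subseteq> {0, 1}")
    case False
    then have "toep c K (p @ y @ s) = 0 * toep c (Suc k) y"
      if "y \<in> binwords (period (Suc k) - 1)" for y
      using that by (auto simp: toep_def binwords_def p1_def)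
    then show ?thesis by (rule that)
  next
    case valid: True
    define Y where "Y y i = (p @ y @ s) ! (i - 1)" for y i
    define y0 where "y0 = replicate (p1 - 1) (0::nat)"
    define g where "g = (\<lambda>(k', j). (k', b * (p1 div period (Suc k')) + j))"
    define h where "h = (\<Prod>(k', j)\<in>cells K - g ` cells (Suc k). c k' (blk (Y y0) k' j))"
    have le: "(b + 1) * p1 \<le> period K"
    proof -
      have "b * p1 + (p1 - 1) + length s = period K - 1"
        using valid assms(2) by (simp add: p1_def)
      then have "b * p1 + p1 + length s = period K" using p1 period_pos[of K] by linarith
      then show ?thesis by simp
    qed
    have div1: "p1 = (p1 div period (Suc k')) * period (Suc k')" if "k' \<le> k" for k'
      using period_dvd[of "Suc k'" "Suc k"] that by (simp add: p1_def)
    have sub: "g ` cells (Suc k) \<subseteq> cells K"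
    proof
      fix x assume "x \<in> g ` cells (Suc k)"
      then obtain k' j where x: "x = (k', b * (p1 div period (Suc k')) + j)"
        and k': "k' \<le> k" and j: "j < p1 div period (Suc k')"
        by (auto simp: g_def cells_def p1_def)
      have "period (Suc k') dvd period K" using k' assms(1) by (intro period_dvd) simp
      then have D: "period K = (period K div period (Suc k')) * period (Suc k')" by simp
      have "((b + 1) * (p1 div period (Suc k'))) * period (Suc k') \<le> (period K div period (Suc k')) * period (Suc k')"
        using le D div1[OF k'] by (metis mult.assoc)
      then have "(b + 1) * (p1 div period (Suc k')) \<le> period K div period (Suc k')" by simp
      then show "x \<in> cells K" using j k' assms(1) by (auto simp: x cells_def)
    qed
    have inj: "inj_on g (cells (Suc k))" by (auto simp: inj_on_def g_def)
    have "toep c K (p @ y @ s) = h * toep c (Suc k) y" if y: "y \<in> binwords (period (Suc k) - 1)" for y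
    proof -
      have ly: "length y = p1 - 1" "set y \<subseteq> {0, 1}" using y by (auto simp: binwords_def p1_def)
      have "toep c K (p @ y @ s) = tval c K (Y y)"
        using valid ly by (auto simp: toep_def Y_def[abs_def])
      also have "\<dots> = (\<Prod>(k', j)\<in>cells K - g ` cells (Suc k). c k' (blk (Y y) k' j)) *
          (\<Prod>(k', j)\<in>g ` cells (Suc k). c k' (blk (Y y) k' j))"
        unfolding tval_def using sub by (simp add: prod.subset_diff)
      also have "(\<Prod>(k', j)\<in>g ` cells (Suc k). c k' (blk (Y y) k' j)) =
          (\<Prod>(k', j)\<in>cells (Suc k). c k' (blk (\<lambda>i. y ! (i - 1)) k' j))"
      proof (subst prod.reindex[OF inj], rule prod.cong[OF refl])
        fix x assume "x \<in> cells (Suc k)"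
        then obtain k' j where x: "x = (k', j)" and k': "k' \<le> k" and j: "j < p1 div period (Suc k')"
          by (auto simp: cells_def p1_def)
        have "blk (Y y) k' (b * (p1 div period (Suc k')) + j) = blk (\<lambda>i. y ! (i - 1)) k' j"
        proof (rule blk_cong)
          fix i assume i: "1 \<le> i" "i < radix k'"
          note cp = cell_position[OF i, of j]
          have "(b * (p1 div period (Suc k')) + j) * period (Suc k') =
             b * p1 + j * period (Suc k')" using div1[OF k'] by (simp add: algebra_simps)
          moreover have "Suc j * period (Suc k') \<le> p1"
            using mult_le_mono1[of "Suc j" "p1 div period (Suc k')" "period (Suc k')"] j div1[OF k'] by simp
          moreover define q where "q = j * period (Suc k') + i * period k'"
          ultimately have "(b * (p1 div period (Suc k')) + j) * period (Suc k') + i * period k' = length p + q"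
              "1 \<le> q" "q < p1"
            using cp assms(2) unfolding p1_def by linarith+
          moreover have "(p @ y @ s) ! (length p + q - 1) = y ! (q - 1)"
          proof -
            have "length p + q - 1 = length p + (q - 1)" "q - 1 < length y"
              using \<open>1 \<le> q\<close> \<open>q < p1\<close> ly by linarith+
            then show ?thesis by (metis nth_append nth_append_length_plus)
          qed
          ultimately show "Y y ((b * (p1 div period (Suc k')) + j) * period (Suc k') + i * period k') =
            y ! (j * period (Suc k') + i * period k' - 1)"
            unfolding Y_def q_def by (simp only:)
        qed
        then show "((\<lambda>(k', j). c k' (blk (Y y) k' j)) \<circ> g) x = (case x of (k', j) \<Rightarrow> c k' (blk (\<lambda>i. y ! (i - 1)) k' j))"
          by (simp add: x g_def)
      qed
      also have "(\<Prod>(k', j)\<in>cells K - g ` cells (Suc k). c k' (blk (Y y) k' j)) = h"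
        unfolding h_def
      proof (rule prod.cong[OF refl])
        fix x assume x': "x \<in> cells K - g ` cells (Suc k)"
        obtain k' j where x: "x = (k', j)" by (cases x)
        have "blk (Y y) k' j = blk (Y y0) k' j"
        proof (rule blk_cong)
          fix i assume i: "1 \<le> i" "i < radix k'"
          define n where "n = j * period (Suc k') + i * period k'"
          note cp = cell_position[OF i, of j, folded n_def]
          have "n \<le> b * p1 \<or> n \<ge> (b + 1) * p1"
          proof (cases "k' \<le> k")
            case False
            then have "p1 dvd n" unfolding n_def p1_def by (intro dvd_add dvd_mult period_dvd) auto
            then have "n = (n div p1) * p1" by simp
            then obtain q where "n = q * p1" ..
            then show ?thesis by (metis add.commute linorder_not_le mult_le_mono1 not_less_eq_eq plus_1_eq_Suc)
          next
            case True
            define D where "D = p1 div period (Suc k')"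
            note d1 = div1[OF True, folded D_def]
            have "\<not> (b * D \<le> j \<and> j < (b + 1) * D)"
            proof
              assume a: "b * D \<le> j \<and> j < (b + 1) * D"
              then have "x = g (k', j - b * D)" by (simp add: x g_def D_def)
              moreover have "(k', j - b * D) \<in> cells (Suc k)"
                using a True by (auto simp: cells_def D_def p1_def)
              ultimately show False using x' by blast
            qed
            then consider "Suc j \<le> b * D" | "(b + 1) * D \<le> j" by linarith
            then show ?thesis
            proof cases
              case 1
              then have "Suc j * period (Suc k') \<le> b * D * period (Suc k')" by (intro mult_le_mono1)
              then have "Suc j * period (Suc k') \<le> b * p1" using d1 by (metis mult.assoc)
              then show ?thesis using cp by linarith
            next
              case 2
              then have "(b + 1) * D * period (Suc k') \<le> j * period (Suc k')" by (intro mult_le_mono1)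
              then have "(b + 1) * p1 \<le> j * period (Suc k')" using d1 by (metis mult.assoc)
              then show ?thesis using cp by linarith
            qed
          qed
          then have "Y y n = Y y0 n" unfolding Y_def
            using cp ly assms(2) by (intro nth_append_middle) (auto simp: y0_def p1_def[symmetric])
          then show "Y y (j * period (Suc k') + i * period k') = Y y0 (j * period (Suc k') + i * period k')"
            by (simp add: n_def)
        qed
        then show "(case x of (k', j) \<Rightarrow> c k' (blk (Y y) k' j)) = (case x of (k', j) \<Rightarrow> c k' (blk (Y y0) k' j))"
          by (simp add: x)
      qed
      also have "(\<Prod>(k', j)\<in>cells (Suc k). c k' (blk (\<lambda>i. y ! (i - 1)) k' j)) = toep c (Suc k) y"
        using ly by (simp add: toep_def tval_def p1_def)
      finally show ?thesis .
    qed
    then show ?thesis by (rule that)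
  qed
qed

text \<open>Each position receives the letter that the chosen tuple of its level prescribes. Groups
  occupy disjoint positions, so all factors can be made 1 simultaneously.\<close>

lemma toep_nonzero_word:
  assumes "\<And>k. c k (\<tau> k) = (1::'f::field)" "\<And>k. length (\<tau> k) = radix k - 1" "\<And>k. set (\<tau> k) \<subseteq> {0, 1}"
  obtains x where "length x = period K - 1" "toep c K x = 1"
proof -
  define lev where "lev n = (GREATEST k. period k dvd n)" for n
  define \<chi> where "\<chi> n = \<tau> (lev n) ! ((n div period (lev n)) mod radix (lev n) - 1)" for n
  have lev: "lev (j * period (Suc k) + i * period k) = k" if "1 \<le> i" "i < radix k" for i j k
    unfolding lev_def
  proof (rule Greatest_equality)
    have eq: "j * period (Suc k) + i * period k = (j * radix k + i) * period k"
      by (simp add: period_Suc algebra_simps)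
    show "period k dvd j * period (Suc k) + i * period k" unfolding eq by simp
    fix k' assume k': "period k' dvd j * period (Suc k) + i * period k"
    show "k' \<le> k"
    proof (rule ccontr)
      assume "\<not> k' \<le> k"
      then have "period (Suc k) dvd j * period (Suc k) + i * period k"
        using dvd_trans[OF period_dvd[of "Suc k" k'] k'] by linarith
      then have "radix k dvd j * radix k + i" unfolding eq by (simp add: period_Suc mult.commute)
      then have "radix k dvd i" by (simp add: dvd_add_right_iff)
      then show False using that by (auto dest: dvd_imp_le)
    qed
  qed
  have \<chi>: "\<chi> (j * period (Suc k) + i * period k) = \<tau> k ! (i - 1)" if "1 \<le> i" "i < radix k" for i j k
  proof -
    have "j * period (Suc k) + i * period k = (j * radix k + i) * period k"
      by (simp add: period_Suc algebra_simps)
    then show ?thesis using lev[OF that, of j] that by (simp add: \<chi>_def)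
  qed
  have \<chi>_bin: "\<chi> n \<in> {0, 1}" for n
  proof -
    define k where "k = lev n"
    have "(n div period k) mod radix k < radix k" by (simp add: radix_eq)
    then have "(n div period k) mod radix k - 1 < radix k - 1" using radix_eq[of k] by linarith
    then show ?thesis using assms(2,3)[of k] nth_mem unfolding \<chi>_def k_def by (metis subsetD)
  qed
  define x where "x = map \<chi> [1..<period K]"
  have "tval c K (\<lambda>i. x ! (i - 1)) = (\<Prod>(k, j)\<in>cells K. 1)"
    unfolding tval_def
  proof (rule prod.cong[OF refl])
    fix z assume "z \<in> cells K"
    then obtain k j where z: "z = (k, j)" "k < K" "j < period K div period (Suc k)"
      by (auto simp: cells_def)
    have "blk (\<lambda>i. x ! (i - 1)) k j = \<tau> k"
    proof (rule nth_equalityI)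
      fix n assume "n < length (blk (\<lambda>i. x ! (i - 1)) k j)"
      then have n: "n < radix k - 1" by (simp add: blk_def)
      have i: "1 \<le> Suc n" "Suc n < radix k" using n by auto
      note cp = cell_position[OF i, of j]
      have "period (Suc k) dvd period K" using z by (intro period_dvd) simp
      then have "Suc j * period (Suc k) \<le> period K"
        using mult_le_mono1[of "Suc j" "period K div period (Suc k)" "period (Suc k)"] z(3) by simp
      then have "x ! (j * period (Suc k) + Suc n * period k - 1) = \<chi> (j * period (Suc k) + Suc n * period k)"
      proof -
        define q where "q = j * period (Suc k) + Suc n * period k"
        have "1 \<le> q" "q < period K" using cp \<open>Suc j * period (Suc k) \<le> period K\<close>
          unfolding q_def by linarith+
        then have "x ! (q - 1) = \<chi> q" by (simp add: x_def)
        then show ?thesis by (simp only: q_def)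
      qed
      then show "blk (\<lambda>i. x ! (i - 1)) k j ! n = \<tau> k ! n"
        using \<chi>[OF i, of j] n by (simp add: blk_def)
    qed (simp add: blk_def assms(2))
    then show "(case z of (k, j) \<Rightarrow> c k (blk (\<lambda>i. x ! (i - 1)) k j)) = (case z of (k, j) \<Rightarrow> 1)"
      by (simp add: z assms(1))
  qed
  moreover have "set x \<subseteq> {0, 1}" unfolding x_def set_map by (rule image_subsetI) (rule \<chi>_bin)
  ultimately have "toep c K x = 1" by (simp add: toep_def x_def split_def)
  then show ?thesis by (rule that[rotated]) (simp add: x_def)
qed

lemma toep_cong:
  assumes "\<And>k. k < K \<Longrightarrow> c k = c' k"
  shows "toep c K = toep c' K"
proof -
  have "tval c K y = tval c' K y" for y
    unfolding tval_def by (rule prod.cong) (auto simp: cells_def assms)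
  then show ?thesis by (simp add: toep_def fun_eq_iff)
qed

text \<open>The top level has a single cell, so the value is linear in \<open>c k\<close>: this
  turns the relations into linear equations.\<close>

lemma toep_Suc:
  "toep c (Suc k) u = of_bool (u \<in> binwords (period (Suc k) - 1)) *
    (c k (blk (\<lambda>i. u ! (i - 1)) k 0) *
     (\<Prod>k'<k. \<Prod>j<period (Suc k) div period (Suc k'). c k' (blk (\<lambda>i. u ! (i - 1)) k' j)))"
  by (auto simp: toep_def tval_def cells_def binwords_def prod.Sigma[symmetric] mult.commute)

section \<open>Relations of a level and coefficients of small support that satisfy them\<close>

lemma card_binwords: "card (binwords d) = 2 ^ d" and finite_binwords: "finite (binwords d)"
proof -
  have "binwords d = {xs. set xs \<subseteq> {0, 1} \<and> length xs = d}" by (auto simp: binwords_def)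
  then show "card (binwords d) = 2 ^ d" "finite (binwords d)"
    using card_lists_length_eq[of "{0::nat, 1}" d] finite_lists_length_eq[of "{0::nat, 1}" d] by (simp_all add: numeral_2_eq_2)
qed

definition shortwords :: "nat \<Rightarrow> nat list set" where
  "shortwords D = {m. length m < D \<and> set m \<subseteq> {0, 1}}"

lemma shortwords_eq: "shortwords D = (\<Union>i<D. binwords i)"
  by (auto simp: shortwords_def binwords_def)

lemma finite_shortwords: "finite (shortwords D)"
  by (simp add: shortwords_eq finite_binwords)

lemma card_shortwords: "card (shortwords D) \<le> 2 ^ D"
proof -
  have "card (shortwords D) \<le> (\<Sum>i<D. card (binwords i))"
    unfolding shortwords_eq by (rule card_UN_le) simp
  also have "\<dots> = 2 ^ D - 1" unfolding card_binwords by (simp add: sum_power2 lessThan_atLeast0)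
  finally show ?thesis by simp
qed

lemma finite_card_bounded_multisets:
  assumes "finite A" "card A \<le> n"
  shows "finite {\<alpha>. set_mset \<alpha> \<subseteq> A \<and> size \<alpha> \<le> P}"
    and "card {\<alpha>. set_mset \<alpha> \<subseteq> A \<and> size \<alpha> \<le> P} \<le> (P + 1) ^ n"
proof -
  let ?M = "{\<alpha>. set_mset \<alpha> \<subseteq> A \<and> size \<alpha> \<le> P}"
  let ?g = "\<lambda>\<alpha>. restrict (count \<alpha>) A"
  have inj: "inj_on ?g ?M"
  proof (rule inj_onI)
    fix \<alpha> \<beta> assume a: "\<alpha> \<in> ?M" "\<beta> \<in> ?M" "?g \<alpha> = ?g \<beta>"
    show "\<alpha> = \<beta>"
    proof (rule multiset_eqI)
      fix x show "count \<alpha> x = count \<beta> x"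
      proof (cases "x \<in> A")
        case True
        then show ?thesis using fun_cong[OF a(3), of x] by simp
      next
        case False
        then have "x \<notin># \<alpha>" "x \<notin># \<beta>" using a(1,2) by auto
        then show ?thesis by (simp add: not_in_iff)
      qed
    qed
  qed
  have sub: "?g ` ?M \<subseteq> A \<rightarrow>\<^sub>E {..P}"
  proof
    fix g assume "g \<in> ?g ` ?M"
    then obtain \<alpha> where "size \<alpha> \<le> P" and g: "g = ?g \<alpha>" by auto
    then have "count \<alpha> x \<le> P" for x using count_le_size[of \<alpha> x] by simp
    then show "g \<in> A \<rightarrow>\<^sub>E {..P}" by (auto simp: g)
  qed
  have fin: "finite (A \<rightarrow>\<^sub>E {..P})" using assms by (intro finite_PiE) auto
  show "finite ?M" by (rule finite_imageD[OF finite_subset[OF sub fin] inj])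
  have "card ?M = card (?g ` ?M)" using inj by (simp add: card_image)
  also have "\<dots> \<le> card (A \<rightarrow>\<^sub>E {..P})" using sub fin by (rule card_mono[rotated])
  also have "\<dots> = (P + 1) ^ card A" using assms by (simp add: card_PiE)
  also have "\<dots> \<le> (P + 1) ^ n" using assms by (intro power_increasing) auto
  finally show "card ?M \<le> (P + 1) ^ n" .
qed

text \<open>The two outer words are the pieces of factors cut off at the two ends of a cell. Empty
  words are kept out of the multiset so that its size is bounded by the length of the cell.\<close>

definition relations :: "nat \<Rightarrow> nat \<Rightarrow> (nat list \<times> nat list multiset \<times> nat list) set" where
  "relations D P = shortwords D \<times>
     {\<alpha>. set_mset \<alpha> \<subseteq> shortwords D - {[]} \<and> size \<alpha> \<le> P} \<times> shortwords D"

lemma relations_bound: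
  "finite (relations D P)" "card (relations D P) \<le> 4 ^ D * (P + 1) ^ (2 ^ D)"
proof -
  have "card (shortwords D - {[]}) \<le> 2 ^ D"
    using card_mono[of "shortwords D" "shortwords D - {[]}"] finite_shortwords[of D] card_shortwords[of D]
    by auto
  note fc = finite_card_bounded_multisets[OF _ this, of P]
  have fin: "finite (shortwords D - {[]})" using finite_shortwords by auto
  show "finite (relations D P)" unfolding relations_def using fc(1)[OF fin] finite_shortwords by auto
  have "card (relations D P) \<le> 2 ^ D * ((P + 1) ^ (2 ^ D) * 2 ^ D)"
    unfolding relations_def card_cartesian_product
    by (intro mult_le_mono card_shortwords fc(2)[OF fin])
  also have "\<dots> = (2 * 2) ^ D * (P + 1) ^ (2 ^ D)" unfolding power_mult_distrib by simp
  finally show "card (relations D P) \<le> 4 ^ D * (P + 1) ^ (2 ^ D)" by simp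
qed

text \<open>One more than the bound on the number of relations, so that the homogeneous system has a
  nonzero solution on a support of this size. For D = 0 no relation is imposed and one point
  suffices.\<close>

definition support_bound :: "nat \<Rightarrow> nat \<Rightarrow> nat" where
  "support_bound k D = (if D = 0 then 1 else 4 ^ D * fpow (Suc k) ^ (2 ^ D) + 1)"

definition satisfies_relations :: "(nat \<Rightarrow> nat list \<Rightarrow> 'f::field) \<Rightarrow> nat \<Rightarrow> nat \<Rightarrow> bool" where
  "satisfies_relations c k D \<longleftrightarrow> (\<forall>(m', \<alpha>, m'')\<in>relations D (period (Suc k)).
     (\<Sum>ms\<in>permutations_of_multiset \<alpha>. toep c (Suc k) (m' @ concat ms @ m'')) = 0)"

text \<open>Each relation is one linear equation for \<open>\<phi>\<close>. With more support points
  than equations there is a nonzero solution, which is rescaled to take the value 1. The hypothesis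
  guarantees that enough binary tuples of length \<open>fpow k\<close> exist to choose the support
  from.\<close>

lemma toep_level_exists:
  fixes c :: "nat \<Rightarrow> nat list \<Rightarrow> 'f::field"
  assumes "support_bound k D \<le> 2 ^ fpow k"
  obtains \<phi> S \<tau> where "finite S" "card S \<le> support_bound k D" "\<And>t. t \<notin> S \<Longrightarrow> \<phi> t = 0"
    "\<tau> \<in> binwords (radix k - 1)" "\<phi> \<tau> = 1" "satisfies_relations (c(k := \<phi>)) k D"
proof -
  let ?R = "relations D (period (Suc k))"
  define n where "n = card ?R"
  have n: "n + 1 \<le> support_bound k D"
    using relations_bound(2)[of D "period (Suc k)"]
    by (auto simp: n_def support_bound_def fpow_eq relations_def shortwords_def)
  then have "n + 1 \<le> card (binwords (radix k - 1))"
    using assms by (simp add: card_binwords radix_def)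
  then obtain S where S: "S \<subseteq> binwords (radix k - 1)" "card S = n + 1" "finite S"
    using obtain_subset_with_card_n by metis
  obtain h where h: "bij_betw h {0..<n} ?R"
    using ex_bij_betw_nat_finite[OF relations_bound(1)] unfolding n_def by blast
  define rest where "rest u = (\<Prod>k'<k. \<Prod>j<period (Suc k) div period (Suc k'). c k' (blk (\<lambda>i. u ! (i - 1)) k' j))" for u
  define B where "B u = blk (\<lambda>i. u ! (i - 1)) k 0" for u :: "nat list"
  define ok where "ok u = (of_bool (u \<in> binwords (period (Suc k) - 1)) :: 'f)" for u
  define v where "v i t = (case h i of (m', \<alpha>, m'') \<Rightarrow> \<Sum>ms\<in>permutations_of_multiset \<alpha>.
      ok (m' @ concat ms @ m'') * (of_bool (B (m' @ concat ms @ m'') = t) * rest (m' @ concat ms @ m'')))" for i t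
  obtain a where a: "\<exists>s\<in>S. a s \<noteq> 0" "\<forall>i<n. (\<Sum>s\<in>S. a s * v i s) = 0"
    using homogeneous_system_nontrivial_solution[of S n v] S by auto
  then obtain \<tau> where \<tau>: "\<tau> \<in> S" "a \<tau> \<noteq> 0" by blast
  define \<phi> where "\<phi> t = (if t \<in> S then a t / a \<tau> else 0)" for t
  have "satisfies_relations (c(k := \<phi>)) k D"
    unfolding satisfies_relations_def
  proof (intro ballI)
    fix x assume "x \<in> ?R"
    then have "x \<in> h ` {0..<n}" using bij_betw_imp_surj_on[OF h] by simp
    then obtain i where i: "i < n" "h i = x" by auto
    obtain m' \<alpha> m'' where x: "x = (m', \<alpha>, m'')" by (cases x)
    have *: "toep (c(k := \<phi>)) (Suc k) u = (\<Sum>t\<in>S. \<phi> t * (ok u * (of_bool (B u = t) * rest u)))" for u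
    proof -
      have "(\<Prod>k'<k. \<Prod>j<period (Suc k) div period (Suc k'). (c(k := \<phi>)) k' (blk (\<lambda>i. u ! (i - 1)) k' j)) = rest u"
        unfolding rest_def by (intro prod.cong) auto
      then have "toep (c(k := \<phi>)) (Suc k) u = ok u * (\<phi> (B u) * rest u)"
        unfolding toep_Suc B_def ok_def by simp
      also have "\<phi> (B u) = (\<Sum>t\<in>S. \<phi> t * of_bool (B u = t))"
        using S(3) by (simp add: \<phi>_def of_bool_def if_distrib cong: if_cong)
      also have "ok u * ((\<Sum>t\<in>S. \<phi> t * of_bool (B u = t)) * rest u) =
          (\<Sum>t\<in>S. \<phi> t * (ok u * (of_bool (B u = t) * rest u)))"
        by (simp only: sum_distrib_left sum_distrib_right mult_ac)
      finally show ?thesis .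
    qed
    have "(\<Sum>ms\<in>permutations_of_multiset \<alpha>. toep (c(k := \<phi>)) (Suc k) (m' @ concat ms @ m''))
       = (\<Sum>t\<in>S. \<phi> t * v i t)"
      unfolding * v_def i x by (subst sum.swap) (simp add: sum_distrib_left)
    also have "\<dots> = (\<Sum>t\<in>S. a t * v i t) / a \<tau>"
      by (simp add: sum_divide_distrib \<phi>_def)
    also have "\<dots> = 0" using a(2) i by simp
    finally show "case x of (m', \<alpha>, m'') \<Rightarrow>
      (\<Sum>ms\<in>permutations_of_multiset \<alpha>. toep (c(k := \<phi>)) (Suc k) (m' @ concat ms @ m'')) = 0"
      by (simp add: x)
  qed
  then show ?thesis
    using that[of S \<phi> \<tau>] S n \<tau> by (auto simp: \<phi>_def)
qed

text \<open>The requirement at level k involves only the levels up to k, so the coefficient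
  functions can be chosen by recursion on the level.\<close>

lemma toep_system_exists:
  assumes "\<And>k. support_bound k (D k) \<le> 2 ^ fpow k"
  obtains c :: "nat \<Rightarrow> nat list \<Rightarrow> 'f::field" and S \<tau> where
    "\<And>k. finite (S k)" "\<And>k. card (S k) \<le> support_bound k (D k)" "\<And>k t. t \<notin> S k \<Longrightarrow> c k t = 0"
    "\<And>k. \<tau> k \<in> binwords (radix k - 1)" "\<And>k. c k (\<tau> k) = 1" "\<And>k. satisfies_relations c k (D k)"
proof -
  define good where "good c k \<phi> \<longleftrightarrow> (\<exists>S \<tau>. finite S \<and> card S \<le> support_bound k (D k) \<and> (\<forall>t. t \<notin> S \<longrightarrow> \<phi> t = 0) \<and>
    \<tau> \<in> binwords (radix k - 1) \<and> \<phi> \<tau> = 1 \<and> satisfies_relations (c(k := \<phi>)) k (D k))"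
    for c :: "nat \<Rightarrow> nat list \<Rightarrow> 'f" and k \<phi>
  have "\<exists>c. \<forall>k. good c k (c k)"
  proof (rule dependent_wellorder_choice)
    fix r :: "nat list \<Rightarrow> 'f" and f g :: "nat \<Rightarrow> nat list \<Rightarrow> 'f" and k
    assume "\<And>l. l < k \<Longrightarrow> f l = g l"
    then have "toep (f(k := r)) (Suc k) = toep (g(k := r)) (Suc k)" by (intro toep_cong) auto
    then show "good f k r = good g k r" by (simp add: good_def satisfies_relations_def)
  next
    fix k and f :: "nat \<Rightarrow> nat list \<Rightarrow> 'f"
    show "\<exists>r. good f k r" unfolding good_def by (rule toep_level_exists[OF assms, of k f]) blast
  qed
  then obtain c where c: "\<And>k. good c k (c k)" by blast
  then have "\<forall>k. \<exists>S \<tau>. finite S \<and> card S \<le> support_bound k (D k) \<and> (\<forall>t. t \<notin> S \<longrightarrow> c k t = 0) \<and>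
    \<tau> \<in> binwords (radix k - 1) \<and> c k \<tau> = 1 \<and> satisfies_relations c k (D k)"
    unfolding good_def by simp
  then obtain S \<tau> where "\<And>k. finite (S k) \<and> card (S k) \<le> support_bound k (D k) \<and> (\<forall>t. t \<notin> S k \<longrightarrow> c k t = 0) \<and>
    \<tau> k \<in> binwords (radix k - 1) \<and> c k (\<tau> k) = 1 \<and> satisfies_relations c k (D k)"
    by metis
  then show ?thesis using that[of S c \<tau>] by blast
qed

section \<open>Sums over all orders of a multiset of words, and powers\<close>

lemma sum_permutations_Cons:
  fixes H :: "'a list \<Rightarrow> 'b::comm_monoid_add"
  assumes "\<alpha> \<noteq> {#}"
  shows "(\<Sum>ms\<in>permutations_of_multiset \<alpha>. H ms) =
    (\<Sum>m\<in>set_mset \<alpha>. \<Sum>ms\<in>permutations_of_multiset (\<alpha> - {#m#}). H (m # ms))"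
  unfolding permutations_of_multiset_nonempty[OF assms]
  by (subst sum.UNION_disjoint) (auto simp: sum.reindex)

lemma sum_permutations_rev:
  "(\<Sum>ms\<in>permutations_of_multiset \<alpha>. H (rev ms)) = (\<Sum>ms\<in>permutations_of_multiset \<alpha>. H ms)"
proof -
  have "(\<Sum>ms\<in>rev ` permutations_of_multiset \<alpha>. H ms) = (\<Sum>ms\<in>permutations_of_multiset \<alpha>. H (rev ms))"
    by (subst sum.reindex) auto
  then show ?thesis by simp
qed

lemma sum_permutations_snoc:
  fixes H :: "'a list \<Rightarrow> 'b::comm_monoid_add"
  assumes "\<alpha> \<noteq> {#}"
  shows "(\<Sum>ms\<in>permutations_of_multiset \<alpha>. H ms) =
    (\<Sum>m\<in>set_mset \<alpha>. \<Sum>ms\<in>permutations_of_multiset (\<alpha> - {#m#}). H (ms @ [m]))"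
proof -
  have "(\<Sum>ms\<in>permutations_of_multiset \<alpha>. H ms) = (\<Sum>ms\<in>permutations_of_multiset \<alpha>. H (rev ms))"
    by (rule sum_permutations_rev[symmetric])
  also have "\<dots> = (\<Sum>m\<in>set_mset \<alpha>. \<Sum>ms\<in>permutations_of_multiset (\<alpha> - {#m#}). H (rev ms @ [m]))"
    by (subst sum_permutations_Cons[OF assms]) simp
  also have "\<dots> = (\<Sum>m\<in>set_mset \<alpha>. \<Sum>ms\<in>permutations_of_multiset (\<alpha> - {#m#}). H (ms @ [m]))"
    by (intro sum.cong refl sum_permutations_rev)
  finally show ?thesis .
qed

definition weight :: "'a list multiset \<Rightarrow> nat" where
  "weight \<alpha> = (\<Sum>m\<in>#\<alpha>. length m)"

lemma length_concat_permutation: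
  "ms \<in> permutations_of_multiset \<alpha> \<Longrightarrow> length (concat ms) = weight \<alpha>"
  by (auto simp: weight_def length_concat permutations_of_multiset_def sum_mset_sum_list[symmetric])

lemma weight_remove: "m \<in># \<alpha> \<Longrightarrow> weight \<alpha> = length m + weight (\<alpha> - {#m#})"
  unfolding weight_def by (metis insert_DiffM image_mset_add_mset sum_mset.add_mset)

lemma size_le_weight: "[] \<notin># \<alpha> \<Longrightarrow> size \<alpha> \<le> weight \<alpha>"
proof (induction \<alpha>)
  case (add m \<alpha>)
  then have "length m \<ge> 1" by (cases m) auto
  then show ?case using add by (simp add: weight_def)
qed simp

context
  fixes c :: "nat \<Rightarrow> nat list \<Rightarrow> 'f::field" and k D K :: nat
  assumes rel: "satisfies_relations c k D" and D: "D \<ge> 1" "D \<le> period (Suc k)" and K: "Suc k \<le> K"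
begin

text \<open>The last factor is split off until the remaining ones end inside the cell; their total length
  does not depend on their order.\<close>

lemma sum_permutations_right:
  assumes "length p = b * period (Suc k)" "m' \<in> shortwords D" "set_mset \<alpha> \<subseteq> shortwords D - {[]}"
    "length m' + weight \<alpha> \<ge> period (Suc k)"
  shows "(\<Sum>ms\<in>permutations_of_multiset \<alpha>. toep c K (p @ m' @ concat ms @ s)) = 0"
  using assms(3,4)
proof (induction "size \<alpha>" arbitrary: \<alpha> s)
  case 0
  then show ?case using assms(2) D by (simp add: weight_def shortwords_def)
next
  case (Suc n)
  then have "\<alpha> \<noteq> {#}" by auto
  show ?case
    unfolding sum_permutations_snoc[OF \<open>\<alpha> \<noteq> {#}\<close>]
  proof (rule sum.neutral, rule ballI)
    fix m assume m: "m \<in># \<alpha>"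
    let ?\<alpha> = "\<alpha> - {#m#}"
    have sub: "set_mset ?\<alpha> \<subseteq> shortwords D - {[]}" using Suc.prems by (meson in_diffD subset_iff)
    show "(\<Sum>ms\<in>permutations_of_multiset ?\<alpha>. toep c K (p @ m' @ concat (ms @ [m]) @ s)) = 0"
    proof (cases "length m' + weight ?\<alpha> \<ge> period (Suc k)")
      case True
      have "n = size ?\<alpha>" using Suc.hyps(2) m by (simp add: size_Diff_singleton)
      from Suc.hyps(1)[OF this sub True, of "m @ s"] show ?thesis by simp
    next
      case False
      \<comment> \<open>The factor m straddles the end of the cell. Its first l letters are the
        right outer word of a relation, and the other letters join the right context.\<close>
      define l where "l = period (Suc k) - 1 - length m' - weight ?\<alpha>"
      have l: "l < length m" "length m' + weight ?\<alpha> + l = period (Suc k) - 1"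
        using False Suc.prems(2) weight_remove[OF m] unfolding l_def by linarith+
      have ms: "m \<in> shortwords D" using m Suc.prems by auto
      obtain h where h: "\<And>y. y \<in> binwords (period (Suc k) - 1) \<Longrightarrow>
          toep c K (p @ y @ (drop l m @ s)) = h * toep c (Suc k) y"
        using toep_aligned[OF K assms(1)] by blast
      have "(\<Sum>ms\<in>permutations_of_multiset ?\<alpha>. toep c K (p @ m' @ concat (ms @ [m]) @ s)) =
        (\<Sum>ms\<in>permutations_of_multiset ?\<alpha>. h * toep c (Suc k) (m' @ concat ms @ take l m))"
      proof (rule sum.cong[OF refl])
        fix ms assume ms': "ms \<in> permutations_of_multiset ?\<alpha>"
        have "set (concat ms) \<subseteq> {0, 1}"
        proof
          fix x assume "x \<in> set (concat ms)"
          then obtain w where "w \<in> set ms" "x \<in> set w" by auto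
          moreover have "mset ms = ?\<alpha>" using ms' by (simp add: permutations_of_multiset_def)
          ultimately have "w \<in># ?\<alpha>" by (metis set_mset_mset)
          then show "x \<in> {0, 1}" using sub \<open>x \<in> set w\<close> by (auto simp: shortwords_def)
        qed
        then have "m' @ concat ms @ take l m \<in> binwords (period (Suc k) - 1)"
          using l length_concat_permutation[OF ms'] assms(2) ms set_take_subset[of l m]
          by (auto simp: binwords_def shortwords_def)
        from h[OF this] show "toep c K (p @ m' @ concat (ms @ [m]) @ s) = h * toep c (Suc k) (m' @ concat ms @ take l m)"
          by (simp flip: append_assoc) (simp only: append_assoc append_take_drop_id)
      qed
      also have "\<dots> = h * (\<Sum>ms\<in>permutations_of_multiset ?\<alpha>. toep c (Suc k) (m' @ concat ms @ take l m))"
        by (simp add: sum_distrib_left)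
      also have "(\<Sum>ms\<in>permutations_of_multiset ?\<alpha>. toep c (Suc k) (m' @ concat ms @ take l m)) = 0"
      proof -
        have "size ?\<alpha> \<le> weight ?\<alpha>" using sub by (intro size_le_weight) auto
        then have "size ?\<alpha> \<le> period (Suc k)" using False by linarith
        moreover have "take l m \<in> shortwords D"
          using ms set_take_subset[of l m] by (auto simp: shortwords_def)
        ultimately have "(m', ?\<alpha>, take l m) \<in> relations D (period (Suc k))"
          using sub assms(2) by (auto simp: relations_def)
        then show ?thesis using rel unfolding satisfies_relations_def by fast
      qed
      finally show ?thesis by simp
    qed
  qed
qed

text \<open>Initial factors are fixed one by one until one of them reaches or crosses a multiple of
  the period; the overhang becomes the left outer word. A fixed factor is nonempty, so the distance
  to the boundary drops at least as fast as the number of factors, and a full period of factors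
  remains for the next cell.\<close>

lemma sum_permutations_left:
  assumes "length p \<le> b * period (Suc k)" "set_mset \<alpha> \<subseteq> shortwords D - {[]}"
    "size \<alpha> \<ge> b * period (Suc k) - length p + period (Suc k)"
  shows "(\<Sum>ms\<in>permutations_of_multiset \<alpha>. toep c K (p @ concat ms @ s)) = 0"
  using assms
proof (induction "size \<alpha>" arbitrary: \<alpha> p)
  case 0
  then show ?case using period_pos[of "Suc k"] by linarith
next
  case (Suc n)
  define P where "P = period (Suc k)"
  have weight_ge: "weight \<beta> \<ge> size \<beta>" if "set_mset \<beta> \<subseteq> shortwords D - {[]}" for \<beta>
    using that by (intro size_le_weight) auto
  show ?case
  proof (cases "length p = b * P")
    case True
    have "(\<Sum>ms\<in>permutations_of_multiset \<alpha>. toep c K (p @ [] @ concat ms @ s)) = 0"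
      using True Suc.prems weight_ge[OF Suc.prems(2)] D
      by (intro sum_permutations_right[of p b]) (auto simp: P_def shortwords_def)
    then show ?thesis by simp
  next
    case False
    then have lt: "length p < b * P" using Suc.prems by (simp add: P_def)
    have "\<alpha> \<noteq> {#}" using Suc.hyps(2) by auto
    show ?thesis
      unfolding sum_permutations_Cons[OF \<open>\<alpha> \<noteq> {#}\<close>]
    proof (rule sum.neutral, rule ballI)
      fix m assume m: "m \<in># \<alpha>"
      let ?\<alpha> = "\<alpha> - {#m#}"
      have sub: "set_mset ?\<alpha> \<subseteq> shortwords D - {[]}" using Suc.prems by (meson in_diffD subset_iff)
      have n: "n = size ?\<alpha>" using Suc.hyps(2) m by (simp add: size_Diff_singleton)
      have ms: "m \<in> shortwords D" "length m \<ge> 1"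
        using m Suc.prems by (auto simp: Suc_le_eq)
      show "(\<Sum>ms\<in>permutations_of_multiset ?\<alpha>. toep c K (p @ concat (m # ms) @ s)) = 0"
      proof (cases "length (p @ m) \<le> b * P")
        case True
        have "(\<Sum>ms\<in>permutations_of_multiset ?\<alpha>. toep c K ((p @ m) @ concat ms @ s)) = 0"
          using True n Suc.prems(3) ms(2) Suc.hyps(2) unfolding P_def
          by (intro Suc.hyps(1) sub) auto
        then show ?thesis by simp
      next
        case False
        define l where "l = b * P - length p"
        have l: "length (p @ take l m) = b * P" using False lt by (simp add: l_def)
        have "(\<Sum>ms\<in>permutations_of_multiset ?\<alpha>. toep c K ((p @ take l m) @ drop l m @ concat ms @ s)) = 0"
        proof (rule sum_permutations_right[OF l[unfolded P_def]])
          show "drop l m \<in> shortwords D" using ms(1) set_drop_subset[of l m] by (auto simp: shortwords_def)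
          have "n \<ge> P" using Suc.prems(3) Suc.hyps(2) lt unfolding P_def by linarith
          then show "period (Suc k) \<le> length (drop l m) + weight ?\<alpha>"
            using weight_ge[OF sub] n unfolding P_def by linarith
        qed (rule sub)
        moreover have "take l m @ drop l m @ x = m @ x" for x
          by (simp flip: append_assoc)
        ultimately show ?thesis by simp
      qed
    qed
  qed
qed

end

text \<open>One period of nonempty factors is enough to reach the next cell boundary, and a second
  one to fill the cell behind it. If K \<le> k, the word is already too long for
  \<open>toep c K\<close>.\<close>

lemma sum_permutations_toep:
  fixes c :: "nat \<Rightarrow> nat list \<Rightarrow> 'f::field"
  assumes "satisfies_relations c k D" "D \<ge> 1" "D \<le> period (Suc k)"
    and \<alpha>: "set_mset \<alpha> \<subseteq> shortwords D - {[]}" "size \<alpha> = 2 * period (Suc k)"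
  shows "(\<Sum>ms\<in>permutations_of_multiset \<alpha>. toep c K (p @ concat ms @ s)) = 0"
proof (cases "Suc k \<le> K")
  case True
  define P b where "P = period (Suc k)" and "b = (length p + P - 1) div P"
  have "P > 0" by (simp add: P_def)
  have "length p + P - 1 = b * P + (length p + P - 1) mod P" unfolding b_def by simp
  moreover have "(length p + P - 1) mod P < P" using \<open>P > 0\<close> by simp
  ultimately have b: "length p \<le> b * P" "b * P - length p \<le> P" using \<open>P > 0\<close> by linarith+
  show ?thesis
    using b \<alpha> unfolding P_def by (intro sum_permutations_left[OF assms(1-3) True]) auto
next
  case False
  have "toep c K (p @ concat ms @ s) = 0" if "ms \<in> permutations_of_multiset \<alpha>" for ms
  proof -
    have "size \<alpha> \<le> weight \<alpha>" using \<alpha> by (intro size_le_weight) auto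
    then have "length (concat ms) \<ge> 2 * period (Suc k)"
      using length_concat_permutation[OF that] \<alpha> by simp
    moreover have "period K \<le> period (Suc k)"
      using False period_dvd[of K "Suc k"] by (intro dvd_imp_le) auto
    ultimately have "length (p @ concat ms @ s) \<noteq> period K - 1"
      using period_pos[of "Suc k"] unfolding length_append by linarith
    then show ?thesis unfolding toep_def by simp
  qed
  then show ?thesis by simp
qed

lemma ev_power:
  "ev \<phi> (f ^ n) = (\<Sum>ms | length ms = n \<and> set ms \<subseteq> keys f. (\<Prod>m\<leftarrow>ms. lookup f m) * \<phi> (concat ms))"
proof -
  have "f ^ n = (\<Sum>ms | length ms = n \<and> set ms \<subseteq> keys f. smul (\<Prod>m\<leftarrow>ms. lookup f m) (mon (concat ms)))"
  proof (induction n)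
    case 0
    have "{ms. length ms = 0 \<and> set ms \<subseteq> keys f} = {[]}" by auto
    then show ?case by (simp add: mon_Nil)
  next
    case (Suc n)
    let ?L = "\<lambda>n. {ms. length ms = n \<and> set ms \<subseteq> keys f}"
    have fin: "finite (?L n)" for n
      using finite_lists_length_eq[of "keys f" n] by (simp add: conj_commute)
    have eq: "?L (Suc n) = (\<lambda>(m, ms). m # ms) ` (keys f \<times> ?L n)"
      by (auto simp: length_Suc_conv image_iff)
    have "f ^ Suc n = (\<Sum>m\<in>keys f. smul (lookup f m) (mon m)) * f ^ n"
      using word_expansion[of f] by simp
    also have "\<dots> = (\<Sum>(m, ms)\<in>keys f \<times> ?L n. smul (lookup f m * (\<Prod>m\<leftarrow>ms. lookup f m)) (mon (m @ concat ms)))"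
      unfolding Suc sum_product sum.cartesian_product
      by (intro sum.cong) (auto simp: smul_mult_left smul_mult_right mon_mult)
    also have "\<dots> = (\<Sum>ms\<in>?L (Suc n). smul (\<Prod>m\<leftarrow>ms. lookup f m) (mon (concat ms)))"
      unfolding eq by (subst sum.reindex) (auto simp: inj_on_def intro!: sum.cong)
    finally show ?case .
  qed
  then show ?thesis by (simp add: ev_sum ev_smul)
qed

text \<open>Scalars commute, so in a power all orders of a multiset of monomials carry the same
  coefficient. Grouping by multisets leaves multiples of the sums treated above, with an exponent
  that depends on k alone.\<close>

lemma toep_power_zero:
  fixes c :: "nat \<Rightarrow> nat list \<Rightarrow> 'f::field"
  assumes "satisfies_relations c k D" "D \<ge> 1" "D \<le> period (Suc k)" "keys f \<subseteq> shortwords D - {[]}"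
  shows "ev (\<lambda>u. toep c K (p @ u @ s)) (f ^ (2 * period (Suc k))) = 0"
proof -
  let ?n = "2 * period (Suc k)" and ?\<phi> = "\<lambda>u. toep c K (p @ u @ s)"
  let ?L = "{ms. length ms = ?n \<and> set ms \<subseteq> keys f}"
  have fin: "finite ?L" using finite_lists_length_eq[of "keys f" ?n] by (simp add: conj_commute)
  have "ev ?\<phi> (f ^ ?n) = (\<Sum>ms\<in>?L. (\<Prod>m\<leftarrow>ms. lookup f m) * ?\<phi> (concat ms))"
    by (rule ev_power)
  also have "\<dots> = (\<Sum>\<alpha>\<in>mset ` ?L. \<Sum>ms | ms \<in> ?L \<and> mset ms = \<alpha>. (\<Prod>m\<leftarrow>ms. lookup f m) * ?\<phi> (concat ms))"
    using fin by (intro sum.group[symmetric]) auto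
  also have "\<dots> = 0"
  proof (rule sum.neutral, rule ballI)
    fix \<alpha> assume "\<alpha> \<in> mset ` ?L"
    then have \<alpha>: "set_mset \<alpha> \<subseteq> keys f" "size \<alpha> = ?n" by auto
    have "{ms. ms \<in> ?L \<and> mset ms = \<alpha>} = permutations_of_multiset \<alpha>"
      using \<alpha> by (auto simp: permutations_of_multiset_def simp flip: size_mset set_mset_mset)
    then have "(\<Sum>ms | ms \<in> ?L \<and> mset ms = \<alpha>. (\<Prod>m\<leftarrow>ms. lookup f m) * ?\<phi> (concat ms)) =
      (\<Sum>ms\<in>permutations_of_multiset \<alpha>. (\<Prod>m\<leftarrow>ms. lookup f m) * ?\<phi> (concat ms))" by simp
    also have "\<dots> = (\<Sum>ms\<in>permutations_of_multiset \<alpha>. (\<Prod>m\<in>#\<alpha>. lookup f m) * ?\<phi> (concat ms))"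
      by (intro sum.cong) (auto simp: permutations_of_multiset_def simp flip: prod_mset_prod_list mset_map)
    also have "\<dots> = 0"
      using sum_permutations_toep[OF assms(1-3), of \<alpha> K p s] \<alpha> assms(4)
      by (simp flip: sum_distrib_left)
    finally show "(\<Sum>ms | ms \<in> ?L \<and> mset ms = \<alpha>. (\<Prod>m\<leftarrow>ms. lookup f m) * ?\<phi> (concat ms)) = 0" .
  qed
  finally show ?thesis .
qed

section \<open>A factor-closed language with prescribed growth\<close>

text \<open>The ceiling of f(2^(i+1)) / f(2^i).\<close>

definition block_ratio :: "(nat \<Rightarrow> nat) \<Rightarrow> nat \<Rightarrow> nat" where
  "block_ratio f i = (f (2 ^ Suc i) + f (2 ^ i) - 1) div f (2 ^ i)"

text \<open>The left half is free, while the right half ranges over a subset only. Its size replaces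
  the squaring of the number of words at each doubling of the length by the growth of f.\<close>

primrec langW :: "(nat \<Rightarrow> nat) \<Rightarrow> nat \<Rightarrow> nat list set" where
  "langW f 0 = (\<lambda>a. [a]) ` {..<f 1}"
| "langW f (Suc i) = (\<lambda>(u, v). u @ v) `
     (langW f i \<times> (SOME C. C \<subseteq> langW f i \<and> card C = block_ratio f i))"

definition tailW :: "(nat \<Rightarrow> nat) \<Rightarrow> nat \<Rightarrow> nat list set" where
  "tailW f i = (SOME C. C \<subseteq> langW f i \<and> card C = block_ratio f i)"

lemma langW_Suc: "langW f (Suc i) = (\<lambda>(u, v). u @ v) ` (langW f i \<times> tailW f i)"
  by (simp add: tailW_def)

declare langW.simps(2) [simp del]

definition factorsW :: "(nat \<Rightarrow> nat) \<Rightarrow> nat \<Rightarrow> nat list set" where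
  "factorsW f n = {v. length v = n \<and> (\<exists>i x y. x @ v @ y \<in> langW f i)}"

lemma ex_power_of_two: "n \<ge> 1 \<Longrightarrow> \<exists>k. n \<le> 2 ^ k \<and> 2 ^ k < 2 * (n::nat)"
proof (induction n rule: dec_induct)
  case base
  then show ?case by (intro exI[of _ 0]) simp
next
  case (step n)
  then obtain k where k: "n \<le> 2 ^ k" "2 ^ k < 2 * n" by blast
  show ?case
  proof (cases "Suc n \<le> 2 ^ k")
    case True
    then show ?thesis using k by (intro exI[of _ k]) simp
  next
    case False
    then show ?thesis using k by (intro exI[of _ "Suc k"]) simp
  qed
qed

context
  fixes f :: "nat \<Rightarrow> nat"
  assumes f_pos: "\<And>n. n \<ge> 1 \<Longrightarrow> f n \<ge> 1"
    and f_incr: "\<And>n. n \<ge> 1 \<Longrightarrow> f n < f (Suc n)"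
    and f_submult: "\<And>n m. n \<ge> 1 \<Longrightarrow> m \<ge> 1 \<Longrightarrow> f (n + m) \<le> f n * f m"
begin

lemma f_mono:
  assumes "1 \<le> n" "n \<le> m"
  shows "f n \<le> f m"
  using assms(2,1)
proof (induction m rule: dec_induct)
  case (step m)
  then show ?case using f_incr[of m] by linarith
qed simp

text \<open>Submultiplicativity bounds the ratio by f(2^i), so a subset of that size will be
  available; monotonicity limits the loss from rounding up to a factor 2.\<close>

lemma block_ratio_bounds:
  "block_ratio f i \<le> f (2 ^ i)" "block_ratio f i \<ge> 1"
  "f (2 ^ Suc i) \<le> f (2 ^ i) * block_ratio f i" "f (2 ^ i) * block_ratio f i \<le> 2 * f (2 ^ Suc i)"
proof -
  let ?a = "f (2 ^ i)" and ?b = "f (2 ^ Suc i)"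
  have a: "?a \<ge> 1" by (rule f_pos) simp
  have ab: "?a \<le> ?b" by (rule f_mono) auto
  have "?b \<le> ?a * ?a" using f_submult[of "2 ^ i" "2 ^ i"] by (simp add: mult_2)
  then have "?b + ?a - 1 < Suc ?a * ?a" using a by simp
  then have "block_ratio f i < Suc ?a" unfolding block_ratio_def by (simp add: less_mult_imp_div_less)
  then show "block_ratio f i \<le> ?a" by simp
  show ge1: "block_ratio f i \<ge> 1"
    unfolding block_ratio_def using a ab by (simp add: Suc_le_eq div_greater_zero_iff)
  have div: "?a * block_ratio f i + (?b + ?a - 1) mod ?a = ?b + ?a - 1"
    unfolding block_ratio_def by simp
  moreover have "(?b + ?a - 1) mod ?a < ?a" using a by simp
  ultimately show "?b \<le> ?a * block_ratio f i" "?a * block_ratio f i \<le> 2 * ?b"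
    using ab by linarith+
qed

text \<open>Rounding costs at most a factor 2 at each level, which accumulates to 2^i.\<close>

lemma langW_props:
  "finite (langW f i) \<and> f (2 ^ i) \<le> card (langW f i) \<and> card (langW f i) \<le> 2 ^ i * f (2 ^ i) \<and>
   (\<forall>w\<in>langW f i. length w = 2 ^ i) \<and> tailW f i \<subseteq> langW f i \<and> card (tailW f i) = block_ratio f i"
proof -
  have tail: "tailW f i \<subseteq> langW f i \<and> card (tailW f i) = block_ratio f i"
    if "f (2 ^ i) \<le> card (langW f i)" for i
  proof -
    have "block_ratio f i \<le> card (langW f i)" using block_ratio_bounds(1)[of i] that by simp
    then have "\<exists>C. C \<subseteq> langW f i \<and> card C = block_ratio f i" by (metis obtain_subset_with_card_n)
    then show ?thesis unfolding tailW_def by (rule someI_ex)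
  qed
  show ?thesis
  proof (induction i)
    case 0
    have "card (langW f 0) = f 1" by (simp add: card_image inj_on_def)
    moreover have "finite (langW f 0)" "\<forall>w\<in>langW f 0. length w = 1" by auto
    ultimately show ?case using tail[of 0] by simp
  next
    case (Suc i)
    have inj: "inj_on (\<lambda>(u, v). u @ v) (langW f i \<times> tailW f i)"
      using Suc by (auto simp: inj_on_def)
    then have card: "card (langW f (Suc i)) = card (langW f i) * block_ratio f i"
      unfolding langW_Suc using Suc by (simp add: card_image card_cartesian_product)
    have "finite (tailW f i)" using Suc finite_subset by blast
    then have "finite (langW f (Suc i))" unfolding langW_Suc using Suc by simp
    moreover have len: "\<forall>w\<in>langW f (Suc i). length w = 2 ^ Suc i"
      unfolding langW_Suc using Suc by fastforce
    moreover have lower: "f (2 ^ Suc i) \<le> card (langW f (Suc i))"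
    proof -
      have "f (2 ^ Suc i) \<le> f (2 ^ i) * block_ratio f i" by (rule block_ratio_bounds(3))
      also have "\<dots> \<le> card (langW f (Suc i))" unfolding card using Suc by (intro mult_le_mono1) blast
      finally show ?thesis .
    qed
    moreover have "card (langW f (Suc i)) \<le> 2 ^ Suc i * f (2 ^ Suc i)"
    proof -
      have "card (langW f (Suc i)) \<le> 2 ^ i * f (2 ^ i) * block_ratio f i"
        unfolding card using Suc by (intro mult_le_mono1) blast
      also have "\<dots> \<le> 2 ^ i * (2 * f (2 ^ Suc i))"
        unfolding mult.assoc using block_ratio_bounds(4)[of i] by (intro mult_le_mono2) simp
      finally show ?thesis by simp
    qed
    ultimately show ?case using tail[of "Suc i"] by blast
  qed
qed

lemma finite_langW: "finite (langW f i)"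
  and card_langW_ge: "f (2 ^ i) \<le> card (langW f i)"
  and card_langW_le: "card (langW f i) \<le> 2 ^ i * f (2 ^ i)"
  and length_langW: "w \<in> langW f i \<Longrightarrow> length w = 2 ^ i"
  and tailW_subset: "tailW f i \<subseteq> langW f i"
  and card_tailW: "card (tailW f i) = block_ratio f i"
  using langW_props[of i] by blast+

lemma set_langW: "w \<in> langW f i \<Longrightarrow> set w \<subseteq> {..<f 1}"
proof (induction i arbitrary: w)
  case 0
  then show ?case by auto
next
  case (Suc i)
  then obtain u v where "w = u @ v" "u \<in> langW f i" "v \<in> tailW f i"
    by (auto simp: langW_Suc)
  moreover then have "v \<in> langW f i" using tailW_subset by blast
  ultimately have "w = u @ v" "u \<in> langW f i" "v \<in> langW f i" by blast+
  then show ?case using Suc.IH[of u] Suc.IH[of v] by auto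
qed

lemma langW_extend:
  assumes "w \<in> langW f i" "i \<le> j"
  shows "\<exists>x. w @ x \<in> langW f j"
  using assms(2)
proof (induction j rule: dec_induct)
  case base
  then show ?case using assms(1) by (intro exI[of _ "[]"]) simp
next
  case (step j)
  then obtain x where "w @ x \<in> langW f j" by blast
  moreover obtain v where "v \<in> tailW f j"
  proof -
    have "tailW f j \<noteq> {}" using card_tailW[of j] block_ratio_bounds(2)[of j] by (metis card.empty not_one_le_zero)
    then show ?thesis using that by blast
  qed
  ultimately have "(w @ x) @ v \<in> langW f (Suc j)"
    unfolding langW_Suc by (intro image_eqI[of _ _ "(w @ x, v)"]) auto
  then show ?case by auto
qed

lemma langW_prefix:
  assumes "w \<in> langW f j" "i \<le> j"
  shows "\<exists>u x. u \<in> langW f i \<and> w = u @ x"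
  using assms(2,1)
proof (induction j arbitrary: w rule: dec_induct)
  case base
  then show ?case by (intro exI[of _ w] exI[of _ "[]"]) simp
next
  case (step j)
  then obtain u v where "u \<in> langW f j" "w = u @ v" by (auto simp: langW_Suc)
  moreover obtain u' x where "u' \<in> langW f i" "u = u' @ x"
    using step.IH[OF \<open>u \<in> langW f j\<close>] by blast
  ultimately show ?case by (intro exI[of _ u'] exI[of _ "x @ v"]) simp
qed

lemma langW_suffix:
  assumes "w \<in> langW f j" "Suc i \<le> j"
  shows "\<exists>v x. v \<in> tailW f i \<and> w = x @ v"
  using assms(2,1)
proof (induction j arbitrary: w rule: dec_induct)
  case base
  then show ?case by (auto simp: langW_Suc)
next
  case (step j)
  then obtain u v where "v \<in> tailW f j" "w = u @ v" by (auto simp: langW_Suc)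
  then have "v \<in> langW f j" using tailW_subset by blast
  then obtain v' x where "v' \<in> tailW f i" "v = x @ v'"
    using step.IH by blast
  with \<open>w = u @ v\<close> show ?case by (intro exI[of _ v'] exI[of _ "u @ x"]) simp
qed

lemma factor_append_cases:
  assumes "x @ v @ y = a @ b"
  obtains y' where "x @ v @ y' = a" | x' where "x' @ v @ y = b"
    | v1 v2 where "v = v1 @ v2" "x @ v1 = a" "v2 @ y = b"
proof -
  from assms obtain us where "x @ us = a \<and> v @ y = us @ b \<or> x = a @ us \<and> us @ v @ y = b"
    by (auto simp: append_eq_append_conv2)
  then consider "x @ us = a" "v @ y = us @ b" | "us @ v @ y = b" by blast
  then show ?thesis
  proof cases
    case 1
    then obtain vs where "v @ vs = us \<and> y = vs @ b \<or> v = us @ vs \<and> vs @ y = b"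
      by (auto simp: append_eq_append_conv2)
    then show ?thesis using 1(1) that(1)[of vs] that(3)[of us vs] by auto
  qed (use that(2) in blast)
qed

text \<open>Adjacent blocks of level \<open>i\<close> in a word of higher level never both range over all of
  \<open>langW f i\<close>, so the number of pairs of adjacent blocks is about \<open>f (2 ^ Suc i)\<close> and not its square.\<close>

lemma langW_factor:
  assumes "x @ v @ y \<in> langW f j" "length v \<le> 2 ^ i" "Suc i \<le> j"
  shows "\<exists>x' y'. x' @ v @ y' \<in> (\<lambda>(u, v). u @ v) ` (langW f i \<times> tailW f i \<union> tailW f i \<times> langW f i)"
  using assms(3,1)
proof (induction j arbitrary: x y rule: dec_induct)
  case base
  then have "x @ v @ y \<in> (\<lambda>(u, v). u @ v) ` (langW f i \<times> tailW f i \<union> tailW f i \<times> langW f i)"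
    unfolding langW_Suc by blast
  then show ?case by blast
next
  case (step j)
  then obtain a b where ab: "x @ v @ y = a @ b" "a \<in> langW f j" "b \<in> tailW f j"
    by (auto simp: langW_Suc)
  then have "b \<in> langW f j" using tailW_subset by blast
  note ab = ab(1,2) this
  from ab(1) show ?case
  proof (cases rule: factor_append_cases)
    case (1 y')
    then show ?thesis using step.IH ab by blast
  next
    case (2 x')
    then show ?thesis using step.IH ab by blast
  next
    \<comment> \<open>Here v crosses the midpoint. The left half ends in a block of
      \<open>tailW f i\<close>, the right half begins with a block of \<open>langW f i\<close>, and
      v is no longer than a block, so the two blocks contain it.\<close>
    case (3 v1 v2)
    obtain t a' where t: "t \<in> tailW f i" "a = a' @ t" using langW_suffix[OF ab(2)] step by blast
    obtain h b' where h: "h \<in> langW f i" "b = h @ b'" using langW_prefix[OF ab(3), of i] step by auto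
    have "length t = 2 ^ i" using t tailW_subset length_langW by blast
    have "length h = 2 ^ i" using h length_langW by blast
    have "\<exists>t'. t = t' @ v1"
    proof -
      have "x @ v1 = a' @ t" using 3 t by simp
      then show ?thesis using \<open>length t = 2 ^ i\<close> assms(2) 3
        by (auto simp: append_eq_append_conv2)
    qed
    moreover have "\<exists>h'. h = v2 @ h'"
    proof -
      have "v2 @ y = h @ b'" using 3 h by simp
      then show ?thesis using \<open>length h = 2 ^ i\<close> assms(2) 3
        by (auto simp: append_eq_append_conv2)
    qed
    ultimately obtain t' h' where "t = t' @ v1" "h = v2 @ h'" by blast
    then have "t' @ v @ h' = t @ h" using 3 by simp
    moreover have "t @ h \<in> (\<lambda>(u, v). u @ v) ` (langW f i \<times> tailW f i \<union> tailW f i \<times> langW f i)"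
      using t(1) h(1) by (intro image_eqI[of _ _ "(t, h)"]) auto
    ultimately show ?thesis by metis
  qed
qed

text \<open>A factor is determined by two adjacent blocks of length 2^i that contain it and by its
  starting position, where n + 1 \<le> 2^i < 2 (n + 1). One linear factor counts the positions, the
  other is the rounding loss in the number of words of length 2^(i+1).\<close>

lemma card_factorsW:
  "finite (factorsW f n)" "card (factorsW f n) \<le> 32 * (n + 1) ^ 2 * f (4 * (n + 1))"
proof -
  obtain i where i: "n + 1 \<le> 2 ^ i" "2 ^ i < 2 * (n + 1)" using ex_power_of_two[of "n + 1"] by auto
  let ?Z = "(\<lambda>(u, v). u @ v) ` (langW f i \<times> tailW f i \<union> tailW f i \<times> langW f i)"
  have finT: "finite (tailW f i)" using finite_langW tailW_subset finite_subset by blast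
  have finZ: "finite ?Z" using finite_langW finT by auto
  have card_Suc: "card (langW f i) * card (tailW f i) = card (langW f (Suc i))"
  proof -
    have "inj_on (\<lambda>(u, v). u @ v) (langW f i \<times> tailW f i)"
      using length_langW by (auto simp: inj_on_def)
    then show ?thesis unfolding langW_Suc by (simp add: card_image card_cartesian_product)
  qed
  have "card ?Z \<le> card (langW f i \<times> tailW f i \<union> tailW f i \<times> langW f i)"
    using finite_langW finT by (intro card_image_le) auto
  also have "\<dots> \<le> card (langW f i \<times> tailW f i) + card (tailW f i \<times> langW f i)" by (rule card_Un_le)
  also have "\<dots> = 2 * card (langW f (Suc i))"
    using card_Suc by (simp add: card_cartesian_product mult.commute)
  finally have cardZ: "card ?Z \<le> 2 * card (langW f (Suc i))" .
  let ?E = "(\<lambda>(z, l). take n (drop l z)) ` (?Z \<times> {..2 * 2 ^ i :: nat})"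
  have sub: "factorsW f n \<subseteq> ?E"
  proof
    fix v assume "v \<in> factorsW f n"
    then obtain j x y where v: "length v = n" "x @ v @ y \<in> langW f j" by (auto simp: factorsW_def)
    \<comment> \<open>A word of level at most i is extended to the right, since the pair of blocks
      is found only in words of level at least \<open>Suc i\<close>.\<close>
    obtain z where "(x @ v @ y) @ z \<in> langW f (max j (Suc i))"
      using langW_extend[OF v(2), of "max j (Suc i)"] by auto
    then have "x @ v @ (y @ z) \<in> langW f (max j (Suc i))" by simp
    moreover have "length v \<le> 2 ^ i" using v(1) i by linarith
    ultimately obtain x' y' where xy: "x' @ v @ y' \<in> ?Z"
      using langW_factor[of x v "y @ z" "max j (Suc i)" i] by (meson max.cobounded2)
    have "length z \<le> 2 * 2 ^ i" if z: "z \<in> ?Z" for z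
    proof -
      obtain a b where "z = a @ b" "a \<in> langW f i" "b \<in> langW f i"
        using z tailW_subset by auto
      then show ?thesis using length_langW by simp
    qed
    from this[OF xy] have "length x' \<le> 2 * 2 ^ i" by simp
    moreover have "v = take n (drop (length x') (x' @ v @ y'))" using v(1) by simp
    ultimately show "v \<in> ?E" using xy by (intro image_eqI[of _ _ "(x' @ v @ y', length x')"]) auto
  qed
  show "finite (factorsW f n)" by (rule finite_subset[OF sub]) (use finZ in auto)
  have "card (factorsW f n) \<le> card ?E" using sub finZ by (intro card_mono) auto
  also have "\<dots> \<le> card (?Z \<times> {..2 * 2 ^ i :: nat})" using finZ by (intro card_image_le) auto
  also have "\<dots> = card ?Z * (2 * 2 ^ i + 1)" by (simp add: card_cartesian_product)
  also have "\<dots> \<le> (2 * card (langW f (Suc i))) * (4 * (n + 1))"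
    using cardZ i by (intro mult_le_mono) auto
  also have "\<dots> \<le> (2 * (2 ^ Suc i * f (2 ^ Suc i))) * (4 * (n + 1))"
    by (intro mult_le_mono1 mult_le_mono2 card_langW_le)
  also have "\<dots> \<le> (2 * (4 * (n + 1) * f (4 * (n + 1)))) * (4 * (n + 1))"
  proof -
    have *: "2 ^ Suc i \<le> 4 * (n + 1)" using i by simp
    then have "f (2 ^ Suc i) \<le> f (4 * (n + 1))" by (intro f_mono) auto
    with * show ?thesis by (intro mult_le_mono1 mult_le_mono2 mult_le_mono)
  qed
  finally show "card (factorsW f n) \<le> 32 * (n + 1) ^ 2 * f (4 * (n + 1))"
    by (simp add: power2_eq_square algebra_simps)
qed

end

section \<open>The wreath functional\<close>

text \<open>The letter 2 separates binary words; the value at \<open>2 b\<^sub>1 2 b\<^sub>2 2 \<dots> b\<^sub>n 2\<close> is the product of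
  the values of \<open>G j\<^sub>i\<close> at \<open>b\<^sub>i\<close>, where \<open>j\<^sub>1 \<dots> j\<^sub>n\<close> is the first list.\<close>

primrec wreath :: "(nat \<Rightarrow> nat list \<Rightarrow> 'f::field) \<Rightarrow> nat list \<Rightarrow> nat list \<Rightarrow> 'f" where
  "wreath G [] u = (if u = [2] then 1 else 0)"
| "wreath G (j # w) u = (case u of [] \<Rightarrow> 0 | a # r \<Rightarrow>
     if a = 2 then G j (takeWhile (\<lambda>x. x \<noteq> 2) r) * wreath G w (dropWhile (\<lambda>x. x \<noteq> 2) r) else 0)"

lemma takeWhile_neq_append: "2 \<notin> set b \<Longrightarrow> takeWhile (\<lambda>x. x \<noteq> (2::nat)) (b @ 2 # y) = b"
  and dropWhile_neq_append: "2 \<notin> set b \<Longrightarrow> dropWhile (\<lambda>x. x \<noteq> (2::nat)) (b @ 2 # y) = 2 # y"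
  by (induction b) auto

lemma wreath_nonzeroD:
  assumes "wreath G w u \<noteq> 0"
  shows "\<exists>v. u = 2 # v" "\<exists>v. u = v @ [2]" "count_list u 2 = Suc (length w)"
proof -
  have "(\<exists>v. u = 2 # v) \<and> (\<exists>v. u = v @ [2]) \<and> count_list u 2 = Suc (length w)"
    using assms
  proof (induction w arbitrary: u)
    case Nil
    then show ?case by (auto split: if_splits)
  next
    case (Cons j w)
    then obtain r where u: "u = 2 # r" by (auto split: list.splits if_splits)
    let ?b = "takeWhile (\<lambda>x. x \<noteq> 2) r" and ?d = "dropWhile (\<lambda>x. x \<noteq> 2) r"
    have "wreath G w ?d \<noteq> 0" using Cons.prems by (simp add: u)
    from Cons.IH[OF this] obtain v where v: "?d = v @ [2]" "count_list ?d 2 = Suc (length w)" by blast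
    have r: "r = ?b @ ?d" by simp
    have "count_list ?b 2 = 0" by (auto simp: count_list_0_iff dest: set_takeWhileD)
    then have "count_list r 2 = Suc (length w)" using v(2) by (metis add_0 count_list_append r)
    moreover have "u = (2 # ?b @ v) @ [2]" using r v(1) by (simp add: u)
    ultimately show ?case using u by (metis count_list.simps(2) length_Cons add_Suc_right add.right_neutral One_nat_def)
  qed
  then show "\<exists>v. u = 2 # v" "\<exists>v. u = v @ [2]" "count_list u 2 = Suc (length w)" by blast+
qed

lemma wreath_letter: "2 \<notin> set b \<Longrightarrow> wreath G [j] (2 # b @ [2]) = G j b"
  by (simp add: takeWhile_neq_append dropWhile_neq_append)

text \<open>The letters 2 are the marks around the gaps, and the gaps correspond to the index
  letters. Cutting at a mark cuts the index word after as many letters as there are earlier marks;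
  the mark itself serves both pieces.\<close>

lemma wreath_split:
  "wreath G w (x @ 2 # y) =
    wreath G (take (count_list x 2) w) (x @ [2]) * wreath G (drop (count_list x 2) w) (2 # y)"
proof (induction w arbitrary: x)
  case Nil
  then show ?case by (cases x) auto
next
  case (Cons j w)
  show ?case
  proof (cases x)
    case Nil
    then show ?thesis by simp
  next
    case x: (Cons a x')
    show ?thesis
    proof (cases "a = 2")
      case False
      then show ?thesis using x wreath_nonzeroD(1) by fastforce
    next
      case a: True
      show ?thesis
      proof (cases "2 \<in> set x'")
        case True
        then obtain b x'' where x': "x' = b @ 2 # x''" "2 \<notin> set b" by (auto dest: split_list_first)
        have "count_list b 2 = 0" using x'(2) by (simp add: count_list_0_iff)
        then show ?thesis using Cons.IH[of "2 # x''"] x a x'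
          by (simp add: takeWhile_neq_append dropWhile_neq_append)
      next
        case False
        then have "count_list x' 2 = 0" by (simp add: count_list_0_iff)
        then show ?thesis using x a False
          by (simp add: takeWhile_neq_append dropWhile_neq_append)
      qed
    qed
  qed
qed

lemma wreath_split3:
  assumes "2 \<notin> set b"
  shows "wreath G w (x @ 2 # b @ 2 # y) =
    wreath G (take (count_list x 2) w) (x @ [2]) *
    (wreath G (take 1 (drop (count_list x 2) w)) (2 # b @ [2]) *
     wreath G (drop 1 (drop (count_list x 2) w)) (2 # y))"
proof -
  have "count_list (2 # b) 2 = 1" using assms by (simp add: count_list_0_iff)
  then show ?thesis
    using wreath_split[of G w x "b @ 2 # y"] wreath_split[of G "drop (count_list x 2) w" "2 # b" y]
    by simp
qed

lemma wreath_take1: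
  assumes "2 \<notin> set b"
  shows "wreath G (take 1 w) (2 # b @ [2]) = (if w = [] then 0 else G (hd w) b)"
  using wreath_letter[OF assms, of G "hd w"] by (cases w) auto

lemma wreath_gap:
  assumes "2 \<notin> set b" "wreath G w (x @ 2 # b @ 2 # y) \<noteq> 0"
  shows "\<exists>j\<in>set w. G j b \<noteq> 0"
proof -
  let ?w = "drop (count_list x 2) w"
  have "wreath G (take 1 ?w) (2 # b @ [2]) \<noteq> 0"
    using assms(2) unfolding wreath_split3[OF assms(1)] by auto
  then have "?w \<noteq> []" "G (hd ?w) b \<noteq> 0" unfolding wreath_take1[OF assms(1)] by (auto split: if_splits)
  then show ?thesis by (meson hd_in_set in_set_dropD)
qed

text \<open>\<open>G_support\<close> ties the index j to the length of its gap, so a short gap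
  reveals an index letter of small weight; \<open>\<Omega>_bounded\<close> then limits the number of
  marks. In \<open>G_nil\<close> the exponent is uniform in the index and in the context.\<close>

locale wreath_system =
  fixes G :: "nat \<Rightarrow> nat list \<Rightarrow> 'f::field" and \<Omega> :: "nat list set"
  assumes G_support: "G j u \<noteq> 0 \<Longrightarrow> u \<in> binwords (period j - 1)"
    and G_word: "\<exists>x. G j x = 1"
    and G_nil: "keys f \<subseteq> shortwords d - {[]} \<Longrightarrow>
      \<exists>n\<ge>1. \<forall>j p s. ev (\<lambda>u. G j (p @ u @ s)) (f ^ n) = 0"
    and \<Omega>_bounded: "\<exists>B. \<forall>w\<in>\<Omega>. (\<exists>j\<in>set w. period j \<le> E) \<longrightarrow> length w \<le> B"
begin

lemma G_letters: "G j u \<noteq> 0 \<Longrightarrow> set u \<subseteq> {0, 1}"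
  using G_support by (auto simp: binwords_def)

lemma wreath_letters: "wreath G w u \<noteq> 0 \<Longrightarrow> set u \<subseteq> {0, 1, 2}"
proof (induction w arbitrary: u)
  case Nil
  then show ?case by (auto split: if_splits)
next
  case (Cons j w)
  then obtain r where u: "u = 2 # r" by (auto split: list.splits if_splits)
  have "set (takeWhile (\<lambda>x. x \<noteq> 2) r) \<subseteq> {0, 1}" "set (dropWhile (\<lambda>x. x \<noteq> 2) r) \<subseteq> {0, 1, 2}"
  proof -
    have "G j (takeWhile (\<lambda>x. x \<noteq> 2) r) \<noteq> 0" "wreath G w (dropWhile (\<lambda>x. x \<noteq> 2) r) \<noteq> 0"
      using Cons.prems by (simp_all add: u)
    from G_letters[OF this(1)] Cons.IH[OF this(2)]
    show "set (takeWhile (\<lambda>x. x \<noteq> 2) r) \<subseteq> {0, 1}" "set (dropWhile (\<lambda>x. x \<noteq> 2) r) \<subseteq> {0, 1, 2}"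
      by blast+
  qed
  moreover have "set r = set (takeWhile (\<lambda>x. x \<noteq> 2) r) \<union> set (dropWhile (\<lambda>x. x \<noteq> 2) r)"
    by (metis set_append takeWhile_dropWhile_id)
  ultimately show ?case by (auto simp: u)
qed

section \<open>The ideal killed by the wreath functionals, and nilness modulo it\<close>

definition null_ideal :: "'f word_space set" where
  "null_ideal = {z. \<forall>w\<in>\<Omega>. \<forall>p s. ev (\<lambda>u. wreath G w (p @ u @ s)) z = 0}"

lemma null_ideal_subspace: "T.subspace null_ideal"
  unfolding T.subspace_def null_ideal_def by (auto simp: ev_add ev_smul)

lemma null_ideal_mon:
  assumes "z \<in> null_ideal"
  shows "mon p * z \<in> null_ideal" "z * mon s \<in> null_ideal"
proof -
  have "mon p * z * mon s \<in> null_ideal" for p s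
    unfolding null_ideal_def
  proof safe
    fix w p' s' assume "w \<in> \<Omega>"
    then have "ev (\<lambda>u. wreath G w ((p' @ p) @ u @ (s @ s'))) z = 0"
      using assms unfolding null_ideal_def by blast
    then show "ev (\<lambda>u. wreath G w (p' @ u @ s')) (mon p * z * mon s) = 0"
      by (simp add: ev_mon_mult_mon)
  qed
  from this[of p "[]"] this[of "[]" s]
  show "mon p * z \<in> null_ideal" "z * mon s \<in> null_ideal" by (simp_all add: mon_Nil)
qed

lemma null_ideal_mult:
  assumes "z \<in> null_ideal"
  shows "x * z \<in> null_ideal" "z * x \<in> null_ideal"
proof -
  have "x * z = (\<Sum>w\<in>keys x. smul (lookup x w) (mon w * z))"
    by (subst word_expansion[of x]) (simp add: sum_distrib_right smul_mult_left)
  then show "x * z \<in> null_ideal"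
    using null_ideal_mon[OF assms] null_ideal_subspace
    by (simp add: T.subspace_sum T.subspace_scale)
  have "z * x = (\<Sum>w\<in>keys x. smul (lookup x w) (z * mon w))"
    by (subst word_expansion[of x]) (simp add: sum_distrib_left smul_mult_right)
  then show "z * x \<in> null_ideal"
    using null_ideal_mon[OF assms] null_ideal_subspace
    by (simp add: T.subspace_sum T.subspace_scale)
qed

lemma wreath_binary_window:
  assumes u: "2 \<notin> set u" "u \<noteq> []" and p: "p = p' @ 2 # p''" "2 \<notin> set p''"
    and s: "s = s'' @ 2 # s'" "2 \<notin> set s''"
  shows "wreath G w (p @ u @ s) =
    wreath G (take (count_list p' 2) w) (p' @ [2]) *
    wreath G (drop 1 (drop (count_list p' 2) w)) (2 # s') *
    (if drop (count_list p' 2) w = [] then 0 else G (hd (drop (count_list p' 2) w)) (p'' @ u @ s''))"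
proof -
  have "2 \<notin> set (p'' @ u @ s'')" using assms by auto
  from wreath_split3[OF this, of G w p' s'] wreath_take1[OF this, of G "drop (count_list p' 2) w"]
  show ?thesis by (simp add: p(1) s(1))
qed

lemma wreath_binary_window_zero:
  assumes u: "2 \<notin> set u" "u \<noteq> []" and "2 \<notin> set p \<or> 2 \<notin> set s"
  shows "wreath G w (p @ u @ s) = 0"
proof (rule ccontr)
  assume "wreath G w (p @ u @ s) \<noteq> 0"
  note nz = wreath_nonzeroD(1,2)[OF this]
  from assms(3) show False
  proof
    assume "2 \<notin> set p"
    then show False using nz(1) u by (cases p; cases u) auto
  next
    assume "2 \<notin> set s"
    then show False using nz(2) u by (cases s rule: rev_cases; cases u rule: rev_cases) auto
  qed
qed

lemma ev_cong: "(\<And>u. u \<in> keys z \<Longrightarrow> \<phi> u = \<psi> u) \<Longrightarrow> ev \<phi> z = ev \<psi> z"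
  by (simp add: ev_def)

lemma ev_scale: "ev (\<lambda>u. a * \<phi> u) z = a * ev \<phi> z"
  by (simp add: ev_def sum_distrib_left mult_ac)

text \<open>A nonempty binary word sits inside a single gap, so each context either gives 0 or
  reduces to a scalar multiple of a context for one \<open>G j\<close>.\<close>

lemma binary_null:
  assumes "\<forall>j p s. ev (\<lambda>u. G j (p @ u @ s)) z = 0" "\<And>u. u \<in> keys z \<Longrightarrow> u \<noteq> [] \<and> set u \<subseteq> {0, 1}"
  shows "z \<in> null_ideal"
  unfolding null_ideal_def
proof safe
  fix w p s assume "w \<in> \<Omega>"
  have u: "2 \<notin> set u" "u \<noteq> []" if "u \<in> keys z" for u using assms(2)[OF that] by auto
  show "ev (\<lambda>u. wreath G w (p @ u @ s)) z = 0"
  proof (cases "2 \<notin> set p \<or> 2 \<notin> set s")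
    case True
    then have "ev (\<lambda>u. wreath G w (p @ u @ s)) z = ev (\<lambda>u. 0) z"
      using u by (intro ev_cong wreath_binary_window_zero) auto
    then show ?thesis by (simp add: ev_def)
  next
    case False
    then obtain p' p'' s' s'' where p: "p = p' @ 2 # p''" "2 \<notin> set p''"
      and s: "s = s'' @ 2 # s'" "2 \<notin> set s''"
      by (meson split_list_first split_list_last)
    let ?w = "drop (count_list p' 2) w"
    have "ev (\<lambda>u. wreath G w (p @ u @ s)) z =
      ev (\<lambda>u. (wreath G (take (count_list p' 2) w) (p' @ [2]) * wreath G (drop 1 ?w) (2 # s') *
        (if ?w = [] then 0 else 1)) * G (hd ?w) (p'' @ u @ s'')) z"
      using u by (intro ev_cong) (simp add: wreath_binary_window[OF _ _ p s])
    also have "\<dots> = 0" unfolding ev_scale using assms(1) by simp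
    finally show ?thesis .
  qed
qed

lemma keys_power:
  "keys (z ^ n) \<subseteq> {concat vs | vs. length vs = n \<and> set vs \<subseteq> keys z}"
proof (induction n)
  case 0
  show ?case by (simp add: zero_list_def)
next
  case (Suc n)
  show ?case
  proof
    fix w assume "w \<in> keys (z ^ Suc n)"
    then obtain u v where uv: "w = u @ v" "u \<in> keys z" "v \<in> keys (z ^ n)"
      using keys_mult_subset[of z "z ^ n"] by auto
    then obtain vs where "v = concat vs" "length vs = n" "set vs \<subseteq> keys z" using Suc by blast
    then show "w \<in> {concat vs | vs. length vs = Suc n \<and> set vs \<subseteq> keys z}"
      using uv by (intro CollectI exI[of _ "u # vs"]) auto
  qed
qed

text \<open>In a nonzero value each factor contains a 2. The last 2 of one factor and the first 2 of
  the next enclose a gap of length at most 2 E, so the index word has a letter of weight at most 2 E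
  + 1 and length at most B. It then allows at most B + 1 marks, fewer than the B + 2 factors
  provide.\<close>

lemma separated_word_null:
  assumes "\<And>v. v \<in> keys z \<Longrightarrow> \<not> set v \<subseteq> {0, 1}"
  shows "\<exists>n\<ge>1. z ^ n \<in> null_ideal"
proof -
  obtain E where E: "\<And>v. v \<in> keys z \<Longrightarrow> length v \<le> E"
    using finite_maxlen[of "keys z"] by (metis finite_keys less_imp_le)
  obtain B where B: "\<And>w j. w \<in> \<Omega> \<Longrightarrow> j \<in> set w \<Longrightarrow> period j \<le> 2 * E + 1 \<Longrightarrow> length w \<le> B"
    using \<Omega>_bounded[of "2 * E + 1"] by blast
  define n where "n = B + 2"
  have "wreath G w (p @ concat vs @ s) = 0"
    if w: "w \<in> \<Omega>" and vs: "length vs = n" "set vs \<subseteq> keys z" for w p s vs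
  proof (rule ccontr)
    assume nz: "wreath G w (p @ concat vs @ s) \<noteq> 0"
    have two: "2 \<in> set v" if "v \<in> set vs" for v
    proof -
      have "set v \<subseteq> {0, 1, 2}" using wreath_letters[OF nz] that by auto
      moreover have "\<not> set v \<subseteq> {0, 1}" using assms vs that by blast
      ultimately show ?thesis by auto
    qed
    obtain v1 v2 vs' where vs': "vs = v1 # v2 # vs'" using vs(1) n_def by (metis Suc_length_conv add_2_eq_Suc')
    obtain x1 y1 where v1: "v1 = x1 @ 2 # y1" "2 \<notin> set y1" using two[of v1] vs' by (auto dest: split_list_last)
    obtain x2 y2 where v2: "v2 = x2 @ 2 # y2" "2 \<notin> set x2" using two[of v2] vs' by (auto dest: split_list_first)
    have "2 \<notin> set (y1 @ x2)" using v1 v2 by auto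
    moreover have "wreath G w ((p @ x1) @ 2 # (y1 @ x2) @ 2 # (y2 @ concat vs' @ s)) \<noteq> 0"
      using nz by (simp add: vs' v1 v2)
    ultimately obtain j where j: "j \<in> set w" "G j (y1 @ x2) \<noteq> 0" using wreath_gap by blast
    have "period j - 1 = length y1 + length x2" using G_support[OF j(2)] by (simp add: binwords_def)
    moreover have "length y1 \<le> E" "length x2 \<le> E"
      using E[of v1] E[of v2] vs v1 v2 vs' by auto
    ultimately have "period j \<le> 2 * E + 1" by linarith
    then have "length w \<le> B" using B w j by blast
    have cl: "length us \<le> count_list (concat us) 2" if "\<And>v. v \<in> set us \<Longrightarrow> 2 \<in> set v" for us :: "nat list list"
      using that
    proof (induction us)
      case (Cons v us)
      then have "count_list v 2 \<noteq> 0" by (auto simp: count_list_0_iff)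
      then show ?case using Cons by simp
    qed simp
    have "n \<le> count_list (p @ concat vs @ s) 2" using cl[of vs] two vs by simp
    then have "n \<le> Suc (length w)" using wreath_nonzeroD(3)[OF nz] by simp
    then show False using \<open>length w \<le> B\<close> n_def by simp
  qed
  then have "z ^ n \<in> null_ideal"
    unfolding null_ideal_def ev_def using keys_power[of z n]
    by (auto intro!: sum.neutral)
  then show ?thesis by (intro exI[of _ n]) (simp add: n_def)
qed

lemma power_diff_null:
  assumes "x - y \<in> null_ideal"
  shows "x ^ n - y ^ n \<in> null_ideal"
proof (induction n)
  case 0
  then show ?case using T.subspace_0[OF null_ideal_subspace] by simp
next
  case (Suc n)
  have "x ^ Suc n - y ^ Suc n = (x - y) * x ^ n + y * (x ^ n - y ^ n)" by (simp add: algebra_simps)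
  then show ?case
    using null_ideal_mult[OF assms, of "x ^ n"] null_ideal_mult[OF Suc, of y]
      T.subspace_add[OF null_ideal_subspace] by simp
qed

text \<open>Let z0 be the binary part of z. Some z0^n is in the ideal, and every word of z^n - z0^n
  contains a nonbinary letter, so a power of this difference is in the ideal. Modulo the ideal the
  difference is z^n.\<close>

lemma nil_modulo_null_ideal:
  assumes "[] \<notin> keys z"
  shows "\<exists>n\<ge>1. z ^ n \<in> null_ideal"
proof -
  define z0 where "z0 = (\<Sum>w\<in>{w \<in> keys z. set w \<subseteq> {0, 1}}. smul (lookup z w) (mon w))"
  define z1 where "z1 = (\<Sum>w\<in>{w \<in> keys z. \<not> set w \<subseteq> {0, 1}}. smul (lookup z w) (mon w))"
  have z: "z = z0 + z1"
  proof -
    have "keys z = {w \<in> keys z. set w \<subseteq> {0, 1}} \<union> {w \<in> keys z. \<not> set w \<subseteq> {0, 1}}" by auto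
    then have "(\<Sum>w\<in>keys z. smul (lookup z w) (mon w)) = z0 + z1"
      unfolding z0_def z1_def by (subst sum.union_disjoint[symmetric]) auto
    then show ?thesis using word_expansion[of z] by simp
  qed
  have keys_comb: "keys (\<Sum>w\<in>A. smul (a w) (mon w)) \<subseteq> A" for A and a :: "nat list \<Rightarrow> 'f"
    using keys_sum[of "\<lambda>w. smul (a w) (mon w)" A] keys_smul_subset
    by (force simp: mon_def)
  have k0: "keys z0 \<subseteq> {w \<in> keys z. set w \<subseteq> {0, 1}}" unfolding z0_def by (rule keys_comb)
  have k1: "keys z1 \<subseteq> {w \<in> keys z. \<not> set w \<subseteq> {0, 1}}" unfolding z1_def by (rule keys_comb)
  obtain E where "\<And>v. v \<in> keys z \<Longrightarrow> length v < E"
    using finite_maxlen[of "keys z"] by (metis finite_keys)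
  then have "keys z0 \<subseteq> shortwords E - {[]}" using k0 assms by (auto simp: shortwords_def)
  then obtain n where n: "n \<ge> 1" "\<forall>j p s. ev (\<lambda>u. G j (p @ u @ s)) (z0 ^ n) = 0"
    using G_nil by blast
  have z0n: "z0 ^ n \<in> null_ideal"
  proof (rule binary_null[OF n(2)])
    fix u assume "u \<in> keys (z0 ^ n)"
    then obtain vs where u: "u = concat vs" "length vs = n" "set vs \<subseteq> keys z0"
      using keys_power[of z0 n] by blast
    have "set u \<subseteq> {0, 1}" using u k0 by auto
    moreover have "vs \<noteq> []" using u(2) n(1) by auto
    then have "u \<noteq> []" using u k0 assms by (cases vs) auto
    ultimately show "u \<noteq> [] \<and> set u \<subseteq> {0, 1}" by simp
  qed
  have sep: "\<not> set v \<subseteq> {0, 1}" if "v \<in> keys (z ^ m - z0 ^ m)" for m v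
    using that
  proof (induction m arbitrary: v)
    case 0
    then show ?case by simp
  next
    case (Suc m)
    have "z ^ Suc m - z0 ^ Suc m = z1 * z ^ m + z0 * (z ^ m - z0 ^ m)"
      by (simp add: algebra_simps) (simp add: z algebra_simps)
    then have "v \<in> keys (z1 * z ^ m) \<or> v \<in> keys (z0 * (z ^ m - z0 ^ m))"
      using Suc.prems Poly_Mapping.keys_add[of "z1 * z ^ m" "z0 * (z ^ m - z0 ^ m)"] by auto
    then show ?case
    proof
      assume "v \<in> keys (z1 * z ^ m)"
      then show ?thesis using keys_mult_subset[of z1 "z ^ m"] k1 by fastforce
    next
      assume "v \<in> keys (z0 * (z ^ m - z0 ^ m))"
      then show ?thesis using keys_mult_subset[of z0 "z ^ m - z0 ^ m"] Suc.IH by fastforce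
    qed
  qed
  obtain m where m: "m \<ge> 1" "(z ^ n - z0 ^ n) ^ m \<in> null_ideal"
    using separated_word_null[of "z ^ n - z0 ^ n"] sep by blast
  have "z ^ n - (z ^ n - z0 ^ n) \<in> null_ideal" using z0n by simp
  from power_diff_null[OF this, of m] m(2) have "(z ^ n) ^ m \<in> null_ideal"
    using T.subspace_add[OF null_ideal_subspace] by fastforce
  then show ?thesis using n m by (intro exI[of _ "n * m"]) (simp add: power_mult)
qed

section \<open>Rank of the wreath functionals\<close>

lemma rank_wreath_left:
  assumes "rank_le UNIV (binwords l) (\<lambda>(j, p, s) u. G j (p @ u @ s)) R"
  shows "rank_le UNIV (binwords l)
    (\<lambda>(w, p) b. wreath G (take (count_list p 2) w) (p @ b @ [2])) (R + 1)"
proof -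
  \<comment> \<open>The left context is cut at its last 2; only the piece behind it shares a gap
    with b.\<close>
  define pre post where "pre p = (SOME x. \<exists>y. p = x @ 2 # y \<and> 2 \<notin> set y)"
    and "post p = (SOME y. p = pre p @ 2 # y \<and> 2 \<notin> set y)" for p :: "nat list"
  have pp: "p = pre p @ 2 # post p \<and> 2 \<notin> set (post p)" if "2 \<in> set p" for p
  proof -
    have "\<exists>x y. p = x @ 2 # y \<and> 2 \<notin> set y" using split_list_last[OF that] by blast
    then have "\<exists>y. p = pre p @ 2 # y \<and> 2 \<notin> set y" unfolding pre_def by (rule someI_ex)
    then show ?thesis unfolding post_def by (rule someI_ex)
  qed
  define v where "v w p = drop (count_list (pre p) 2) (take (count_list p 2) w)" for w p :: "nat list"
  define \<alpha> where "\<alpha> = (\<lambda>(w, p). if 2 \<in> set p \<and> v w p \<noteq> []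
    then wreath G (take (count_list (pre p) 2) (take (count_list p 2) w)) (pre p @ [2]) else 0)"
  \<comment> \<open>The second summand is the case in which p and b are both empty and no gap is
    opened; it accounts for the added 1 in the rank.\<close>
  have eq: "wreath G (take (count_list p 2) w) (p @ b @ [2]) =
      \<alpha> (w, p) * 1 * G (hd (v w p)) (post p @ b @ []) + of_bool (p = []) * of_bool (b = [])"
    if "b \<in> binwords l" for w p b
  proof (cases "2 \<in> set p")
    case False
    have "2 \<notin> set b" using that by (auto simp: binwords_def)
    show ?thesis
    proof (cases "p @ b = []")
      case True
      then show ?thesis by (simp add: \<alpha>_def)
    next
      case ne: False
      have "p @ b @ [2] \<noteq> [2]" using ne by simp
      moreover have "count_list p 2 = 0" using False by (simp add: count_list_0_iff)
      ultimately show ?thesis using ne by (auto simp: \<alpha>_def False)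
    qed
  next
    case True
    note pq = pp[OF True]
    have nb: "2 \<notin> set (post p @ b)" using that pq by (auto simp: binwords_def)
    have "count_list (pre p @ 2 # post p) 2 = Suc (count_list (pre p) 2)"
      using conjunct2[OF pq] by (simp add: count_list_0_iff)
    then have cnt: "count_list p 2 = Suc (count_list (pre p) 2)"
      by (rule trans[OF arg_cong[OF conjunct1[OF pq], of "\<lambda>x. count_list x 2"]])
    have v1: "take 1 (v w p) = v w p" by (simp add: v_def cnt)
    have "wreath G (take (count_list p 2) w) (p @ b @ [2]) =
      wreath G (take (count_list p 2) w) (pre p @ 2 # ((post p @ b) @ [2]))"
    proof -
      have "p @ b @ [2] = pre p @ 2 # ((post p @ b) @ [2])"
        using pq by (metis append.assoc append_Cons)
      then show ?thesis by (rule arg_cong)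
    qed
    also have "\<dots> = wreath G (take (count_list (pre p) 2) (take (count_list p 2) w)) (pre p @ [2]) *
       wreath G (v w p) (2 # (post p @ b) @ [2])"
      unfolding v_def by (rule wreath_split)
    also have "wreath G (v w p) (2 # (post p @ b) @ [2]) = (if v w p = [] then 0 else G (hd (v w p)) (post p @ b))"
      using wreath_take1[OF nb, of G "v w p"] unfolding v1 .
    finally show ?thesis using True by (auto simp: \<alpha>_def)
  qed
  have r1: "rank_le UNIV (binwords l) (\<lambda>x u. \<alpha> x * 1 * (\<lambda>(w, p) u. G (hd (v w p)) (post p @ u @ [])) x u) R"
    using rank_le_scale[OF rank_le_pullback[OF assms, of UNIV "\<lambda>(w, p). (hd (v w p), post p, [])" "binwords l" "\<lambda>u. u"],
      of \<alpha> "\<lambda>_. 1"] by (simp add: split_def)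
  have r2: "rank_le UNIV (binwords l) (\<lambda>x u. of_bool (snd (x :: nat list \<times> nat list) = []) * (of_bool (u = []) :: 'f)) 1"
    by (rule rank_le_outer)
  have "rank_le UNIV (binwords l) (\<lambda>x u. \<Sum>i\<in>{True, False}.
      (if i then \<alpha> x * 1 * (\<lambda>(w, p) u. G (hd (v w p)) (post p @ u @ [])) x u
       else of_bool (snd x = []) * of_bool (u = [])))
     (\<Sum>i\<in>{True, False}. if i then R else 1)"
    by (rule rank_le_sum) (use r1 r2 in auto)
  then have "rank_le UNIV (binwords l) (\<lambda>x u. \<alpha> x * 1 * (\<lambda>(w, p) u. G (hd (v w p)) (post p @ u @ [])) x u +
       of_bool (snd x = []) * of_bool (u = [])) (R + 1)" by simp
  moreover have "(\<lambda>(w, p) b. wreath G (take (count_list p 2) w) (p @ b @ [2])) x u =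
      \<alpha> x * 1 * (\<lambda>(w, p) u. G (hd (v w p)) (post p @ u @ [])) x u + of_bool (snd x = []) * of_bool (u = [])"
    if "u \<in> binwords l" for x u
    using eq[OF that] by (cases x) (simp only: prod.case snd_conv)
  ultimately show ?thesis by (simp cong: rank_le_cong)
qed

text \<open>Mirror image of \<open>rank_wreath_left\<close>: the right context is cut at its first
  2, and the added 1 covers the case of b and s both empty.\<close>

lemma rank_wreath_right:
  assumes "rank_le UNIV (binwords l) (\<lambda>(j, p, s) u. G j (p @ u @ s)) R"
  shows "rank_le UNIV (binwords l) (\<lambda>(w, s) b. wreath G w (2 # b @ s)) (R + 1)"
proof -
  define pre post where "pre s = (SOME x. \<exists>y. s = x @ 2 # y \<and> 2 \<notin> set x)"
    and "post s = (SOME y. s = pre s @ 2 # y \<and> 2 \<notin> set (pre s))" for s :: "nat list"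
  have pp: "s = pre s @ 2 # post s \<and> 2 \<notin> set (pre s)" if "2 \<in> set s" for s
  proof -
    have "\<exists>x y. s = x @ 2 # y \<and> 2 \<notin> set x" using split_list_first[OF that] by blast
    then have "\<exists>y. s = pre s @ 2 # y \<and> 2 \<notin> set (pre s)" unfolding pre_def by (rule someI_ex)
    then show ?thesis unfolding post_def by (rule someI_ex)
  qed
  define \<alpha> where "\<alpha> = (\<lambda>(w, s). if 2 \<in> set s \<and> w \<noteq> [] then wreath G (drop 1 w) (2 # post s) else 0)"
  have eq: "wreath G w (2 # b @ s) = \<alpha> (w, s) * 1 * G (hd w) ([] @ b @ pre s) +
      (wreath G w [2] * of_bool (s = [])) * of_bool (b = [])"
    if "b \<in> binwords l" for w s b
  proof (cases "2 \<in> set s")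
    case False
    have nb: "2 \<notin> set b" using that by (auto simp: binwords_def)
    have "wreath G w (2 # b @ s) = 0" if "b @ s \<noteq> []"
    proof (rule ccontr)
      assume "wreath G w (2 # b @ s) \<noteq> 0"
      then obtain v where "2 # b @ s = v @ [2]" using wreath_nonzeroD(2) by blast
      then have "2 \<in> set (b @ s)" using that by (cases v) auto
      then show False using nb False by auto
    qed
    then show ?thesis using False by (auto simp: \<alpha>_def)
  next
    case True
    note pq = pp[OF True]
    have nb: "2 \<notin> set (b @ pre s)" using that pq by (auto simp: binwords_def)
    have "2 # b @ s = (2 # b @ pre s) @ 2 # post s"
      using pq by (metis append.assoc append_Cons)
    moreover have "count_list (2 # b @ pre s) 2 = 1" using nb by (simp add: count_list_0_iff)
    ultimately have "wreath G w (2 # b @ s) =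
        wreath G (take 1 w) (2 # (b @ pre s) @ [2]) * wreath G (drop 1 w) (2 # post s)"
      using wreath_split[of G w "2 # b @ pre s" "post s"] by simp
    also have "wreath G (take 1 w) (2 # (b @ pre s) @ [2]) = (if w = [] then 0 else G (hd w) (b @ pre s))"
      by (rule wreath_take1[OF nb])
    finally show ?thesis using True by (auto simp: \<alpha>_def)
  qed
  have r1: "rank_le UNIV (binwords l) (\<lambda>x u. \<alpha> x * 1 * (\<lambda>(w, s) u. G (hd w) ([] @ u @ pre s)) x u) R"
    using rank_le_scale[OF rank_le_pullback[OF assms, of UNIV "\<lambda>(w, s). (hd w, [], pre s)" "binwords l" "\<lambda>u. u"],
      of \<alpha> "\<lambda>_. 1"] by (simp add: split_def)
  have r2: "rank_le UNIV (binwords l) (\<lambda>x u. (wreath G (fst x) [2] * of_bool (snd x = [])) * (of_bool (u = []) :: 'f)) 1"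
    by (rule rank_le_outer)
  have "rank_le UNIV (binwords l) (\<lambda>x u. \<Sum>i\<in>{True, False}.
      (if i then \<alpha> x * 1 * (\<lambda>(w, s) u. G (hd w) ([] @ u @ pre s)) x u
       else (wreath G (fst x) [2] * of_bool (snd x = [])) * of_bool (u = [])))
     (\<Sum>i\<in>{True, False}. if i then R else 1)"
    by (rule rank_le_sum) (use r1 r2 in auto)
  then have "rank_le UNIV (binwords l) (\<lambda>x u. \<alpha> x * 1 * (\<lambda>(w, s) u. G (hd w) ([] @ u @ pre s)) x u +
       (wreath G (fst x) [2] * of_bool (snd x = [])) * of_bool (u = [])) (R + 1)" by simp
  moreover have "(\<lambda>(w, s) b. wreath G w (2 # b @ s)) x u =
      \<alpha> x * 1 * (\<lambda>(w, s) u. G (hd w) ([] @ u @ pre s)) x u +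
       (wreath G (fst x) [2] * of_bool (snd x = [])) * of_bool (u = [])"
    if "u \<in> binwords l" for x u
    using eq[OF that] by (cases x) (simp only: prod.case snd_conv fst_conv)
  ultimately show ?thesis by (simp cong: rank_le_cong)
qed

lemma wreath_split_window:
  assumes "mid = 2 # y" "mid = y' @ [2]" "2 \<notin> set b"
  shows "wreath G w (x @ b @ mid @ z) = wreath G (take (count_list x 2) w) (x @ b @ [2]) *
    (wreath G (take (count_list mid 2 - 1) (drop (count_list x 2) w)) mid *
     wreath G (drop (count_list mid 2 - 1) (drop (count_list x 2) w)) (2 # z))"
proof -
  let ?w = "drop (count_list x 2) w"
  have b: "count_list b 2 = 0" using assms(3) by (simp add: count_list_0_iff)
  have "count_list mid 2 - 1 = count_list y' 2" by (simp add: assms(2))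
  moreover have "wreath G ?w (2 # y @ z) =
      wreath G (take (count_list y' 2) ?w) (y' @ [2]) * wreath G (drop (count_list y' 2) ?w) (2 # z)"
  proof -
    have "2 # y @ z = y' @ 2 # z" using assms(1,2) by (metis append.assoc append_Cons append_Nil)
    then show ?thesis by (simp only: wreath_split[of G ?w y' z])
  qed
  moreover have "wreath G w (x @ b @ mid @ z) = wreath G (take (count_list x 2) w) (x @ b @ [2]) *
      wreath G ?w (2 # y @ z)"
    using wreath_split[of G w "x @ b" "y @ z"] b by (simp add: assms(1))
  ultimately show ?thesis using assms(2) by simp
qed

lemma rank_wreath_binary:
  assumes "rank_le UNIV (binwords d) (\<lambda>(j, p, s) u. G j (p @ u @ s)) R" "d \<ge> 1"
  shows "rank_le UNIV (binwords d) (\<lambda>(w, p, s) u. wreath G w (p @ u @ s)) R"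
proof -
  define C where "C = {(w :: nat list, p :: nat list, s :: nat list). 2 \<in> set p \<and> 2 \<in> set s}"
  have "\<forall>x\<in>C. \<exists>a g. \<forall>u\<in>binwords d. (case x of (w, p, s) \<Rightarrow> wreath G w (p @ u @ s)) =
      a * (case g of (j, p, s) \<Rightarrow> G j (p @ u @ s))"
  proof
    fix x assume "x \<in> C"
    then obtain w p s where x: "x = (w, p, s)" "2 \<in> set p" "2 \<in> set s" by (auto simp: C_def)
    then obtain p' p'' s' s'' where p: "p = p' @ 2 # p''" "2 \<notin> set p''"
      and s: "s = s'' @ 2 # s'" "2 \<notin> set s''"
      by (meson split_list_first split_list_last)
    let ?w = "drop (count_list p' 2) w"
    have "wreath G w (p @ u @ s) = (wreath G (take (count_list p' 2) w) (p' @ [2]) *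
        wreath G (drop 1 ?w) (2 # s') * (if ?w = [] then 0 else 1)) * G (hd ?w) (p'' @ u @ s'')"
      if "u \<in> binwords d" for u
    proof -
      have "2 \<notin> set u" "u \<noteq> []" using that assms(2) by (auto simp: binwords_def)
      then show ?thesis by (simp add: wreath_binary_window[OF _ _ p s])
    qed
    then show "\<exists>a g. \<forall>u\<in>binwords d. (case x of (w, p, s) \<Rightarrow> wreath G w (p @ u @ s)) =
      a * (case g of (j, p, s) \<Rightarrow> G j (p @ u @ s))"
      unfolding x by (intro exI[of _ "wreath G (take (count_list p' 2) w) (p' @ [2]) *
        wreath G (drop 1 ?w) (2 # s') * (if ?w = [] then 0 else 1)"] exI[of _ "(hd ?w, p'', s'')"]) simp
  qed
  then obtain a g where ag: "\<And>x u. x \<in> C \<Longrightarrow> u \<in> binwords d \<Longrightarrow>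
      (case x of (w, p, s) \<Rightarrow> wreath G w (p @ u @ s)) = a x * (case g x of (j, p, s) \<Rightarrow> G j (p @ u @ s))"
    by metis
  have "rank_le C (binwords d) (\<lambda>x u. a x * 1 * (case g x of (j, p, s) \<Rightarrow> G j (p @ u @ s))) R"
    using rank_le_scale[OF rank_le_pullback[OF assms(1), of C g "binwords d" "\<lambda>u. u"], of a "\<lambda>_. 1"]
    by (simp add: split_def)
  then have "rank_le C (binwords d) (\<lambda>x u. case x of (w, p, s) \<Rightarrow> wreath G w (p @ u @ s)) R"
    using ag by (simp add: split_def cong: rank_le_cong)
  then have "rank_le C (binwords d) (\<lambda>(w, p, s) u. wreath G w (p @ u @ s)) R"
    by (simp add: split_def)
  then show ?thesis
  proof (rule rank_le_zero_rows)
    fix x u assume "x \<in> UNIV - C" and u: "u \<in> binwords d"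
    then obtain w p s where x: "x = (w, p, s)" "2 \<notin> set p \<or> 2 \<notin> set s"
      by (cases x) (auto simp: C_def)
    have "2 \<notin> set u" "u \<noteq> []" using u assms(2) by (auto simp: binwords_def)
    then show "(case x of (w, p, s) \<Rightarrow> \<lambda>u. wreath G w (p @ u @ s)) u = 0"
      using wreath_binary_window_zero[OF _ _ x(2)] by (simp add: x(1))
  qed
qed

text \<open>Columns are sorted by the lengths of their binary ends and by their number of marks.
  Within a class the value is a product of a left, a middle and a right part. The row enters the
  middle part only through the factor of its index word that is read there, and V contains all
  factors that matter.\<close>

lemma rank_wreath:
  assumes R: "\<And>l. l \<le> d \<Longrightarrow> rank_le UNIV (binwords l) (\<lambda>(j, p, s) u. G j (p @ u @ s)) R" and d: "d \<ge> 1"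
    and V: "finite V" "card V \<ge> 1" "\<And>x v y z. x @ v @ y \<in> \<Omega> \<Longrightarrow> length z \<le> d \<Longrightarrow> wreath G v z \<noteq> 0 \<Longrightarrow> v \<in> V"
  shows "rank_le {(w, p, s). w \<in> \<Omega>} {u. length u = d \<and> set u \<subseteq> {0, 1, 2}}
    (\<lambda>(w, p, s) u. wreath G w (p @ u @ s)) (2 * (d + 1) ^ 3 * ((R + 1) * card V * (R + 1)))"
proof -
  \<comment> \<open>Here mid runs from the first 2 of u to the last. Its t marks enclose t - 1 gaps,
    hence the \<open>t - 1\<close> index letters read by it below.\<close>
  define U where "U l0 l1 t = {u. \<exists>b0 y y' mid b1. u = b0 @ mid @ b1 \<and> b0 \<in> binwords l0 \<and> b1 \<in> binwords l1 \<and>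
     mid = 2 # y \<and> mid = y' @ [2] \<and> count_list mid 2 = t \<and> length u = d}" for l0 l1 t
  define J where "J = insert None (Some ` ({..d} \<times> {..d} \<times> {..d}))"
  define UU where "UU = (\<lambda>i. case i of None \<Rightarrow> binwords d | Some (l0, l1, t) \<Rightarrow> U l0 l1 t)"
  let ?C = "{(w :: nat list, p :: nat list, s :: nat list). w \<in> \<Omega>}"
  let ?M = "\<lambda>(w, p, s) u. wreath G w (p @ u @ s)"
  let ?n = "(R + 1) * card V * (R + 1)"
  have rU: "rank_le ?C (U l0 l1 t) ?M ?n" if "l0 \<le> d" "l1 \<le> d" for l0 l1 t
  proof -
    define mid where "mid u = take (d - l1 - l0) (drop l0 u)" for u :: "nat list"
    have eq: "?M (w, p, s) u = wreath G (take (count_list p 2) w) (p @ take l0 u @ [2]) *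
       wreath G (take (t - 1) (drop (count_list p 2) w)) (mid u) *
       wreath G (drop (t - 1) (drop (count_list p 2) w)) (2 # drop (d - l1) u @ s)"
      and len: "length (mid u) \<le> d"
      if uU: "u \<in> U l0 l1 t" for w p s u
    proof -
      obtain b0 y y' m b1 where u: "u = b0 @ m @ b1" "b0 \<in> binwords l0" "b1 \<in> binwords l1"
        "m = 2 # y" "m = y' @ [2]" "count_list m 2 = t" "length u = d"
        using uU unfolding U_def by blast
      have l: "length b0 = l0" "length b1 = l1" "2 \<notin> set b0" using u by (auto simp: binwords_def)
      have lm: "length m = d - l1 - l0" "d - l1 = l0 + length m" using u(1,7) l by auto
      have parts: "take l0 u = b0" "mid u = m" "drop (d - l1) u = b1"
        unfolding mid_def lm(1)[symmetric] by (simp_all add: u(1) l(1)[symmetric] lm(2))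
      show "length (mid u) \<le> d" using u parts by simp
      have "p @ u @ s = p @ b0 @ m @ (b1 @ s)" by (simp add: u(1))
      then have "?M (w, p, s) u = wreath G w (p @ b0 @ m @ (b1 @ s))" by simp
      then show "?M (w, p, s) u = wreath G (take (count_list p 2) w) (p @ take l0 u @ [2]) *
       wreath G (take (t - 1) (drop (count_list p 2) w)) (mid u) *
       wreath G (drop (t - 1) (drop (count_list p 2) w)) (2 # drop (d - l1) u @ s)"
        unfolding wreath_split_window[OF u(4,5) l(3)] parts u(6) by (simp add: mult.assoc)
    qed
    have bin: "take l0 u \<in> binwords l0" "drop (d - l1) u \<in> binwords l1" if uU: "u \<in> U l0 l1 t" for u
    proof -
      obtain b0 m b1 where u: "u = b0 @ m @ b1" "b0 \<in> binwords l0" "b1 \<in> binwords l1" "length u = d"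
        using uU unfolding U_def by blast
      have l: "length b0 = l0" "length b1 = l1" using u by (auto simp: binwords_def)
      have lm: "d - l1 = length b0 + length m" using u(1,4) l by auto
      show "take l0 u \<in> binwords l0" using u l by simp
      show "drop (d - l1) u \<in> binwords l1" unfolding lm using u l by simp
    qed
    have r1: "rank_le ?C (U l0 l1 t)
       (\<lambda>c u. (\<lambda>(w, p) b. wreath G (take (count_list p 2) w) (p @ b @ [2])) ((\<lambda>(w, p, s). (w, p)) c) (take l0 u)) (R + 1)"
      by (rule rank_le_pullback[OF rank_wreath_left[OF R[OF that(1)]]]) (use bin in auto)
    have r3: "rank_le ?C (U l0 l1 t)
       (\<lambda>c u. (\<lambda>(w, s) b. wreath G w (2 # b @ s))
          ((\<lambda>(w, p, s). (drop (t - 1) (drop (count_list p 2) w), s)) c) (drop (d - l1) u)) (R + 1)"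
      by (rule rank_le_pullback[OF rank_wreath_right[OF R[OF that(2)]]]) (use bin in auto)
    have r2: "rank_le ?C (U l0 l1 t)
       (\<lambda>(w, p, s) u. wreath G (take (t - 1) (drop (count_list p 2) w)) (mid u)) (card V)"
    proof (rule rank_leI_sum[OF V(1) order_refl])
      fix c u assume c: "c \<in> ?C" and u: "u \<in> U l0 l1 t"
      obtain w p s where cw: "c = (w, p, s)" "w \<in> \<Omega>" using c by auto
      define v where "v = take (t - 1) (drop (count_list p 2) w)"
      have "wreath G v (mid u) = (\<Sum>x\<in>V. of_bool (v = x) * wreath G x (mid u))"
      proof (cases "v \<in> V")
        case True
        then show ?thesis using V(1) by (simp add: of_bool_def if_distrib[of "\<lambda>x. x * _"] cong: if_cong)
      next
        case False
        have "take (count_list p 2) w @ v @ drop (t - 1) (drop (count_list p 2) w) \<in> \<Omega>"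
          unfolding v_def append_take_drop_id by (rule cw(2))
        from V(3)[OF this len[OF u]] False have "wreath G v (mid u) = 0" by blast
        moreover have "(\<Sum>x\<in>V. of_bool (v = x) * wreath G x (mid u)) = 0"
          by (rule sum.neutral) (use False in auto)
        ultimately show ?thesis by simp
      qed
      then show "(case c of (w, p, s) \<Rightarrow> \<lambda>u. wreath G (take (t - 1) (drop (count_list p 2) w)) (mid u)) u =
         (\<Sum>x\<in>V. (\<lambda>(w, p, s) x. of_bool (take (t - 1) (drop (count_list p 2) w) = x)) c x * wreath G x (mid u))"
        by (simp add: cw v_def)
    qed
    show ?thesis
      using rank_le_mult[OF rank_le_mult[OF r1 r2] r3] eq
      by (subst rank_le_cong) auto
  qed
  have r: "rank_le ?C {u. length u = d \<and> set u \<subseteq> {0, 1, 2}} ?M (card J * ?n)"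
  proof (rule rank_le_UN_cols)
    show "finite J" by (simp add: J_def)
    show "rank_le ?C (UU j) ?M ?n" if "j \<in> J" for j
    proof (cases j)
      case None
      have "R * 1 * 1 \<le> ?n" using V(2) by (intro mult_le_mono) auto
      then show ?thesis using rank_le_mono[OF rank_wreath_binary[OF R[OF order_refl] d], of ?n ?C "binwords d"] None
        by (simp add: UU_def)
    next
      case (Some a)
      then show ?thesis using that rU by (auto simp: J_def UU_def)
    qed
    fix u assume u: "u \<in> {u. length u = d \<and> set u \<subseteq> {0, 1, 2::nat}}"
    show "\<exists>j\<in>J. u \<in> UU j"
    proof (cases "2 \<in> set u")
      case False
      then have "u \<in> binwords d" using u by (auto simp: binwords_def)
      then show ?thesis by (intro bexI[of _ None]) (auto simp: J_def UU_def)
    next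
      case True
      then obtain b0 y where 1: "u = b0 @ 2 # y" "2 \<notin> set b0" by (auto dest: split_list_first)
      obtain y' b1 where 2: "2 # y = y' @ 2 # b1" "2 \<notin> set b1"
        using split_list_last[of 2 "2 # y"] by auto
      obtain y'' where y'': "y' @ [2] = 2 # y''" using 2 by (cases y') auto
      have u': "u = b0 @ (y' @ [2]) @ b1" using 1 2 by simp
      have "count_list u 2 \<le> d" using u count_le_length[of u 2] by simp
      then have c: "count_list (y' @ [2]) 2 \<le> d" by (simp add: u')
      have l: "length b0 \<le> d" "length b1 \<le> d" using u u' by auto
      have "b0 \<in> binwords (length b0)" "b1 \<in> binwords (length b1)"
        using u 1(2) 2(2) u' by (auto simp: binwords_def)
      then have "u \<in> U (length b0) (length b1) (count_list (y' @ [2]) 2)"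
        unfolding U_def using u u' y'' by blast
      then show ?thesis using c l
        by (intro bexI[of _ "Some (length b0, length b1, count_list (y' @ [2]) 2)"]) (auto simp: J_def UU_def)
    qed
  qed
  have "card J \<le> 2 * (d + 1) ^ 3"
  proof -
    have "card J \<le> Suc (card ({..d} \<times> {..d} \<times> {..d}))"
      unfolding J_def by (rule order_trans[OF card_insert_le_m1]) (auto simp: card_image)
    moreover have "card ({..d} \<times> {..d} \<times> {..d}) = (d + 1) ^ 3"
      by (simp only: card_cartesian_product card_atMost power3_eq_cube Suc_eq_plus1 mult.assoc)
    moreover have "1 \<le> (d + 1) ^ 3" by simp
    ultimately show ?thesis by linarith
  qed
  then have "card J * ?n \<le> 2 * (d + 1) ^ 3 * ?n" by (rule mult_le_mono1)
  then show ?thesis by (rule rank_le_mono[OF r]) auto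
qed

section \<open>Words dual to the index words\<close>

definition witness :: "nat \<Rightarrow> nat list" where
  "witness j = (SOME x. G j x = 1)"

lemma witness: "G j (witness j) = 1"
  unfolding witness_def using someI_ex[OF G_word[of j]] .

lemma witness_binary: "witness j \<in> binwords (period j - 1)"
  using G_support[of j "witness j"] by (simp add: witness)

definition encode :: "nat list \<Rightarrow> nat list" where
  "encode w = 2 # concat (map (\<lambda>j. witness j @ [2]) w)"

text \<open>Witnesses of different letters have different lengths because \<open>period\<close> is
  injective, so a gap filled with one of them is seen by its own index only.\<close>

lemma wreath_encode: "wreath G v (encode w) = of_bool (v = w)"
proof (induction v arbitrary: w)
  case Nil
  have "(encode w = [2]) = (w = [])" by (cases w) (auto simp: encode_def)
  then show ?case by auto
next
  case (Cons j v)
  show ?case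
  proof (cases w)
    case Nil
    have "wreath G (j # v) [2] = 0" using wreath_nonzeroD(3)[of G "j # v" "[2]"] by auto
    then show ?thesis using Nil by (simp add: encode_def)
  next
    case w: (Cons i w')
    have nb: "2 \<notin> set (witness i)" using witness_binary[of i] by (auto simp: binwords_def)
    have "encode w = 2 # witness i @ encode w'" by (simp add: encode_def w)
    moreover have "G j (witness i) = of_bool (j = i)"
    proof (cases "j = i")
      case False
      have "period j - 1 \<noteq> period i - 1"
        using period_strict_mono False period_pos[of i] period_pos[of j]
        by (metis One_nat_def Suc_pred strict_mono_eq)
      then have "witness i \<notin> binwords (period j - 1)"
        using witness_binary[of i] by (auto simp: binwords_def)
      then have "G j (witness i) = 0" using G_support by blast
      then show ?thesis using False by simp
    qed (simp add: witness)
    moreover obtain e where "encode w' = 2 # e" by (simp add: encode_def)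
    ultimately show ?thesis using Cons.IH[of w'] nb w
      by (auto simp: takeWhile_neq_append dropWhile_neq_append simp del: takeWhile_append dropWhile_append)
  qed
qed

lemma length_encode:
  assumes "\<And>j. j \<in> set w \<Longrightarrow> period j \<le> b"
  shows "length (encode w) \<le> length w * b + 1"
proof -
  have "length (witness j @ [2]) = period j" for j
    using witness_binary[of j] period_pos[of j] by (simp add: binwords_def)
  then have "length (concat (map (\<lambda>j. witness j @ [2]) w)) = (\<Sum>j\<leftarrow>w. period j)"
    by (simp add: length_concat o_def)
  also have "\<dots> \<le> (\<Sum>j\<leftarrow>w. b)" by (rule sum_list_mono) (use assms in auto)
  finally show ?thesis by (simp add: encode_def sum_list_triv)
qed

lemma encode_letters: "set (encode w) \<subseteq> {0, 1, 2}"
proof -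
  have "set (witness j) \<subseteq> {0, 1}" for j using witness_binary[of j] by (simp add: binwords_def)
  then have "(\<Union>j\<in>set w. set (witness j)) \<subseteq> {0, 1}" by (rule UN_least)
  moreover have "set (encode w) \<subseteq> insert 2 (\<Union>j\<in>set w. set (witness j))"
    by (auto simp: encode_def)
  ultimately show ?thesis by blast
qed

end

section \<open>Quotients of the free algebra and their growth\<close>

context vector_space
begin

lemma finite_basis_of_subset_span:
  assumes "finite F" "X \<subseteq> span F"
  obtains B where "B \<subseteq> X" "independent B" "X \<subseteq> span B" "finite B" "card B = dim X"
proof -
  obtain B where B: "B \<subseteq> X" "independent B" "X \<subseteq> span B" "card B = dim X" by (rule basis_exists)
  moreover have "finite B" using independent_span_bound[OF assms(1) B(2)] B(1) assms(2) by blast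
  ultimately show ?thesis using that by blast
qed

lemma independent_card_le_dim_span:
  assumes "finite F" "X \<subseteq> span F" "independent S" "S \<subseteq> span X"
  shows "finite S \<and> card S \<le> dim X"
proof -
  obtain B where B: "B \<subseteq> X" "independent B" "X \<subseteq> span B" "finite B" "card B = dim X"
    using finite_basis_of_subset_span[OF assms(1,2)] by blast
  have "S \<subseteq> span B" using assms(4) B(3) span_minimal[OF _ subspace_span] by blast
  from independent_span_bound[OF B(4) assms(3) this] B(5) show ?thesis by simp
qed

end

section \<open>Realisation of a quotient algebra by a linear projection\<close>

global_interpretation TT: vector_space_pair smul smul ..

locale word_ideal =
  fixes I :: "'f::field word_space set"
  assumes subspace_I: "T.subspace I"
    and left_I: "z \<in> I \<Longrightarrow> x * z \<in> I"
    and right_I: "z \<in> I \<Longrightarrow> z * x \<in> I"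
begin

text \<open>The quotient has to be a subspace of the word space itself. A basis of I is extended to
  a basis of the whole space; killing the former and fixing the new vectors gives one representative
  for each coset.\<close>

lemma ex_projection:
  "\<exists>\<pi>. Vector_Spaces.linear smul smul \<pi> \<and> (\<forall>z. \<pi> z - z \<in> I) \<and> (\<forall>z\<in>I. \<pi> z = 0)"
proof -
  obtain B where B: "B \<subseteq> I" "T.independent B" "I \<subseteq> T.span B" using T.maximal_independent_subset by blast
  obtain C where C: "B \<subseteq> C" "T.independent C" "UNIV \<subseteq> T.span C"
    using T.maximal_independent_subset_extend[of B UNIV] B by auto
  define \<pi> where "\<pi> = TT.construct C (\<lambda>b. if b \<in> B then 0 else b)"
  have lin: "Vector_Spaces.linear smul smul \<pi>" unfolding \<pi>_def by (rule TT.linear_construct[OF C(2)])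
  note hom = TT.linear_add[OF lin] TT.linear_scale[OF lin] TT.linear_0[OF lin]
  have basis: "\<pi> b = (if b \<in> B then 0 else b)" if "b \<in> C" for b
    unfolding \<pi>_def using TT.construct_basis[OF C(2) that] by simp
  have "T.span C \<subseteq> {z. \<pi> z - z \<in> I}"
  proof (rule T.span_minimal)
    show "C \<subseteq> {z. \<pi> z - z \<in> I}"
      using basis B(1) T.subspace_0[OF subspace_I] T.subspace_neg[OF subspace_I] by auto
    have "T.subspace {z. \<pi> z - z \<in> I} \<longleftrightarrow> True"
      unfolding T.subspace_def
      using T.subspace_0[OF subspace_I] T.subspace_add[OF subspace_I] T.subspace_scale[OF subspace_I]
      by (auto simp: hom) (metis (no_types, opaque_lifting) add_diff_add, metis T.scale_right_diff_distrib)
    then show "T.subspace {z. \<pi> z - z \<in> I}" by simp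
  qed
  moreover have "T.span B \<subseteq> {z. \<pi> z = 0}"
  proof (rule T.span_minimal)
    show "B \<subseteq> {z. \<pi> z = 0}" using basis C(1) by auto
    show "T.subspace {z. \<pi> z = 0}" unfolding T.subspace_def by (auto simp: hom)
  qed
  ultimately show ?thesis using lin B(3) C(3) by blast
qed

definition proj :: "'f word_space \<Rightarrow> 'f word_space" where
  "proj = (SOME \<pi>. Vector_Spaces.linear smul smul \<pi> \<and> (\<forall>z. \<pi> z - z \<in> I) \<and> (\<forall>z\<in>I. \<pi> z = 0))"

lemma linear_proj: "Vector_Spaces.linear smul smul proj"
  and proj_diff: "proj z - z \<in> I" and proj_I: "z \<in> I \<Longrightarrow> proj z = 0"
  using someI_ex[OF ex_projection, folded proj_def] by blast+

lemmas proj_add = TT.linear_add[OF linear_proj]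
  and proj_smul = TT.linear_scale[OF linear_proj]
  and proj_0 = TT.linear_0[OF linear_proj]
  and proj_minus = TT.linear_diff[OF linear_proj]
  and proj_sum = TT.linear_sum[OF linear_proj]

lemma proj_eq_0_iff: "proj z = 0 \<longleftrightarrow> z \<in> I"
proof
  assume "proj z = 0"
  then show "z \<in> I" using proj_diff[of z] T.subspace_neg[OF subspace_I, of "- z"] by simp
qed (rule proj_I)

lemma proj_proj_left: "proj (proj x * y) = proj (x * y)"
proof -
  have "proj (proj x * y) - proj (x * y) = proj ((proj x - x) * y)"
    by (simp add: proj_minus left_diff_distrib)
  also have "\<dots> = 0" by (intro proj_I right_I proj_diff)
  finally show ?thesis by simp
qed

lemma proj_proj_right: "proj (x * proj y) = proj (x * y)"
proof -
  have "proj (x * proj y) - proj (x * y) = proj (x * (proj y - y))"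
    by (simp add: proj_minus right_diff_distrib)
  also have "\<dots> = 0" by (intro proj_I left_I proj_diff)
  finally show ?thesis by simp
qed

definition qprod :: "'f word_space \<Rightarrow> 'f word_space \<Rightarrow> 'f word_space" where
  "qprod x y = proj (x * y)"

text \<open>The empty word is left out, since its image would act as a unit and could not be
  nilpotent in a nonzero algebra.\<close>

definition quot :: "'f word_space set" where
  "quot = proj ` {z. lookup z [] = 0}"

lemma lookup_mult_Nil:
  assumes "lookup x [] = 0"
  shows "lookup (x * y) [] = (0::'f)"
proof (rule ccontr)
  assume "lookup (x * y) [] \<noteq> 0"
  then have "[] \<in> keys (x * y)" by (simp add: in_keys_iff)
  then have "[] \<in> {u @ v | u v. u \<in> keys x \<and> v \<in> keys y}" using keys_mult_subset[of x y] by blast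
  then have "[] \<in> keys x" by auto
  then show False using assms by (simp add: in_keys_iff)
qed

lemma subspace_quot: "T.subspace quot"
proof -
  have "T.subspace {z. lookup z [] = 0}" by (auto simp: T.subspace_def lookup_add)
  then show ?thesis unfolding quot_def by (rule TT.linear_subspace_image[OF linear_proj])
qed

sublocale Q: assoc_algebra smul qprod quot
proof
  show "T.subspace quot" by (rule subspace_quot)
  show "qprod x y \<in> quot" if xy: "x \<in> quot" "y \<in> quot" for x y
  proof -
    obtain a b where "x = proj a" "y = proj b" "lookup a [] = 0" "lookup b [] = 0"
      using xy by (auto simp: quot_def)
    then have "qprod x y = proj (a * b)" "lookup (a * b) [] = 0"
      by (simp_all add: qprod_def proj_proj_left proj_proj_right lookup_mult_Nil)
    then show ?thesis by (auto simp: quot_def)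
  qed
  show "qprod (qprod x y) z = qprod x (qprod y z)" for x y z
    unfolding qprod_def proj_proj_left proj_proj_right mult.assoc ..
  show "qprod (x + y) z = qprod x z + qprod y z" "qprod x (y + z) = qprod x y + qprod x z" for x y z
    unfolding qprod_def distrib_left distrib_right proj_add by (rule refl)+
  show "qprod (smul c x) y = smul c (qprod x y)" "qprod x (smul c y) = smul c (qprod x y)" for c x y
    unfolding qprod_def smul_mult_left smul_mult_right proj_smul by (rule refl)+
qed

lemma pow_Suc_proj: "Q.pow_Suc (proj a) n = proj (a ^ Suc n)"
proof (induction n)
  case (Suc n)
  have "Q.pow_Suc (proj a) (Suc n) = proj (a ^ Suc n * a)"
    by (simp only: Q.pow_Suc.simps Suc qprod_def proj_proj_left proj_proj_right)
  then show ?case by (simp add: power_commutes mult.assoc)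
qed simp

definition gens :: "nat \<Rightarrow> 'f word_space set" where
  "gens n = (\<lambda>w. proj (mon w)) ` {w. 1 \<le> length w \<and> length w \<le> n \<and> set w \<subseteq> {0, 1, 2}}"

lemma finite_gens: "finite (gens n)"
proof -
  have "{w. 1 \<le> length w \<and> length w \<le> n \<and> set w \<subseteq> {0, 1, 2}} \<subseteq> {w. set w \<subseteq> {0, 1, 2::nat} \<and> length w \<le> n}"
    by auto
  then show ?thesis unfolding gens_def
    by (intro finite_imageI finite_subset[OF _ finite_lists_length_le[of "{0, 1, 2}" n]]) auto
qed

lemma gens_mono: "m \<le> n \<Longrightarrow> gens m \<subseteq> gens n"
  by (force simp: gens_def)

lemma gens_subset: "gens n \<subseteq> quot"
  unfolding gens_def quot_def
  by (rule image_subsetI, rule imageI) (auto simp: mon_def lookup_single when_def)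

lemma qprod_left_linear: "qprod (x + y) z = qprod x z + qprod y z" "qprod (smul a x) z = smul a (qprod x z)"
  "qprod 0 z = 0"
  and qprod_right_linear: "qprod z (x + y) = qprod z x + qprod z y" "qprod z (smul a x) = smul a (qprod z x)"
  "qprod z 0 = 0"
  by (simp_all add: qprod_def distrib_left distrib_right proj_add proj_smul proj_0 smul_mult_left smul_mult_right)

lemma qprod_span:
  assumes "x \<in> T.span S" "y \<in> T.span S'" "T.subspace B" "\<And>s s'. s \<in> S \<Longrightarrow> s' \<in> S' \<Longrightarrow> qprod s s' \<in> B"
  shows "qprod x y \<in> B"
proof -
  have 1: "qprod s y \<in> B" if "s \<in> S" for s
  proof -
    have "T.subspace {y. qprod s y \<in> B}"
      using assms(3) by (auto simp: T.subspace_def qprod_right_linear)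
    then have "T.span S' \<subseteq> {y. qprod s y \<in> B}" using assms(4)[OF that] by (intro T.span_minimal) auto
    then show ?thesis using assms(2) by blast
  qed
  have "T.subspace {x. qprod x y \<in> B}"
    using assms(3) by (auto simp: T.subspace_def qprod_left_linear)
  then have "T.span S \<subseteq> {x. qprod x y \<in> B}" using 1 by (intro T.span_minimal) auto
  then show ?thesis using assms(1) by blast
qed

lemma gens_mult: "x \<in> gens m \<Longrightarrow> y \<in> gens n \<Longrightarrow> qprod x y \<in> gens (m + n)"
  unfolding gens_def
  by (auto simp: qprod_def proj_proj_left proj_proj_right mon_mult intro!: image_eqI[OF refl])

lemma space_pow_subset_gens:
  assumes "V \<subseteq> T.span (gens D)"
  shows "Q.space_pow_Suc V k \<subseteq> T.span (gens (D * Suc k))"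
proof (induction k)
  case (Suc k)
  have "qprod x y \<in> T.span (gens (D * Suc (Suc k)))" if "x \<in> Q.space_pow_Suc V k" "y \<in> V" for x y
  proof (rule qprod_span[of x "gens (D * Suc k)" y "gens D"])
    fix s s' assume "s \<in> gens (D * Suc k)" "s' \<in> gens D"
    then have "qprod s s' \<in> gens (D * Suc k + D)" by (rule gens_mult)
    then show "qprod s s' \<in> T.span (gens (D * Suc (Suc k)))"
      by (simp add: algebra_simps T.span_base)
  qed (use that Suc assms in auto)
  then have "{qprod x y |x y. x \<in> Q.space_pow_Suc V k \<and> y \<in> V} \<subseteq> T.span (gens (D * Suc (Suc k)))" by blast
  then show ?case unfolding Q.space_pow_Suc.simps by (rule T.span_minimal) simp
qed (use assms in auto)

text \<open>Exponents are shifted by one: (j + 1) + (k + 1) has the index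
  \<open>Suc (j + k)\<close>.\<close>

lemma space_pow_mult:
  assumes "T.subspace V" "x \<in> Q.space_pow_Suc V j" "y \<in> Q.space_pow_Suc V k"
  shows "qprod x y \<in> Q.space_pow_Suc V (Suc (j + k))"
  using assms(3)
proof (induction k arbitrary: y)
  case 0
  then show ?case using assms(2) by (auto intro: T.span_base)
next
  case (Suc k)
  have sub: "T.subspace (Q.space_pow_Suc V n)" for n
    using assms(1) by (cases n) auto
  have "{qprod u v |u v. u \<in> Q.space_pow_Suc V k \<and> v \<in> V} \<subseteq> {y. qprod x y \<in> Q.space_pow_Suc V (Suc (j + Suc k))}"
  proof
    fix z assume "z \<in> {qprod u v |u v. u \<in> Q.space_pow_Suc V k \<and> v \<in> V}"
    then obtain u v where z: "z = qprod u v" "u \<in> Q.space_pow_Suc V k" "v \<in> V" by auto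
    have "qprod x z = qprod (qprod x u) v"
      by (simp add: z qprod_def proj_proj_left proj_proj_right mult.assoc)
    moreover have "qprod (qprod x u) v \<in> T.span {qprod u v |u v. u \<in> Q.space_pow_Suc V (j + Suc k) \<and> v \<in> V}"
      using Suc.IH[OF z(2)] z(3) by (intro T.span_base) auto
    ultimately show "z \<in> {y. qprod x y \<in> Q.space_pow_Suc V (Suc (j + Suc k))}" by simp
  qed
  moreover have "T.subspace {y. qprod x y \<in> Q.space_pow_Suc V (Suc (j + Suc k))}"
    using sub[of "Suc (j + Suc k)"] by (auto simp: T.subspace_def qprod_right_linear simp del: Q.space_pow_Suc.simps)
  ultimately have "T.span {qprod u v |u v. u \<in> Q.space_pow_Suc V k \<and> v \<in> V} \<subseteq>
      {y. qprod x y \<in> Q.space_pow_Suc V (Suc (j + Suc k))}" by (rule T.span_minimal)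
  then show ?case using Suc.prems by auto
qed

lemma proj_expansion:
  "proj z = (\<Sum>w\<in>keys z. smul (lookup z w) (proj (mon w)))"
  by (subst word_expansion[of z]) (simp add: proj_sum proj_smul)

end

locale ternary_word_ideal = word_ideal I for I :: "'f::field word_space set" +
  assumes letters_I: "\<not> set w \<subseteq> {0, 1, 2} \<Longrightarrow> mon w \<in> I"
    and nil_I: "lookup z [] = 0 \<Longrightarrow> \<exists>n\<ge>1. z ^ n \<in> I"
    and proper_I: "\<exists>w. w \<noteq> [] \<and> mon w \<notin> I"
begin

lemma quot_subset_span: "quot \<subseteq> (\<Union>n. T.span (gens n))"
proof
  fix x assume "x \<in> quot"
  then obtain z where z: "x = proj z" "lookup z [] = 0" by (auto simp: quot_def)
  obtain n where n: "\<And>w. w \<in> keys z \<Longrightarrow> length w < n"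
    using finite_maxlen[of "keys z"] by (metis finite_keys)
  have "proj (mon w) \<in> T.span (gens n)" if "w \<in> keys z" for w
  proof (cases "set w \<subseteq> {0, 1, 2}")
    case True
    have "w \<noteq> []" using that z(2) by (auto simp: in_keys_iff)
    then have "proj (mon w) \<in> gens n" using True n[OF that] by (auto simp: gens_def Suc_le_eq intro!: image_eqI[OF refl])
    then show ?thesis by (rule T.span_base)
  next
    case False
    then show ?thesis using proj_I[OF letters_I[OF False]] T.span_zero by simp
  qed
  then have "x \<in> T.span (gens n)"
    unfolding z(1) proj_expansion[of z] by (intro T.span_sum T.span_scale)
  then show "x \<in> (\<Union>n. T.span (gens n))" by blast
qed

lemma nil_quot: "Q.nil_algebra"
  unfolding Q.nil_algebra_def
proof
  fix x assume "x \<in> quot"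
  then obtain z where z: "x = proj z" "lookup z [] = 0" by (auto simp: quot_def)
  then obtain n where "n \<ge> 1" "z ^ n \<in> I" using nil_I by blast
  then have "Q.pow_Suc x (n - 1) = 0" unfolding z(1) pow_Suc_proj by (simp add: proj_I)
  then show "\<exists>n. Q.pow_Suc x n = 0" by blast
qed

lemma finitely_generated_quot: "Q.finitely_generated"
proof -
  have "Q.generates (gens 1)"
    unfolding Q.generates_def
  proof (intro conjI allI impI)
    show "gens 1 \<subseteq> quot" by (rule gens_subset)
    fix B assume B: "Q.subalgebra B \<and> gens 1 \<subseteq> B"
    then have sub: "T.subspace B" "B \<subseteq> quot" and mult: "\<And>x y. x \<in> B \<Longrightarrow> y \<in> B \<Longrightarrow> qprod x y \<in> B"
      by (auto simp: Q.subalgebra_def)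
    have gen: "proj (mon w) \<in> B" if "w \<noteq> []" "set w \<subseteq> {0, 1, 2}" for w
      using that
    proof (induction w rule: list_nonempty_induct)
      case (single x)
      then have "proj (mon [x]) \<in> gens 1" by (auto simp: gens_def intro!: image_eqI[OF refl])
      then show ?case using B by blast
    next
      case (cons x w)
      then have "proj (mon [x]) \<in> gens 1" by (auto simp: gens_def intro!: image_eqI[OF refl])
      then have "qprod (proj (mon [x])) (proj (mon w)) \<in> B" using B cons by (intro mult) auto
      then show ?case by (simp add: qprod_def proj_proj_left proj_proj_right mon_mult)
    qed
    have "gens n \<subseteq> B" for n
    proof
      fix x assume "x \<in> gens n"
      then obtain w where "x = proj (mon w)" "1 \<le> length w" "set w \<subseteq> {0, 1, 2}" by (auto simp: gens_def)
      then show "x \<in> B" using gen[of w] by fastforce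
    qed
    then have "T.span (gens n) \<subseteq> B" for n using sub(1) by (intro T.span_minimal) auto
    then show "B = quot" using sub(2) quot_subset_span by blast
  qed
  then show ?thesis unfolding Q.finitely_generated_def using finite_gens by blast
qed

text \<open>The spans increase with n and multiply into one another, so their union is a subalgebra
  containing V, and generation makes it everything.\<close>

lemma span_space_pow:
  assumes "T.subspace V" "Q.generates V"
  shows "quot \<subseteq> (\<Union>n. T.span (\<Union>k<n. Q.space_pow_Suc V k))"
proof -
  let ?U = "\<lambda>n. T.span (\<Union>k<n. Q.space_pow_Suc V k)"
  have V: "V \<subseteq> quot" using assms(2) by (simp add: Q.generates_def)
  have mono: "?U m \<subseteq> ?U n" if "m \<le> n" for m n using that by (intro T.span_mono) force
  have mult: "qprod x y \<in> ?U (m + n)" if "x \<in> ?U m" "y \<in> ?U n" for x y m n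
  proof (rule qprod_span[OF that])
    fix s s' assume "s \<in> (\<Union>k<m. Q.space_pow_Suc V k)" "s' \<in> (\<Union>k<n. Q.space_pow_Suc V k)"
    then obtain i j where ij: "i < m" "j < n" "s \<in> Q.space_pow_Suc V i" "s' \<in> Q.space_pow_Suc V j" by blast
    then have "qprod s s' \<in> Q.space_pow_Suc V (Suc (i + j))" by (intro space_pow_mult assms(1))
    moreover have "Suc (i + j) < m + n" using ij by linarith
    ultimately show "qprod s s' \<in> ?U (m + n)" by (intro T.span_base) blast
  qed simp
  have pow: "Q.space_pow_Suc V k \<subseteq> quot" for k
  proof (induction k)
    case (Suc k)
    then have "{qprod x y |x y. x \<in> Q.space_pow_Suc V k \<and> y \<in> V} \<subseteq> quot" using V Q.prod_closed by blast
    then show ?case unfolding Q.space_pow_Suc.simps by (rule T.span_minimal) (rule subspace_quot)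
  qed (use V in simp)
  have "?U n \<subseteq> quot" for n using pow by (intro T.span_minimal subspace_quot) auto
  then have sub: "(\<Union>n. ?U n) \<subseteq> quot" by blast
  have "T.subspace (\<Union>n. ?U n)"
    unfolding T.subspace_def
  proof (intro conjI ballI allI)
    show "0 \<in> (\<Union>n. ?U n)" using T.span_zero by blast
    fix x y assume "x \<in> (\<Union>n. ?U n)" "y \<in> (\<Union>n. ?U n)"
    then obtain m n where "x \<in> ?U m" "y \<in> ?U n" by blast
    then have "x \<in> ?U (max m n)" "y \<in> ?U (max m n)" using mono[of m "max m n"] mono[of n "max m n"] by auto
    then show "x + y \<in> (\<Union>n. ?U n)" using T.span_add by blast
  next
    fix c x assume "x \<in> (\<Union>n. ?U n)"
    then show "smul c x \<in> (\<Union>n. ?U n)" using T.span_scale by blast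
  qed
  moreover have "\<forall>x\<in>(\<Union>n. ?U n). \<forall>y\<in>(\<Union>n. ?U n). qprod x y \<in> (\<Union>n. ?U n)" using mult by blast
  ultimately have "Q.subalgebra (\<Union>n. ?U n)" using sub by (simp add: Q.subalgebra_def)
  moreover have "V \<subseteq> ?U 1" using T.span_superset by auto
  then have "V \<subseteq> (\<Union>n. ?U n)" by blast
  ultimately have "(\<Union>n. ?U n) = quot" using assms(2) unfolding Q.generates_def by blast
  then show ?thesis by simp
qed

text \<open>A unit equals all its powers, so nilness makes it 0, and then the algebra is zero, which
  \<open>proper_I\<close> excludes. Hence \<open>growth\<close> takes the branch of the unital
  hull.\<close>

lemma not_unital: "\<not> (\<exists>e. Q.is_unit e)"
proof
  assume "\<exists>e. Q.is_unit e"
  then obtain e where e: "Q.is_unit e" by blast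
  then have "Q.pow_Suc e n = e" for n by (induction n) (auto simp: Q.is_unit_def)
  moreover obtain n where "Q.pow_Suc e n = 0" using nil_quot e unfolding Q.nil_algebra_def Q.is_unit_def by blast
  ultimately have "e = 0" by metis
  obtain w where w: "w \<noteq> []" "mon w \<notin> I" using proper_I by blast
  then have "proj (mon w) \<in> quot" by (auto simp: quot_def mon_def lookup_single when_def)
  then have "proj (mon w) = qprod 0 (proj (mon w))" using e \<open>e = 0\<close> by (auto simp: Q.is_unit_def)
  then have "proj (mon w) = 0" by (simp add: qprod_left_linear)
  then show False using w by (simp add: proj_eq_0_iff)
qed

section \<open>Growth computed in the unital hull\<close>

sublocale hull: assoc_algebra Q.hull_scale Q.hull_prod Q.hull_carrier
  by (rule Q.assoc_algebra_hull)

lemma hull_span: "hull.span ({0} \<times> S) = {0} \<times> T.span S"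
proof
  have "hull.subspace ({0} \<times> T.span S)"
    using T.subspace_span[of S] by (auto simp: hull.subspace_def T.subspace_def Q.hull_scale_def zero_prod_def)
  then show "hull.span ({0} \<times> S) \<subseteq> {0} \<times> T.span S"
    by (rule hull.span_minimal[rotated]) (auto intro: T.span_base)
  have "T.subspace {x. (0, x) \<in> hull.span ({0} \<times> S)}"
    unfolding T.subspace_def
  proof (intro conjI ballI allI; clarsimp)
    show "(0, 0) \<in> hull.span ({0} \<times> S)" using hull.span_zero[of "{0} \<times> S"] by (simp add: zero_prod_def)
    show "(0, x + y) \<in> hull.span ({0} \<times> S)"
      if "(0, x) \<in> hull.span ({0} \<times> S)" "(0, y) \<in> hull.span ({0} \<times> S)" for x y
      using hull.span_add[OF that] by simp
    show "(0, smul c x) \<in> hull.span ({0} \<times> S)" if "(0, x) \<in> hull.span ({0} \<times> S)" for c x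
      using hull.span_scale[OF that, of c] by (simp add: Q.hull_scale_def)
  qed
  then have "T.span S \<subseteq> {x. (0, x) \<in> hull.span ({0} \<times> S)}"
    by (rule T.span_minimal[rotated]) (auto intro: hull.span_base)
  then show "{0} \<times> T.span S \<subseteq> hull.span ({0} \<times> S)" by auto
qed

lemma hull_space_pow: "hull.space_pow_Suc ({0} \<times> V) k = {0} \<times> Q.space_pow_Suc V k"
proof (induction k)
  case (Suc k)
  have "{Q.hull_prod x y |x y. x \<in> {0} \<times> Q.space_pow_Suc V k \<and> y \<in> {0} \<times> V} =
      {0} \<times> {qprod x y |x y. x \<in> Q.space_pow_Suc V k \<and> y \<in> V}"
    by (auto simp: Q.hull_prod_def)
  then show ?case by (simp add: Suc hull_span)
qed simp

lemma growth_eq: "Q.growth V n = hull.dim (insert (1, 0) ({0} \<times> (\<Union>k<n. Q.space_pow_Suc V k)))"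
proof -
  have "(\<Union>k<n. {0 :: 'f} \<times> Q.space_pow_Suc V k) = {0} \<times> (\<Union>k<n. Q.space_pow_Suc V k)" by auto
  then show ?thesis
    by (simp only: Q.growth_def not_unital if_False hull.unital_growth_def hull_space_pow hull.dim_span)
qed

lemma growth_le:
  assumes "finite W" "(\<Union>k<n. Q.space_pow_Suc V k) \<subseteq> T.span W"
  shows "Q.growth V n \<le> card W + 1"
proof -
  have "insert (1, 0) ({0} \<times> (\<Union>k<n. Q.space_pow_Suc V k)) \<subseteq> hull.span (insert (1, 0) ({0} \<times> W))"
  proof -
    have "{0} \<times> (\<Union>k<n. Q.space_pow_Suc V k) \<subseteq> hull.span ({0} \<times> W)"
      unfolding hull_span using assms(2) by auto
    also have "\<dots> \<subseteq> hull.span (insert (1, 0) ({0} \<times> W))" by (intro hull.span_mono) auto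
    finally show ?thesis by (auto intro: hull.span_base)
  qed
  then have "Q.growth V n \<le> card (insert (1, 0) ({0 :: 'f} \<times> W))"
    unfolding growth_eq by (rule hull.dim_le_card) (use assms(1) in auto)
  also have "\<dots> \<le> card ({0 :: 'f} \<times> W) + 1" using assms(1) by (simp add: card_insert_if)
  finally show ?thesis by (simp add: card_cartesian_product)
qed

lemma growth_ge:
  assumes "finite F" "(\<Union>k<n. Q.space_pow_Suc V k) \<subseteq> T.span F" "T.independent S" "finite S"
    "S \<subseteq> T.span (\<Union>k<n. Q.space_pow_Suc V k)"
  shows "card S + 1 \<le> Q.growth V n"
proof -
  let ?X = "insert (1, 0) ({0} \<times> (\<Union>k<n. Q.space_pow_Suc V k))"
  have X: "?X \<subseteq> hull.span (insert (1, 0) ({0} \<times> F))"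
  proof -
    have "{0} \<times> (\<Union>k<n. Q.space_pow_Suc V k) \<subseteq> hull.span ({0} \<times> F)"
      unfolding hull_span using assms(2) by auto
    also have "\<dots> \<subseteq> hull.span (insert (1, 0) ({0} \<times> F))" by (intro hull.span_mono) auto
    finally show ?thesis by (auto intro: hull.span_base)
  qed
  have ind0: "hull.independent ({0} \<times> S)"
  proof
    assume "hull.dependent ({0} \<times> S)"
    then obtain u v where v: "v \<in> {0} \<times> S" "u v \<noteq> 0" "(\<Sum>v\<in>{0} \<times> S. Q.hull_scale (u v) v) = 0"
      using hull.dependent_finite[of "{0} \<times> S"] assms(4) by auto
    have "(\<Sum>v\<in>{0} \<times> S. Q.hull_scale (u v) v) = (\<Sum>s\<in>S. Q.hull_scale (u (0, s)) (0, s))"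
    proof -
      have "{0 :: 'f} \<times> S = Pair 0 ` S" by auto
      then show ?thesis by (simp only:) (subst sum.reindex; simp add: inj_on_def)
    qed
    then have "snd (\<Sum>s\<in>S. Q.hull_scale (u (0, s)) (0, s)) = 0" using v(3) by simp
    then have "(\<Sum>s\<in>S. smul (u (0, s)) s) = 0"
      by (simp add: snd_sum Q.hull_scale_def)
    moreover obtain s where "s \<in> S" "u (0, s) \<noteq> 0" using v by auto
    ultimately have "T.dependent S" using assms(4) by (subst T.dependent_finite) (auto intro!: exI[of _ "\<lambda>s. u (0, s)"])
    then show False using assms(3) by simp
  qed
  have ind: "hull.independent (insert (1, 0) ({0} \<times> S))"
    using ind0 by (subst hull.independent_insert) (auto simp: hull_span)
  have sub: "insert (1, 0) ({0} \<times> S) \<subseteq> hull.span ?X"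
  proof -
    have "{0} \<times> S \<subseteq> hull.span ({0} \<times> (\<Union>k<n. Q.space_pow_Suc V k))"
      unfolding hull_span using assms(5) by auto
    also have "\<dots> \<subseteq> hull.span ?X" by (intro hull.span_mono) auto
    finally show ?thesis by (auto intro: hull.span_base)
  qed
  have "finite (insert (1, 0) ({0 :: 'f} \<times> F))" using assms(1) by simp
  from hull.independent_card_le_dim_span[OF this X ind sub]
  have "card (insert (1, 0) ({0 :: 'f} \<times> S)) \<le> hull.dim ?X" ..
  moreover have "card (insert (1 :: 'f, 0) ({0} \<times> S)) = card S + 1"
    using assms(4) by (subst card_insert_disjoint) (auto simp: card_cartesian_product)
  ultimately show ?thesis by (simp add: growth_eq)
qed

text \<open>Finitely many vectors span V, and each lies in the span of some \<open>gens m\<close>;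
  conversely each of the three letters lies in a finite sum of powers of V. One D serves for all of
  them, so up to asymptotic equivalence only the dimensions of \<open>gens n\<close> matter. The + 1
  is the unit of the hull.\<close>

lemma growth_comparison:
  assumes "Q.fin_dim_subspace V" "Q.generates V"
  obtains D where "D \<ge> 2"
    "\<And>n. Q.growth V n \<le> T.dim (gens (D * n)) + 1"
    "\<And>n. T.dim (gens n) + 1 \<le> Q.growth V (D * n)"
proof -
  obtain S0 where S0: "finite S0" "V = T.span S0" using assms(1) by (auto simp: Q.fin_dim_subspace_def)
  have subV: "T.subspace V" by (simp add: S0)
  have "S0 \<subseteq> quot" using assms(2) T.span_superset by (auto simp: S0 Q.generates_def)
  then have "\<forall>x\<in>S0. \<exists>n. x \<in> T.span (gens n)" using quot_subset_span by blast
  then obtain h where h: "\<And>x. x \<in> S0 \<Longrightarrow> x \<in> T.span (gens (h x))" by metis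
  have "\<forall>x\<in>gens 1. \<exists>n. x \<in> T.span (\<Union>k<n. Q.space_pow_Suc V k)"
    using span_space_pow[OF subV assms(2)] gens_subset by blast
  then obtain g where g: "\<And>x. x \<in> gens 1 \<Longrightarrow> x \<in> T.span (\<Union>k<g x. Q.space_pow_Suc V k)" by metis
  define D where "D = Suc (Suc (Max (insert 0 (h ` S0)) + Max (insert 0 (g ` gens 1))))"
  have hD: "h x \<le> D" if "x \<in> S0" for x
  proof -
    have "h x \<le> Max (insert 0 (h ` S0))" by (rule Max_ge) (use that S0(1) in auto)
    then show ?thesis unfolding D_def by linarith
  qed
  have gD: "g x \<le> D" if "x \<in> gens 1" for x
  proof -
    have "g x \<le> Max (insert 0 (g ` gens 1))" by (rule Max_ge) (use that finite_gens in auto)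
    then show ?thesis unfolding D_def by linarith
  qed
  have "S0 \<subseteq> T.span (gens D)"
    using h T.span_mono[OF gens_mono[OF hD]] by blast
  then have VD: "V \<subseteq> T.span (gens D)" unfolding S0(2) by (intro T.span_minimal) auto
  have U: "(\<Union>k<n. Q.space_pow_Suc V k) \<subseteq> T.span (gens (D * n))" for n
  proof -
    have "Q.space_pow_Suc V k \<subseteq> T.span (gens (D * n))" if "k < n" for k
    proof -
      have "gens (D * Suc k) \<subseteq> gens (D * n)" using that by (intro gens_mono mult_le_mono2) simp
      then show ?thesis using space_pow_subset_gens[OF VD, of k] T.span_mono by blast
    qed
    then show ?thesis by blast
  qed
  have upper: "Q.growth V n \<le> T.dim (gens (D * n)) + 1" for n
  proof -
    obtain B where B: "gens (D * n) \<subseteq> T.span B" "finite B" "card B = T.dim (gens (D * n))"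
      using T.finite_basis_of_subset_span[OF finite_gens T.span_superset] by metis
    have "(\<Union>k<n. Q.space_pow_Suc V k) \<subseteq> T.span B"
      using U[of n] T.span_minimal[OF B(1) T.subspace_span] by blast
    from growth_le[OF B(2) this] B(3) show ?thesis by simp
  qed
  have gen1: "x \<in> T.span (\<Union>k<D. Q.space_pow_Suc V k)" if "x \<in> gens 1" for x
  proof -
    have "(\<Union>k<g x. Q.space_pow_Suc V k) \<subseteq> (\<Union>k<D. Q.space_pow_Suc V k)" using gD[OF that] by force
    then show ?thesis using g[OF that] T.span_mono by blast
  qed
  have word: "proj (mon w) \<in> T.span (\<Union>k<D * length w. Q.space_pow_Suc V k)"
    if "w \<noteq> []" "set w \<subseteq> {0, 1, 2}" for w
    using that
  proof (induction w rule: list_nonempty_induct)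
    case (single x)
    then have "proj (mon [x]) \<in> gens 1" by (auto simp: gens_def intro!: image_eqI[OF refl])
    then show ?case using gen1 by simp
  next
    case (cons x w)
    then have x: "proj (mon [x]) \<in> gens 1" by (auto simp: gens_def intro!: image_eqI[OF refl])
    have "qprod (proj (mon [x])) (proj (mon w)) \<in> T.span (\<Union>k<D * length (x # w). Q.space_pow_Suc V k)"
    proof (rule qprod_span[OF gen1[OF x] cons.IH])
      fix s s' assume "s \<in> (\<Union>k<D. Q.space_pow_Suc V k)" "s' \<in> (\<Union>k<D * length w. Q.space_pow_Suc V k)"
      then obtain i j where ij: "i < D" "j < D * length w" "s \<in> Q.space_pow_Suc V i" "s' \<in> Q.space_pow_Suc V j" by blast
      then have "qprod s s' \<in> Q.space_pow_Suc V (Suc (i + j))" by (intro space_pow_mult subV)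
      moreover have "Suc (i + j) < D * length (x # w)" using ij by simp
      ultimately show "qprod s s' \<in> T.span (\<Union>k<D * length (x # w). Q.space_pow_Suc V k)"
        by (intro T.span_base) blast
    qed (use cons in auto)
    moreover have "qprod (proj (mon [x])) (proj (mon w)) = proj (mon (x # w))"
      by (simp add: qprod_def proj_proj_left proj_proj_right mon_mult)
    ultimately show ?case by simp
  qed
  have lower: "T.dim (gens n) + 1 \<le> Q.growth V (D * n)" for n
  proof -
    have sub: "gens n \<subseteq> T.span (\<Union>k<D * n. Q.space_pow_Suc V k)"
    proof
      fix x assume "x \<in> gens n"
      then obtain w where w: "x = proj (mon w)" "1 \<le> length w" "length w \<le> n" "set w \<subseteq> {0, 1, 2}"
        unfolding gens_def by blast
      have ne: "w \<noteq> []" using w(2) by auto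
      have "D * length w \<le> D * n" using w(3) by simp
      then have "(\<Union>k<D * length w. Q.space_pow_Suc V k) \<subseteq> (\<Union>k<D * n. Q.space_pow_Suc V k)"
        by (intro UN_mono) auto
      then show "x \<in> T.span (\<Union>k<D * n. Q.space_pow_Suc V k)"
        using word[OF ne w(4)] T.span_mono w(1) by blast
    qed
    obtain B where B: "B \<subseteq> gens n" "T.independent B" "finite B" "card B = T.dim (gens n)"
      using T.finite_basis_of_subset_span[OF finite_gens T.span_superset] by metis
    have "B \<subseteq> T.span (\<Union>k<D * n. Q.space_pow_Suc V k)" using B(1) sub by blast
    from growth_ge[OF finite_gens U B(2,3) this] B(4) show ?thesis by simp
  qed
  show ?thesis by (rule that[of D]) (use upper lower in \<open>auto simp: D_def\<close>)
qed

end

section \<open>Dimensions of the quotient from ranks and dual words\<close>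

context wreath_system
begin

lemma ternary_null_ideal:
  assumes "\<Omega> \<noteq> {}"
  shows "ternary_word_ideal null_ideal"
proof
  show "T.subspace null_ideal" by (rule null_ideal_subspace)
  show "x * z \<in> null_ideal" "z * x \<in> null_ideal" if "z \<in> null_ideal" for x z
    using null_ideal_mult[OF that] by auto
  show "mon w \<in> null_ideal" if "\<not> set w \<subseteq> {0, 1, 2}" for w
  proof -
    have "wreath G v (p @ w @ s) = 0" for v p s
      using wreath_letters[of v "p @ w @ s"] that by auto
    then show ?thesis by (simp add: null_ideal_def)
  qed
  show "\<exists>n\<ge>1. z ^ n \<in> null_ideal" if "lookup z [] = 0" for z
    using nil_modulo_null_ideal[of z] that by (simp add: in_keys_iff)
  obtain w where w: "w \<in> \<Omega>" using assms by blast
  have "mon (encode w) \<notin> null_ideal"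
  proof
    assume "mon (encode w) \<in> null_ideal"
    then have "ev (\<lambda>u. wreath G w ([] @ u @ [])) (mon (encode w)) = 0"
      using w unfolding null_ideal_def by blast
    then show False by (simp add: wreath_encode)
  qed
  then show "\<exists>w. w \<noteq> [] \<and> mon w \<notin> null_ideal" by (auto simp: encode_def)
qed

text \<open>If more than N words had independent images, a nonzero combination of them would be
  annihilated by all N column functions of the factorisation. It would lie in the ideal and so give
  a linear dependence in the quotient.\<close>

lemma dim_gens_le:
  assumes "\<Omega> \<noteq> {}"
    and "rank_le {(w, p, s). w \<in> \<Omega>} {w. 1 \<le> length w \<and> length w \<le> n \<and> set w \<subseteq> {0, 1, 2}}
      (\<lambda>(w, p, s) u. wreath G w (p @ u @ s)) N"
  shows "T.dim (word_ideal.gens null_ideal n) \<le> N"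
proof -
  interpret ternary_word_ideal null_ideal using ternary_null_ideal[OF assms(1)] .
  let ?W = "{w. 1 \<le> length w \<and> length w \<le> n \<and> set w \<subseteq> {0, 1, 2::nat}}"
  let ?M = "\<lambda>(w, p, s) u. wreath G w (p @ u @ s)"
  obtain B where B: "B \<subseteq> gens n" "T.independent B" "finite B" "card B = T.dim (gens n)"
    using T.finite_basis_of_subset_span[OF finite_gens T.span_superset] by metis
  obtain W where W: "W \<subseteq> ?W" "inj_on (\<lambda>w. proj (mon w)) W" "B = (\<lambda>w. proj (mon w)) ` W"
    using B(1) unfolding gens_def by (meson subset_image_inj)
  have finW: "finite W" using B(3) W(2,3) finite_imageD by blast
  have cardW: "card W = card B" using W(2,3) by (simp add: card_image)
  show ?thesis
  proof (rule ccontr)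
    assume "\<not> T.dim (gens n) \<le> N"
    then have "N < card W" using B(4) cardW by simp
    obtain \<alpha> \<beta> where M: "\<And>c u. c \<in> {(w, p, s). w \<in> \<Omega>} \<Longrightarrow> u \<in> ?W \<Longrightarrow> ?M c u = (\<Sum>i<N. \<alpha> c i * \<beta> i u)"
      using assms(2) unfolding rank_le_def by blast
    obtain a where a: "\<exists>u\<in>W. a u \<noteq> 0" "\<forall>i<N. (\<Sum>u\<in>W. a u * \<beta> i u) = 0"
      using homogeneous_system_nontrivial_solution[OF finW \<open>N < card W\<close>, of \<beta>] by blast
    define z where "z = (\<Sum>u\<in>W. smul (a u) (mon u))"
    have "z \<in> null_ideal"
      unfolding null_ideal_def
    proof safe
      fix w p s assume "w \<in> \<Omega>"
      have "ev (\<lambda>u. wreath G w (p @ u @ s)) z = (\<Sum>u\<in>W. a u * wreath G w (p @ u @ s))"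
        by (simp add: z_def ev_sum ev_smul)
      also have "\<dots> = (\<Sum>u\<in>W. a u * (\<Sum>i<N. \<alpha> (w, p, s) i * \<beta> i u))"
        using M[of "(w, p, s)"] W(1) \<open>w \<in> \<Omega>\<close> by (intro sum.cong) auto
      also have "\<dots> = (\<Sum>i<N. \<alpha> (w, p, s) i * (\<Sum>u\<in>W. a u * \<beta> i u))"
        unfolding sum_distrib_left by (subst sum.swap) (simp add: mult.left_commute)
      also have "\<dots> = 0" using a(2) by simp
      finally show "ev (\<lambda>u. wreath G w (p @ u @ s)) z = 0" .
    qed
    then have "(\<Sum>u\<in>W. smul (a u) (proj (mon u))) = 0"
      using proj_I[of z] by (simp add: z_def proj_sum proj_smul)
    then have "(\<Sum>b\<in>B. smul (a (the_inv_into W (\<lambda>w. proj (mon w)) b)) b) = 0"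
      unfolding W(3) by (subst sum.reindex[OF W(2)]) (simp add: the_inv_into_f_f[OF W(2)])
    moreover obtain u where u: "u \<in> W" "a u \<noteq> 0" using a(1) by blast
    moreover have "proj (mon u) \<in> B" using u(1) W(3) by blast
    moreover have "a (the_inv_into W (\<lambda>w. proj (mon w)) (proj (mon u))) \<noteq> 0"
      using u(2) the_inv_into_f_f[OF W(2) u(1)] by simp
    ultimately have "(\<exists>v\<in>B. a (the_inv_into W (\<lambda>w. proj (mon w)) v) \<noteq> 0) \<and>
        (\<Sum>b\<in>B. smul (a (the_inv_into W (\<lambda>w. proj (mon w)) b)) b) = 0" by metis
    then have "T.dependent B"
      unfolding T.dependent_finite[OF B(3)]
      by (rule exI[of _ "\<lambda>b. a (the_inv_into W (\<lambda>w. proj (mon w)) b)"])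
    then show False using B(2) by simp
  qed
qed

text \<open>In a linear relation between encodings, the functional with index word v reads off the
  coefficient of the encoding of v.\<close>

lemma card_le_dim_gens:
  assumes "finite \<Omega>'" "\<Omega>' \<subseteq> \<Omega>" "\<Omega>' \<noteq> {}" "\<And>w. w \<in> \<Omega>' \<Longrightarrow> length (encode w) \<le> n"
  shows "card \<Omega>' \<le> T.dim (word_ideal.gens null_ideal n)"
proof -
  interpret ternary_word_ideal null_ideal using ternary_null_ideal assms by blast
  let ?g = "\<lambda>w. proj (mon (encode w))"
  have coeff: "a v = 0" if "(\<Sum>w\<in>\<Omega>'. smul (a w) (?g w)) = 0" "v \<in> \<Omega>'" for a v
  proof -
    have "proj (\<Sum>w\<in>\<Omega>'. smul (a w) (mon (encode w))) = 0" using that(1) by (simp add: proj_sum proj_smul)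
    then have "(\<Sum>w\<in>\<Omega>'. smul (a w) (mon (encode w))) \<in> null_ideal" by (simp add: proj_eq_0_iff)
    then have "ev (\<lambda>u. wreath G v ([] @ u @ [])) (\<Sum>w\<in>\<Omega>'. smul (a w) (mon (encode w))) = 0"
      using that(2) assms(2) unfolding null_ideal_def by blast
    then have "(\<Sum>w\<in>\<Omega>'. a w * of_bool (v = w)) = 0"
      by (simp add: ev_sum ev_smul wreath_encode)
    then show ?thesis using assms(1) that(2) by (simp add: of_bool_def if_distrib cong: if_cong)
  qed
  have inj: "inj_on ?g \<Omega>'"
  proof (rule inj_onI, rule ccontr)
    fix v w assume vw: "v \<in> \<Omega>'" "w \<in> \<Omega>'" "?g v = ?g w" "v \<noteq> w"
    define a :: "nat list \<Rightarrow> 'f" where "a x = (if x = v then 1 else if x = w then - 1 else 0)" for x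
    have "(\<Sum>x\<in>\<Omega>'. smul (a x) (?g x)) = (\<Sum>x\<in>{v, w}. smul (a x) (?g x))"
      using assms(1) vw by (intro sum.mono_neutral_right) (auto simp: a_def)
    also have "\<dots> = 0" using vw by (simp add: a_def)
    finally have "a v = 0" using coeff vw(1) by blast
    then show False by (simp add: a_def)
  qed
  have "T.independent (?g ` \<Omega>')"
  proof
    assume "T.dependent (?g ` \<Omega>')"
    then obtain u x where x: "x \<in> ?g ` \<Omega>'" "u x \<noteq> 0" "(\<Sum>v\<in>?g ` \<Omega>'. smul (u v) v) = 0"
      using assms(1) by (subst (asm) T.dependent_finite) auto
    have "(\<Sum>w\<in>\<Omega>'. smul (u (?g w)) (?g w)) = 0" using x(3) by (subst (asm) sum.reindex[OF inj]) simp
    then have "u (?g w) = 0" if "w \<in> \<Omega>'" for w using coeff[of "\<lambda>w. u (?g w)"] that by blast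
    then show False using x by auto
  qed
  moreover have "?g ` \<Omega>' \<subseteq> gens n"
  proof safe
    fix w assume "w \<in> \<Omega>'"
    have "1 \<le> length (encode w)" by (simp add: encode_def)
    then show "?g w \<in> gens n" unfolding gens_def
      using assms(4)[OF \<open>w \<in> \<Omega>'\<close>] encode_letters[of w] by (intro image_eqI[OF refl]) auto
  qed
  ultimately have "card (?g ` \<Omega>') \<le> T.dim (gens n)"
    using T.independent_card_le_dim_span[OF finite_gens T.span_superset] T.span_superset by blast
  then show ?thesis using inj by (simp add: card_image)
qed

lemma wreath_length:
  "wreath G v z \<noteq> 0 \<Longrightarrow> j \<in> set v \<Longrightarrow> period j \<le> Suc (length z)"
proof (induction v arbitrary: z)
  case (Cons i v)
  then obtain r where z: "z = 2 # r" by (auto split: list.splits if_splits)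
  have nz: "G i (takeWhile (\<lambda>x. x \<noteq> 2) r) \<noteq> 0" "wreath G v (dropWhile (\<lambda>x. x \<noteq> 2) r) \<noteq> 0"
    using Cons.prems(1) by (simp_all add: z)
  show ?case
  proof (cases "j = i")
    case True
    have "length (takeWhile (\<lambda>x. x \<noteq> 2) r) = period j - 1"
      using G_support[OF nz(1)] True by (simp add: binwords_def)
    moreover have "length (takeWhile (\<lambda>x. x \<noteq> 2) r) \<le> length r" by (rule length_takeWhile_le)
    ultimately show ?thesis by (simp add: z)
  next
    case False
    then have "period j \<le> Suc (length (dropWhile (\<lambda>x. x \<noteq> 2) r))"
      using Cons.IH[OF nz(2)] Cons.prems(2) by simp
    moreover have "length (dropWhile (\<lambda>x. x \<noteq> 2) r) \<le> length r" by (rule length_dropWhile_le)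
    ultimately show ?thesis by (simp add: z)
  qed
qed simp

text \<open>\<open>rank_wreath\<close> is applied in each degree from 1 to n. An index word that
  does not vanish on z is shorter than z, and each of its gaps fits into z, so only the factors
  described by \<open>fac\<close> are needed.\<close>

lemma dim_gens_le_of_factors:
  assumes R: "\<And>l. l \<le> n \<Longrightarrow> rank_le UNIV (binwords l) (\<lambda>(j, p, s) u. G j (p @ u @ s)) R"
    and V: "finite V" "card V \<ge> 1"
    and fac: "\<And>x v y. x @ v @ y \<in> \<Omega> \<Longrightarrow> length v < n \<Longrightarrow> \<forall>j\<in>set v. period j \<le> Suc n \<Longrightarrow> v \<in> V"
    and "\<Omega> \<noteq> {}"
  shows "T.dim (word_ideal.gens null_ideal n) \<le> n * (2 * (n + 1) ^ 3 * ((R + 1) * card V * (R + 1)))"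
proof (rule dim_gens_le[OF \<open>\<Omega> \<noteq> {}\<close>])
  let ?C = "{(w :: nat list, p :: nat list, s :: nat list). w \<in> \<Omega>}"
  let ?M = "\<lambda>(w, p, s) u. wreath G w (p @ u @ s)"
  let ?N = "2 * (n + 1) ^ 3 * ((R + 1) * card V * (R + 1))"
  have "rank_le ?C {w. 1 \<le> length w \<and> length w \<le> n \<and> set w \<subseteq> {0, 1, 2}} ?M (card {1..n} * ?N)"
  proof (rule rank_le_UN_cols)
    fix d assume d: "d \<in> {1..n}"
    have "v \<in> V" if "x @ v @ y \<in> \<Omega>" "length z \<le> d" "wreath G v z \<noteq> 0" for x v y z
    proof (rule fac[OF that(1)])
      have "Suc (length v) \<le> length z" using wreath_nonzeroD(3)[OF that(3)] count_le_length[of z 2] by simp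
      then show "length v < n" using that(2) d by simp
      show "\<forall>j\<in>set v. period j \<le> Suc n"
        using wreath_length[OF that(3)] that(2) d by fastforce
    qed
    then have "rank_le ?C {u. length u = d \<and> set u \<subseteq> {0, 1, 2}} ?M (2 * (d + 1) ^ 3 * ((R + 1) * card V * (R + 1)))"
      using R d V by (intro rank_wreath) auto
    moreover have "2 * (d + 1) ^ 3 * ((R + 1) * card V * (R + 1)) \<le> ?N"
      using d by (intro mult_le_mono1 mult_le_mono2 power_mono) auto
    ultimately show "rank_le ?C {u. length u = d \<and> set u \<subseteq> {0, 1, 2}} ?M ?N"
      by (rule rank_le_mono) auto
  qed auto
  then show "rank_le ?C {w. 1 \<le> length w \<and> length w \<le> n \<and> set w \<subseteq> {0, 1, 2}} ?M (n * ?N)" by simp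
qed

end

section \<open>Choice of the parameters\<close>

text \<open>Let D k be the largest d \<le> k that is 0 or whose requirement holds from k onwards.
  The set of such d grows with k, which gives monotonicity, and each d enters it eventually.\<close>

lemma slow_sequence_exists:
  assumes "\<And>d. \<exists>k0. \<forall>k\<ge>k0. Q d k"
  obtains D :: "nat \<Rightarrow> nat" where "mono D" "\<And>k. D k \<le> k" "\<And>k. D k = 0 \<or> Q (D k) k" "\<And>n. \<exists>k. n \<le> D k"
proof -
  define A where "A k = {d. d \<le> k \<and> (d = 0 \<or> (\<forall>k'\<ge>k. Q d k'))}" for k
  define D where "D k = Max (A k)" for k
  have fin: "finite (A k)" for k unfolding A_def by (rule finite_subset[of _ "{..k}"]) auto
  have ne: "0 \<in> A k" for k by (simp add: A_def)
  have mem: "D k \<in> A k" for k unfolding D_def using fin ne by (intro Max_in) auto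
  show ?thesis
  proof
    show "mono D"
    proof (rule monoI)
      fix k l :: nat assume "k \<le> l"
      then have "A k \<subseteq> A l" by (auto simp: A_def)
      then show "D k \<le> D l" unfolding D_def using fin ne by (intro Max_mono) auto
    qed
    show "D k \<le> k" "D k = 0 \<or> Q (D k) k" for k using mem[of k] by (auto simp: A_def)
    show "\<exists>k. n \<le> D k" for n
    proof -
      obtain k0 where k0: "\<forall>k\<ge>k0. Q n k" using assms by blast
      then have "n \<in> A (max n k0)" by (auto simp: A_def)
      then have "n \<le> D (max n k0)" unfolding D_def using fin by (intro Max_ge) auto
      then show ?thesis by blast
    qed
  qed
qed

text \<open>With y = x div m one has x \<le> m (y + 1) and y + 1 \<le> 2^y.\<close>

lemma power_le_two_power:
  fixes x m :: nat
  assumes "m \<ge> 1"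
  shows "x ^ m \<le> m ^ m * 2 ^ x"
proof -
  have "x \<le> m * Suc (x div m)"
    using assms by (metis dividend_less_times_div less_imp_le not_one_le_zero gr0I mult_Suc_right add.commute)
  then have "x ^ m \<le> (m * Suc (x div m)) ^ m" by (intro power_mono) auto
  also have "\<dots> = m ^ m * Suc (x div m) ^ m" by (rule power_mult_distrib)
  also have "\<dots> \<le> m ^ m * (2 ^ (x div m)) ^ m"
    by (intro mult_le_mono2 power_mono) (auto simp: Suc_le_eq less_exp)
  also have "\<dots> = m ^ m * 2 ^ (x div m * m)" by (simp add: power_mult)
  also have "\<dots> \<le> m ^ m * 2 ^ x" by (intro mult_le_mono2 power_increasing) auto
  finally show ?thesis .
qed

lemma eventually_poly_le_two_power:
  "\<exists>x0. \<forall>x\<ge>x0. C * x ^ d + 1 \<le> (2 :: nat) ^ x"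
proof (intro exI allI impI)
  fix x assume x: "(C + 1) * Suc d ^ Suc d \<le> x"
  define M where "M = Suc d ^ Suc d"
  have M: "M \<ge> 1" unfolding M_def by (rule one_le_power) simp
  have "1 * 1 \<le> (C + 1) * M" using M by (intro mult_le_mono) auto
  then have "x \<ge> 1" using x unfolding M_def by linarith
  have "M * ((C + 1) * x ^ d) = (C + 1) * M * x ^ d" by (simp add: algebra_simps)
  also have "\<dots> \<le> x * x ^ d" using x unfolding M_def by (rule mult_le_mono1)
  also have "\<dots> \<le> M * 2 ^ x" using power_le_two_power[of "Suc d" x] by (simp add: M_def)
  finally have "(C + 1) * x ^ d \<le> 2 ^ x" using M by simp
  moreover have "1 \<le> x ^ d" using \<open>x \<ge> 1\<close> by simp
  ultimately show "C * x ^ d + 1 \<le> 2 ^ x" by (simp add: algebra_simps)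
qed

text \<open>The exponent in \<open>support_bound_le\<close>: 4^d costs 2 d because
  \<open>fpow k\<close> is at least 2, the number of multisets costs 2^(d+1) because
  \<open>fpow (Suc k)\<close> is a square, and the last 1 absorbs the added point.\<close>

definition degree_bound :: "nat \<Rightarrow> nat" where
  "degree_bound d = (if d = 0 then 0 else 2 * d + 2 ^ (d + 1) + 1)"

lemma degree_bound_mono: "c \<le> d \<Longrightarrow> degree_bound c \<le> degree_bound d"
  by (auto simp: degree_bound_def intro!: add_mono power_increasing)

lemma support_bound_le: "support_bound k d \<le> fpow k ^ degree_bound d"
proof (cases "d = 0")
  case False
  let ?q = "fpow k"
  have q: "2 \<le> ?q" by (rule fpow_ge_2)
  have "4 ^ d = (2 ^ (2 * d) :: nat)" by (simp add: power_mult)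
  also have "\<dots> \<le> ?q ^ (2 * d)" using q by (intro power_mono) auto
  finally have 1: "4 ^ d \<le> ?q ^ (2 * d)" .
  have "4 ^ d * fpow (Suc k) ^ (2 ^ d) = 4 ^ d * ?q ^ (2 ^ (d + 1))"
    by (simp add: fpow_Suc flip: power_mult)
  also have "\<dots> \<le> ?q ^ (2 * d) * ?q ^ (2 ^ (d + 1))" using 1 by (rule mult_le_mono1)
  also have "\<dots> = ?q ^ (2 * d + 2 ^ (d + 1))" by (simp add: power_add)
  finally have "support_bound k d \<le> ?q ^ (2 * d + 2 ^ (d + 1)) + 1"
    using False by (simp add: support_bound_def)
  also have "\<dots> \<le> ?q ^ (2 * d + 2 ^ (d + 1)) * 2" using q by simp
  also have "\<dots> \<le> ?q ^ (2 * d + 2 ^ (d + 1)) * ?q" using q by (rule mult_le_mono2)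
  finally show ?thesis using False by (simp add: degree_bound_def mult.commute)
qed (simp add: support_bound_def degree_bound_def)

text \<open>The exponents of 2 add up to 1 + (1 + 2 + ... + 2^(k-1)) = 2^k. Thus all lower levels
  together cost no more than one level.\<close>

lemma prod_fpow: "2 * (\<Prod>j<k. fpow j) = fpow k"
proof (induction k)
  case (Suc k)
  then have "2 * (\<Prod>j<Suc k. fpow j) = fpow k * fpow k" by simp
  then show ?case by (simp add: fpow_Suc power2_eq_square)
qed (simp add: fpow_def)

text \<open>Since \<open>fpow (Suc k)\<close> \<le> n^2, the two periods cost n^4. As D is monotone,
  the exponent of level k serves all lower levels, and by \<open>prod_fpow\<close> the product of
  the squared support bounds costs only four times that exponent.\<close>

lemma rank_bound_poly:
  assumes "mono D" "fpow k \<le> n"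
  shows "2 * period (Suc k) * period (Suc k) * (\<Prod>j<Suc k. support_bound j (D j) * support_bound j (D j)) + 1
    \<le> 3 * n ^ (4 + 4 * degree_bound (D k))"
proof -
  let ?e = "degree_bound (D k)"
  have n1: "1 \<le> n" using assms(2) fpow_ge_2[of k] by simp
  have q2: "fpow (Suc k) \<le> n ^ 2" unfolding fpow_Suc using assms(2) by (intro power_mono) auto
  have sb: "support_bound j (D j) \<le> fpow j ^ ?e" if "j < Suc k" for j
  proof -
    have "D j \<le> D k" using assms(1) that by (simp add: monoD)
    then have "fpow j ^ degree_bound (D j) \<le> fpow j ^ ?e"
      using fpow_ge_2[of j] by (intro power_increasing degree_bound_mono) auto
    then show ?thesis using support_bound_le[of j "D j"] by simp
  qed
  have "(\<Prod>j<Suc k. support_bound j (D j) * support_bound j (D j)) \<le> (\<Prod>j<Suc k. fpow j ^ ?e * fpow j ^ ?e)"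
    by (intro prod_mono conjI mult_le_mono sb) auto
  also have "\<dots> = ((\<Prod>j<Suc k. fpow j) ^ ?e) ^ 2"
    by (simp add: prod.distrib prod_power_distrib power2_eq_square power_mult_distrib mult_ac)
  also have "\<dots> \<le> ((n ^ 2) ^ ?e) ^ 2"
  proof -
    have "(\<Prod>j<Suc k. fpow j) \<le> fpow (Suc k)" using prod_fpow[of "Suc k"] by linarith
    then have "(\<Prod>j<Suc k. fpow j) \<le> n ^ 2" using q2 by linarith
    then show ?thesis by (intro power_mono) auto
  qed
  also have "\<dots> = n ^ (4 * ?e)" by (simp flip: power_mult add: mult_ac)
  finally have prod: "(\<Prod>j<Suc k. support_bound j (D j) * support_bound j (D j)) \<le> n ^ (4 * ?e)" .
  have p: "period (Suc k) \<le> n ^ 2" using q2 by (simp add: fpow_eq)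
  have "period (Suc k) * period (Suc k) * (\<Prod>j<Suc k. support_bound j (D j) * support_bound j (D j))
    \<le> n ^ 2 * n ^ 2 * n ^ (4 * ?e)" by (intro mult_le_mono p prod)
  also have "\<dots> = n ^ (4 + 4 * ?e)" by (simp flip: power_add)
  finally have a: "period (Suc k) * period (Suc k) * (\<Prod>j<Suc k. support_bound j (D j) * support_bound j (D j))
    \<le> n ^ (4 + 4 * ?e)" .
  have "1 \<le> n ^ (4 + 4 * ?e)" using n1 by (rule one_le_power)
  with a show ?thesis unfolding mult.assoc by linarith
qed

lemma ex_fpow_interval:
  assumes "n \<ge> 2"
  obtains k where "fpow k \<le> n" "n < fpow (Suc k)"
proof -
  define k where "k = (LEAST k. n < fpow (Suc k))"
  have "n < fpow (Suc n)"
    using less_exp[of n] less_exp[of "2 ^ Suc n"] unfolding fpow_def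
    by (metis less_trans less_exp power_strict_increasing_iff one_less_numeral_iff semiring_norm(76) lessI)
  then have 1: "n < fpow (Suc k)" unfolding k_def by (rule LeastI)
  have "fpow k \<le> n"
  proof (cases k)
    case 0
    then show ?thesis using assms by (simp add: fpow_def)
  next
    case (Suc l)
    then have "\<not> n < fpow (Suc l)" using not_less_Least[of l "\<lambda>k. n < fpow (Suc k)"] by (simp add: k_def)
    then show ?thesis using Suc by simp
  qed
  then show ?thesis using that 1 by blast
qed

section \<open>Relabelled truncated copies of the language\<close>

definition relabel :: "nat \<Rightarrow> nat \<Rightarrow> nat list \<Rightarrow> nat list" where
  "relabel q i w = map (\<lambda>a. i * q + a) w"

text \<open>The letter \<open>j\<close> has weight \<open>period j\<close>, so only finitely many copies of the language contain a
  letter of bounded weight; since the \<open>i\<close>-th copy is truncated at length \<open>2 ^ K i\<close>, all long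
  products of letters of bounded weight vanish.\<close>

definition truncated_copies :: "(nat \<Rightarrow> nat) \<Rightarrow> (nat \<Rightarrow> nat) \<Rightarrow> nat list set" where
  "truncated_copies f K = {relabel (f 1) i w | i k w. k \<le> K i \<and> w \<in> langW f k}"

lemma truncated_copies_bounded:
  assumes len: "\<And>k w. w \<in> langW f k \<Longrightarrow> length w = 2 ^ k" and f1: "f 1 \<ge> 1"
  shows "\<exists>B. \<forall>w\<in>truncated_copies f K. (\<exists>j\<in>set w. period j \<le> E) \<longrightarrow> length w \<le> B"
proof (intro exI ballI impI)
  fix w assume "w \<in> truncated_copies f K" and j: "\<exists>j\<in>set w. period j \<le> E"
  then obtain i k v where w: "w = relabel (f 1) i v" "k \<le> K i" "v \<in> langW f k" by (auto simp: truncated_copies_def)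
  obtain a where a: "period (i * f 1 + a) \<le> E" using j by (auto simp: w relabel_def)
  have "i * 1 \<le> i * f 1" using f1 by (rule mult_le_mono2)
  then have "i \<le> E" using period_gt[of "i * f 1 + a"] a by linarith
  have "length w = 2 ^ k" using len[OF w(3)] by (simp add: w relabel_def)
  also have "\<dots> \<le> 2 ^ K i" using w(2) by (intro power_increasing) auto
  also have "\<dots> \<le> (\<Sum>i\<le>E. 2 ^ K i)" using \<open>i \<le> E\<close> by (intro member_le_sum) auto
  finally show "length w \<le> (\<Sum>i\<le>E. 2 ^ K i)" .
qed

context
  fixes f :: "nat \<Rightarrow> nat"
  assumes f_pos: "\<And>n. n \<ge> 1 \<Longrightarrow> f n \<ge> 1"
    and f_incr: "\<And>n. n \<ge> 1 \<Longrightarrow> f n < f (Suc n)"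
    and f_submult: "\<And>n m. n \<ge> 1 \<Longrightarrow> m \<ge> 1 \<Longrightarrow> f (n + m) \<le> f n * f m"
begin

lemmas f_facts = f_pos f_incr f_submult

text \<open>A letter of copy i is at least i and smaller than its weight, so weights up to n + 1
  leave only the copies 0 to n. At most 2 n copies, n lengths and 32 n^2 f(4 n) factors of each
  length give 64 n^4 f(4 n). The empty word shows no letter that bounds its copy and is added
  separately.\<close>

lemma truncated_copies_factors:
  assumes "n \<ge> 1"
  obtains V where "finite V" "card V \<ge> 1" "card V \<le> 65 * n ^ 4 * f (4 * n)"
    "\<And>x v y. x @ v @ y \<in> truncated_copies f K \<Longrightarrow> length v < n \<Longrightarrow> \<forall>j\<in>set v. period j \<le> Suc n \<Longrightarrow> v \<in> V"
proof -
  define Fac where "Fac = (\<Union>l<n. factorsW f l)"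
  define V where "V = insert [] ((\<lambda>(i, v). relabel (f 1) i v) ` ({..n} \<times> Fac))"
  have fin: "finite Fac" unfolding Fac_def using card_factorsW(1)[OF f_facts] by auto
  then have finV: "finite V" by (simp add: V_def)
  have "card Fac \<le> (\<Sum>l<n. card (factorsW f l))" unfolding Fac_def by (rule card_UN_le) simp
  also have "\<dots> \<le> (\<Sum>l<n. 32 * n ^ 2 * f (4 * n))"
  proof (rule sum_mono)
    fix l assume l: "l \<in> {..<n}"
    have "card (factorsW f l) \<le> 32 * (l + 1) ^ 2 * f (4 * (l + 1))" by (rule card_factorsW(2)[OF f_facts])
    also have "\<dots> \<le> 32 * n ^ 2 * f (4 * n)"
      using l by (intro mult_le_mono mult_le_mono2 power_mono f_mono[OF f_facts]) auto
    finally show "card (factorsW f l) \<le> 32 * n ^ 2 * f (4 * n)" .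
  qed
  finally have cF: "card Fac \<le> n * (32 * n ^ 2 * f (4 * n))" by simp
  have "card V \<le> Suc (card ((\<lambda>(i, v). relabel (f 1) i v) ` ({..n} \<times> Fac)))"
    unfolding V_def using fin by (simp add: card_insert_if)
  also have "\<dots> \<le> Suc (card ({..n} \<times> Fac))"
    using card_image_le[of "{..n} \<times> Fac" "\<lambda>(i, v). relabel (f 1) i v"] fin by blast
  also have "\<dots> \<le> Suc ((2 * n) * (n * (32 * n ^ 2 * f (4 * n))))"
    unfolding card_cartesian_product using cF assms by (intro Suc_le_mono[THEN iffD2] mult_le_mono) auto
  also have "\<dots> = Suc (64 * n ^ 4 * f (4 * n))" by (simp add: power2_eq_square power4_eq_xxxx)
  also have "\<dots> \<le> 65 * n ^ 4 * f (4 * n)"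
  proof -
    have "1 * 1 \<le> n ^ 4 * f (4 * n)" using assms f_pos[of "4 * n"] by (intro mult_le_mono) auto
    then show ?thesis by simp
  qed
  finally have cV: "card V \<le> 65 * n ^ 4 * f (4 * n)" .
  have "v \<in> V" if v: "x @ v @ y \<in> truncated_copies f K" "length v < n" "\<forall>j\<in>set v. period j \<le> Suc n" for x v y
  proof (cases v)
    case (Cons j v')
    obtain i k w where w: "x @ v @ y = relabel (f 1) i w" "w \<in> langW f k"
      using v(1) by (auto simp: truncated_copies_def)
    obtain x' v0 y' where s: "w = x' @ v0 @ y'" "v = relabel (f 1) i v0"
      using w(1) unfolding relabel_def by (metis append_eq_map_conv)
    have "length v0 = length v" by (simp add: s relabel_def)
    moreover have "x' @ v0 @ y' \<in> langW f k" using w(2) s(1) by simp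
    ultimately have "v0 \<in> factorsW f (length v)"
      unfolding factorsW_def by (intro CollectI conjI exI)
    then have "v0 \<in> Fac" using v(2) unfolding Fac_def by (intro UN_I[of "length v"]) auto
    moreover have "i \<le> n"
    proof -
      obtain a where "j = i * f 1 + a" using s(2) Cons by (cases v0) (auto simp: relabel_def)
      moreover have "i * 1 \<le> i * f 1" using f_pos[of 1] by (intro mult_le_mono2) simp
      moreover have "period j \<le> Suc n" using v(3) Cons by simp
      ultimately show ?thesis using period_gt[of j] by linarith
    qed
    ultimately show ?thesis unfolding V_def using s(2) by force
  qed (simp add: V_def)
  moreover have "card V \<ge> 1"
    using card_mono[OF finV, of "{[]}"] by (simp add: V_def)
  ultimately show ?thesis using finV cV that by blast
qed

end

section \<open>Assembly of the algebra and the two growth bounds\<close>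

theorem theoremA2:
  fixes f \<omega> \<delta> :: "nat \<Rightarrow> nat"
  assumes f_pos: "f \<in> {1..} \<rightarrow> {1..}"
    and f_incr: "increasing f"
    and f_submult: "submultiplicative f"
    and w_pos: "\<omega> \<in> {1..} \<rightarrow> {1..}"
    and w_mono: "mono_on {1..} \<omega>"
    and w_superpoly: "super_polynomial \<omega>"
    and d_pos: "\<delta> \<in> {1..} \<rightarrow> {1..}"
    and d_mono: "mono_on {1..} \<delta>"
    and d_lim: "filterlim \<delta> at_top sequentially"
    and d_le: "\<forall>n\<ge>1. \<delta> n \<le> n"
  shows "\<exists>(scale :: 'f::field \<Rightarrow> 'f word_space \<Rightarrow> 'f word_space) prod R.
    assoc_algebra scale prod R \<and>
    assoc_algebra.finitely_generated scale prod R \<and>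
    assoc_algebra.nil_algebra prod R \<and>
    (\<forall>V. assoc_algebra.fin_dim_subspace scale V \<and> assoc_algebra.generates scale prod R V \<longrightarrow>
      (\<lambda>n. at_real f (real n / real (\<delta> n))) \<preceq> assoc_algebra.growth scale prod R V \<and>
      assoc_algebra.growth scale prod R V \<preceq> (\<lambda>n. \<omega> n * f n))"
proof -
  have fp: "f n \<ge> 1" if "n \<ge> 1" for n using f_pos that by auto
  have fi: "f n < f (Suc n)" if "n \<ge> 1" for n using f_incr that by (simp add: increasing_def)
  have fs: "f (n + m) \<le> f n * f m" if "n \<ge> 1" "m \<ge> 1" for n m
    using f_submult that by (simp add: submultiplicative_def)
  note ff = fp fi fs
  have wp: "\<omega> n \<ge> 1" if "n \<ge> 1" for n using w_pos that by auto
  have wm: "\<omega> m \<le> \<omega> n" if "1 \<le> m" "m \<le> n" for m n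
    using w_mono that by (auto simp: mono_on_def)
  have dp: "\<delta> n \<ge> 1" if "n \<ge> 1" for n using d_pos that by auto
  define q where "q = f 1"
  have q1: "q \<ge> 1" using fp[of 1] by (simp add: q_def)
  have w_poly: "\<exists>x0. \<forall>x\<ge>x0. x ^ m \<le> \<omega> x" if "m \<ge> 1" for m
  proof -
    have "filterlim (\<lambda>n. real (\<omega> n) / real n powr real m) at_top sequentially"
      using w_superpoly that unfolding super_polynomial_def by simp
    then have "eventually (\<lambda>n. 1 \<le> real (\<omega> n) / real n powr real m) sequentially"
      by (auto simp: filterlim_at_top)
    then obtain x0 where x0: "\<And>x. x \<ge> x0 \<Longrightarrow> 1 \<le> real (\<omega> x) / real x powr real m"
      by (auto simp: eventually_sequentially)
    show ?thesis
    proof (intro exI allI impI)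
      fix x assume x: "max x0 1 \<le> x"
      then have p: "real x powr real m = real x ^ m" "real x ^ m > 0" by (auto simp: powr_realpow)
      have "1 \<le> real (\<omega> x) / real x ^ m" using x0[of x] x unfolding p(1) by simp
      then have "real x ^ m \<le> real (\<omega> x)" using p(2) by (simp add: le_divide_eq)
      then show "x ^ m \<le> \<omega> x" by (metis of_nat_le_iff of_nat_power)
    qed
  qed
  \<comment> \<open>The exponent is the degree in n of the dimension bound to come: 1 + 3 + a + 4 +
    a with a = 4 + 4 \<open>degree_bound d\<close>.\<close>
  define Q where "Q d k \<longleftrightarrow> support_bound k d \<le> 2 ^ fpow k \<and>
    (\<forall>x\<ge>fpow k. x ^ (16 + 8 * degree_bound d) \<le> \<omega> x)" for d k
  have "\<exists>k0. \<forall>k\<ge>k0. Q d k" for d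
  proof -
    obtain x0 where x0: "\<And>x. x \<ge> x0 \<Longrightarrow> 4 ^ d * x ^ (2 ^ (d + 1)) + 1 \<le> (2 :: nat) ^ x"
      using eventually_poly_le_two_power[of "4 ^ d" "2 ^ (d + 1)"] by blast
    obtain x1 where x1: "\<And>x. x \<ge> x1 \<Longrightarrow> x ^ (16 + 8 * degree_bound d) \<le> \<omega> x"
      using w_poly[of "16 + 8 * degree_bound d"] by auto
    have "Q d k" if k: "k \<ge> max x0 x1" for k
    proof -
      have "k < fpow k" using period_gt[of k] by (simp add: fpow_eq)
      then have ge: "x0 \<le> fpow k" "x1 \<le> fpow k" using k by auto
      have "4 ^ d * fpow (Suc k) ^ (2 ^ d) = 4 ^ d * fpow k ^ (2 ^ (d + 1))"
        by (simp add: fpow_Suc flip: power_mult)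
      then have "support_bound k d \<le> 2 ^ fpow k"
        using x0[OF ge(1)] by (simp add: support_bound_def)
      then show ?thesis unfolding Q_def using x1 ge(2) by auto
    qed
    then show ?thesis by blast
  qed
  then obtain D where D: "mono D" "\<And>k. D k \<le> k" "\<And>k. D k = 0 \<or> Q (D k) k" "\<And>n. \<exists>k. n \<le> D k"
    using slow_sequence_exists[of Q] by blast
  have "support_bound k (D k) \<le> 2 ^ fpow k" for k
    using D(3)[of k] by (auto simp: Q_def support_bound_def[of k 0])
  then obtain c :: "nat \<Rightarrow> nat list \<Rightarrow> 'f" and S \<tau> where
    c: "\<And>k. finite (S k)" "\<And>k. card (S k) \<le> support_bound k (D k)" "\<And>k t. t \<notin> S k \<Longrightarrow> c k t = 0"
    "\<And>k. \<tau> k \<in> binwords (radix k - 1)" "\<And>k. c k (\<tau> k) = 1" "\<And>k. satisfies_relations c k (D k)"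
    using toep_system_exists[of D] by metis
  \<comment> \<open>Above all weights of copy i, whose letters are at least i q and less than (i +
    1) q.\<close>
  define w where "w i = period (Suc i * q)" for i
  \<comment> \<open>Copy i is to serve the n with \<open>w i\<close> \<le> \<delta> n <
    \<open>w (Suc i)\<close>. As \<delta> tends to infinity these n are bounded, so truncating the
    copy loses nothing.\<close>
  have "\<exists>K. \<forall>n\<ge>1. \<delta> n < w (Suc i) \<longrightarrow> n \<le> 2 ^ K" for i
  proof -
    have "eventually (\<lambda>n. w (Suc i) \<le> \<delta> n) sequentially" using d_lim by (simp add: filterlim_at_top)
    then obtain N where N: "\<And>n. n \<ge> N \<Longrightarrow> w (Suc i) \<le> \<delta> n" by (auto simp: eventually_sequentially)
    have "n \<le> 2 ^ N" if "\<delta> n < w (Suc i)" for n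
    proof -
      have "n < N" using N[of n] that by force
      then show ?thesis using less_exp[of N] by linarith
    qed
    then show ?thesis by blast
  qed
  then obtain K where K: "\<And>i n. n \<ge> 1 \<Longrightarrow> \<delta> n < w (Suc i) \<Longrightarrow> n \<le> 2 ^ K i" by metis
  define \<Omega> where "\<Omega> = truncated_copies f K"
  interpret W: wreath_system "toep c" \<Omega>
  proof
    show "u \<in> binwords (period j - 1)" if "toep c j u \<noteq> 0" for j u
      using that by (auto simp: toep_def binwords_def split: if_splits)
    show "\<exists>x. toep c j x = 1" for j
    proof -
      have "length (\<tau> k) = radix k - 1" "set (\<tau> k) \<subseteq> {0, 1}" for k
        using c(4)[of k] by (simp_all add: binwords_def)
      with c(5) obtain x where "toep c j x = 1" by (rule toep_nonzero_word[of c \<tau> j])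
      then show ?thesis by blast
    qed
    show "\<exists>B. \<forall>w\<in>\<Omega>. (\<exists>j\<in>set w. period j \<le> E) \<longrightarrow> length w \<le> B" for E
      unfolding \<Omega>_def using fp[of 1] by (intro truncated_copies_bounded length_langW[OF ff]) auto
    fix g :: "'f word_space" and d assume g: "keys g \<subseteq> shortwords d - {[]}"
    \<comment> \<open>D is unbounded, so the relations of one level k cover all elements of degree
      below d, for every j and every context.\<close>
    obtain k where k: "max d 1 \<le> D k" using D(4) by blast
    have "D k \<le> period (Suc k)" using D(2)[of k] period_gt[of "Suc k"] by linarith
    moreover have "keys g \<subseteq> shortwords (D k) - {[]}" using g k by (auto simp: shortwords_def)
    ultimately have "ev (\<lambda>u. toep c j (p @ u @ s)) (g ^ (2 * period (Suc k))) = 0" for j p s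
      using k by (intro toep_power_zero[OF c(6)]) auto
    then show "\<exists>n\<ge>1. \<forall>j p s. ev (\<lambda>u. toep c j (p @ u @ s)) (g ^ n) = 0"
      by (intro exI[of _ "2 * period (Suc k)"]) (simp add: Suc_le_eq)
  qed
  have "[0] \<in> langW f 0" using q1 by (auto simp: q_def)
  then have \<Omega>_ne: "\<Omega> \<noteq> {}" unfolding \<Omega>_def truncated_copies_def by blast
  interpret A: ternary_word_ideal W.null_ideal by (rule W.ternary_null_ideal[OF \<Omega>_ne])

  \<comment> \<open>When D k = 0, Q gives no information. The exponent is then 16, and a constant
    takes care of the finitely many n at which n^16 exceeds \<omega> n.\<close>
  obtain C where C: "C \<ge> 1" "\<And>n. n \<ge> 1 \<Longrightarrow> n ^ 16 \<le> C * \<omega> n"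
  proof -
    obtain x0 where x0: "\<And>x. x \<ge> x0 \<Longrightarrow> x ^ 16 \<le> \<omega> x" using w_poly[of 16] by auto
    have "n ^ 16 \<le> (x0 ^ 16 + 1) * \<omega> n" if "n \<ge> 1" for n
    proof (cases "n \<ge> x0")
      case True
      then show ?thesis using x0[of n] by simp
    next
      case False
      then have "n ^ 16 \<le> x0 ^ 16" by (intro power_mono) auto
      then have "n ^ 16 \<le> x0 ^ 16 + 1" by linarith
      from mult_le_mono[OF this wp[OF that]] show ?thesis by (simp only: mult_1_right)
    qed
    then show ?thesis using that[of "x0 ^ 16 + 1"] by simp
  qed
  \<comment> \<open>9360 = 2 * 8 * 3 * 65 * 3, where 8 comes from (n + 1)^3 \<le> (2 n)^3 and each 3
    from R + 1.\<close>
  have upper: "T.dim (A.gens n) \<le> 9360 * (C * \<omega> n * f (4 * n))" if n: "n \<ge> 2" for n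
  proof -
    obtain k where k: "fpow k \<le> n" "n < fpow (Suc k)" using ex_fpow_interval[OF n] by blast
    define R where "R = 2 * period (Suc k) * period (Suc k) *
      (\<Prod>j<Suc k. support_bound j (D j) * support_bound j (D j))"
    define a where "a = 4 + 4 * degree_bound (D k)"
    have R: "R + 1 \<le> 3 * n ^ a" unfolding R_def a_def by (rule rank_bound_poly[OF D(1) k(1)])
    have sb1: "1 \<le> support_bound j (D j)" for j by (simp add: support_bound_def)
    have rank: "rank_le UNIV (binwords l) (\<lambda>(j, p, s) u. toep c j (p @ u @ s)) R" if "l \<le> n" for l
    proof -
      have "l \<le> period (Suc k)" using that k(2) unfolding fpow_eq by linarith
      from rank_toep[where c = c and S = S and N = "\<lambda>j. support_bound j (D j)", OF c(1-3) sb1 this]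
      show ?thesis unfolding R_def .
    qed
    obtain V where V: "finite V" "card V \<ge> 1" "card V \<le> 65 * n ^ 4 * f (4 * n)"
      "\<And>x v y. x @ v @ y \<in> \<Omega> \<Longrightarrow> length v < n \<Longrightarrow> \<forall>j\<in>set v. period j \<le> Suc n \<Longrightarrow> v \<in> V"
      using truncated_copies_factors[OF ff, of n K] n unfolding \<Omega>_def by auto
    have "T.dim (A.gens n) \<le> n * (2 * (n + 1) ^ 3 * ((R + 1) * card V * (R + 1)))"
      by (rule W.dim_gens_le_of_factors[OF rank V(1,2,4) \<Omega>_ne])
    also have "\<dots> \<le> n * (2 * (2 * n) ^ 3 * ((3 * n ^ a) * (65 * n ^ 4 * f (4 * n)) * (3 * n ^ a)))"
      using n by (intro mult_le_mono mult_le_mono2 power_mono R V(3)) auto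
    also have "\<dots> = 9360 * (n ^ (1 + 3 + a + 4 + a) * f (4 * n))"
    proof -
      have "n ^ (1 + 3 + a + 4 + a) = n * n ^ 3 * n ^ a * n ^ 4 * n ^ a"
        by (simp only: power_add power_one_right)
      then show ?thesis unfolding power_mult_distrib by (simp only:) simp
    qed
    also have "1 + 3 + a + 4 + a = 16 + 8 * degree_bound (D k)" by (simp add: a_def)
    also have "n ^ (16 + 8 * degree_bound (D k)) \<le> C * \<omega> n"
    proof (cases "D k = 0")
      case True
      then show ?thesis using C(2)[of n] n by (simp add: degree_bound_def)
    next
      case False
      then have "n ^ (16 + 8 * degree_bound (D k)) \<le> \<omega> n" using D(3)[of k] k(1) by (auto simp: Q_def)
      also have "\<dots> \<le> C * \<omega> n" using C(1) by simp
      finally show ?thesis .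
    qed
    finally show ?thesis by simp
  qed
  have lower: "f (n div \<delta> n) \<le> T.dim (A.gens (3 * n))" if n: "n \<ge> 1" and w0: "w 0 \<le> \<delta> n" for n
  proof -
    have i_lt: "i < w i" for i
      using period_gt[of "Suc i * q"] mult_le_mono2[OF q1, of "Suc i"] unfolding w_def by simp
    \<comment> \<open>The last copy whose weight bound is at most \<delta> n; by the choice of K,
      its truncation length \<open>2 ^ K i\<close> is still at least n.\<close>
    define i where "i = (GREATEST i. w i \<le> \<delta> n)"
    have bnd: "\<forall>i. w i \<le> \<delta> n \<longrightarrow> i \<le> \<delta> n" using i_lt by (meson less_imp_le order_trans)
    have wi: "w i \<le> \<delta> n" unfolding i_def
      by (rule GreatestI_nat[of "\<lambda>i. w i \<le> \<delta> n" 0 "\<delta> n"]) (use w0 bnd in auto)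
    have "\<not> w (Suc i) \<le> \<delta> n"
      using Greatest_le_nat[of "\<lambda>i. w i \<le> \<delta> n" "Suc i" "\<delta> n"] bnd unfolding i_def by fastforce
    then have nK: "n \<le> 2 ^ K i" using K[OF n] by simp
    define x where "x = n div \<delta> n"
    have x1: "x \<ge> 1" unfolding x_def using d_le n dp[OF n] by (simp add: Suc_le_eq div_greater_zero_iff)
    have xn: "x * \<delta> n \<le> n" "x \<le> n" by (simp_all add: x_def)
    obtain k where k: "x \<le> 2 ^ k" "2 ^ k < 2 * x" using ex_power_of_two[OF x1] by blast
    have "(2::nat) ^ k < 2 ^ Suc (K i)" using k xn nK by simp
    then have kK: "k \<le> K i" by (simp only: power_strict_increasing_iff)
    define \<Omega>' where "\<Omega>' = relabel q i ` langW f k"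
    have inj: "inj_on (relabel q i) (langW f k)"
      unfolding relabel_def by (intro inj_on_mapI) (auto simp: inj_on_def)
    have "f x \<le> f (2 ^ k)" using x1 k by (intro f_mono[OF ff]) auto
    also have "\<dots> \<le> card (langW f k)" by (rule card_langW_ge[OF ff])
    also have "\<dots> = card \<Omega>'" unfolding \<Omega>'_def using inj by (simp add: card_image)
    also have "\<dots> \<le> T.dim (A.gens (3 * n))"
    proof (rule W.card_le_dim_gens)
      show "finite \<Omega>'" unfolding \<Omega>'_def using finite_langW[OF ff] by blast
      show "\<Omega>' \<subseteq> \<Omega>" unfolding \<Omega>'_def \<Omega>_def truncated_copies_def q_def using kK by blast
      have "card (langW f k) \<ge> 1" using card_langW_ge[OF ff, of k] fp[of "2 ^ k"] by simp
      then have "langW f k \<noteq> {}" by (metis card.empty not_one_le_zero)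
      then show "\<Omega>' \<noteq> {}" by (simp add: \<Omega>'_def)
      fix v assume "v \<in> \<Omega>'"
      then obtain u where u: "v = relabel q i u" "u \<in> langW f k" by (auto simp: \<Omega>'_def)
      have "period j \<le> w i" if j: "j \<in> set v" for j
      proof -
        obtain a where "a \<in> set u" "j = i * q + a" using j by (auto simp: u relabel_def)
        then have "j \<le> Suc i * q" using set_langW[OF ff u(2)] by (auto simp: q_def)
        then show ?thesis unfolding w_def using period_strict_mono by (simp add: strict_mono_less_eq)
      qed
      then have "length (W.encode v) \<le> length v * w i + 1" by (rule W.length_encode)
      also have "length v = 2 ^ k" using length_langW[OF ff u(2)] by (simp add: u relabel_def)
      also have "2 ^ k * w i + 1 \<le> 2 * x * \<delta> n + 1" using k(2) wi by (intro add_mono mult_le_mono) auto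
      also have "\<dots> \<le> 3 * n" using xn n by simp
      finally show "length (W.encode v) \<le> 3 * n" .
    qed
    finally show ?thesis by (simp add: x_def)
  qed
  obtain N0 where N0: "\<And>n. n \<ge> N0 \<Longrightarrow> w 0 \<le> \<delta> n"
    using d_lim unfolding filterlim_at_top eventually_sequentially by blast
  have at_real: "at_real f (real n / real (\<delta> n)) = f (n div \<delta> n)" for n
    by (simp add: at_real_def floor_divide_of_nat_eq)
  have "(\<lambda>n. at_real f (real n / real (\<delta> n))) \<preceq> A.Q.growth V \<and>
      A.Q.growth V \<preceq> (\<lambda>n. \<omega> n * f n)"
    if V: "A.Q.fin_dim_subspace V" "A.Q.generates V" for V
  proof -
    obtain d where d: "d \<ge> 2" "\<And>n. A.Q.growth V n \<le> T.dim (A.gens (d * n)) + 1"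
      "\<And>n. T.dim (A.gens n) + 1 \<le> A.Q.growth V (d * n)"
      using A.growth_comparison[OF V] by blast
    \<comment> \<open>C1 absorbs the finitely many n with \<delta> n < \<open>w 0\<close>, for which
      not even copy 0 is light enough.\<close>
    define C1 where "C1 = f (N0 + 1) + 1"
    have "f (n div \<delta> n) \<le> C1 * A.Q.growth V (3 * d * n)" if n: "n \<ge> 1" for n
    proof -
      have g: "T.dim (A.gens (3 * n)) + 1 \<le> A.Q.growth V (3 * d * n)"
        using d(3)[of "3 * n"] by (simp add: mult.left_commute mult.assoc)
      show ?thesis
      proof (cases "w 0 \<le> \<delta> n")
        case True
        have "f (n div \<delta> n) \<le> A.Q.growth V (3 * d * n)" using lower[OF n True] g by linarith
        also have "\<dots> \<le> C1 * A.Q.growth V (3 * d * n)" by (simp add: C1_def)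
        finally show ?thesis .
      next
        case False
        then have "n < N0" using N0[of n] by force
        then have "n div \<delta> n \<le> N0 + 1" using div_le_dividend[of n "\<delta> n"] by linarith
        moreover have "1 \<le> n div \<delta> n" using d_le n dp[OF n] by (simp add: Suc_le_eq div_greater_zero_iff)
        ultimately have "f (n div \<delta> n) \<le> f (N0 + 1)" by (intro f_mono[OF ff])
        then have "f (n div \<delta> n) * 1 \<le> C1 * A.Q.growth V (3 * d * n)"
          using g by (intro mult_le_mono) (auto simp: C1_def)
        then show ?thesis by simp
      qed
    qed
    then have "\<forall>n\<ge>1. real (f (n div \<delta> n)) \<le> real C1 * real (A.Q.growth V (3 * d * n))"
      by (metis of_nat_le_iff of_nat_mult)
    moreover have "real C1 > 0" "3 * d > 0" using d(1) by (auto simp: C1_def)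
    ultimately have lo: "(\<lambda>n. at_real f (real n / real (\<delta> n))) \<preceq> A.Q.growth V"
      unfolding asymp_le_def at_real by blast
    define C2 where "C2 = 9360 * C + 1"
    have "A.Q.growth V n \<le> C2 * (\<omega> (4 * d * n) * f (4 * d * n))" if n: "n \<ge> 1" for n
    proof -
      \<comment> \<open>The factor d \<ge> 2 brings every n \<ge> 1 into the range of
        \<open>upper\<close>, which starts at \<open>fpow 0\<close> = 2.\<close>
      have dn: "d * n \<ge> 2" using d(1) n mult_le_mono[of 2 d 1 n] by simp
      have w4: "\<omega> (d * n) \<le> \<omega> (4 * d * n)" using dn by (intro wm) linarith+
      have "A.Q.growth V n \<le> 9360 * (C * \<omega> (d * n) * f (4 * (d * n))) + 1"
        using d(2)[of n] upper[OF dn] by linarith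
      also have "\<dots> \<le> 9360 * (C * \<omega> (4 * d * n) * f (4 * d * n)) + 1"
        using w4 by (simp add: mult.assoc)
      also have "1 \<le> \<omega> (4 * d * n) * f (4 * d * n)"
      proof -
        have "1 \<le> 4 * d * n" using dn by linarith
        from mult_le_mono[OF wp[OF this] fp[OF this]] show ?thesis by simp
      qed
      finally show ?thesis by (simp add: C2_def algebra_simps)
    qed
    then have "\<forall>n\<ge>1. real (A.Q.growth V n) \<le> real C2 * real (\<omega> (4 * d * n) * f (4 * d * n))"
      by (metis of_nat_le_iff of_nat_mult)
    moreover have "real C2 > 0" "4 * d > 0" using d(1) by (auto simp: C2_def)
    ultimately have "A.Q.growth V \<preceq> (\<lambda>n. \<omega> n * f n)"
      unfolding asymp_le_def by blast
    with lo show ?thesis by blast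
  qed
  then show ?thesis
    using A.Q.assoc_algebra_axioms A.finitely_generated_quot A.nil_quot by blast
qed

end
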